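(* Let $R$ be a Noetherian ring, $\mathbf a=a_1,\dots,a_s$ elements of $R$, $\mathfrak a=(a_1,\dots,a_s)$, $b\in R$, $\mathbf f=(b,a_1,\dots,a_s)$ and $I=(b,a_1,\dots,a_s)$, with $\operatorname{grade}(I)\ge1$. Then $$H_i({}_0\mathcal Z^+_\bullet(\mathbf a,\mathbf f))\simeq bH_i(a_1,\dots,a_s)\quad\text{for all } i\ge1,\qquad H_0({}_0\mathcal Z^+_\bullet(\mathbf a,\mathbf f))\simeq R/(\mathfrak a:b).$$ Furthermore, in the graded case (i.e. $R$ graded and $b,a_1,\dots,a_s$ homogeneous), $H_i({}_0\mathcal Z^+_\bullet(\mathbf a,\mathbf f))\simeq bH_i(a_1,\dots,a_s)((i+1)\deg(b))$ for $i\ge1$.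
   Context: $H_i(a_1,\dots,a_s)$ is the $i$-th homology of the Koszul complex $K_\bullet(a_1,\dots,a_s;R)$. The complex ${}_0\mathcal Z^+_\bullet(\mathbf a,\mathbf f)$. Put $r=s+1$, and let $Z_i(\mathbf f)$ be the $i$-th cycles of the Koszul complex $K_\bullet(\mathbf f;R)$. Let $S=R[T_0,T_1,\dots,T_s]$ with $\deg T_j=1$, $S_0=R$ ($T_0$ corresponds to $b$ and $T_i$ to $a_i$), and $\mathfrak g=(T_0,\dots,T_s)$; since each $a_i$ is itself one of the generators in $\mathbf f$, one takes $\gamma_i=T_i$ for $1\le i\le s$. Let $\mathcal Z_\bullet(\mathbf f)$ be the approximation complex $0\to Z_{r-1}(\mathbf f)\otimes_RS(-r+1)\to\cdots\to Z_0(\mathbf f)\otimes_RS\to0$, with differential the restriction of that of the Koszul complex $K_\bullet(T_0,\dots,T_s;S)$, and let $D_\bullet=\operatorname{Tot}(K_\bullet(\gamma_1,\dots,\gamma_s;S)\otimes_S\mathcal Z_\bullet(\mathbf f))$, where $K_p(\bm\gamma;S)$ is a direct sum of copies of $S(-p)$. Subscript $[0]$ denotes the degree-$0$ component for the $T$-grading. Then ${}_0\mathcal Z^+_\bullet$ is the complex with ${}_0\mathcal Z^+_0=(D_0)_{[0]}=R$ and ${}_0\mathcal Z^+_i=H^r_{\mathfrak g}(D_{i+r-1})_{[0]}$ for $1\le i\le s$. The differentials between terms with $i\ge1$ are induced by $D_\bullet$, and ${}_0\mathcal Z^+_1\to{}_0\mathcal Z^+_0$ is the map $\tau_0$ defined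 as follows: let $C^\bullet_{\mathfrak g}$ be the Čech complex of $S$ on $T_0,\dots,T_s$ and consider $\operatorname{Tot}(C^\bullet_{\mathfrak g}\otimes_SD_\bullet)$ with $C^p_{\mathfrak g}\otimes D_i$ in homological degree $i-p$; one has $H_0(\operatorname{Tot})_{[0]}\cong\operatorname{coker}\big(H^r_{\mathfrak g}(D_{r+1})_{[0]}\to H^r_{\mathfrak g}(D_r)_{[0]}\big)$, and $\tau_0$ is the composite $H^r_{\mathfrak g}(D_r)_{[0]}\to H_0(\operatorname{Tot})_{[0]}\to H_0(D_\bullet)_{[0]}=R$ whose second map is the edge homomorphism induced by the projection $\operatorname{Tot}\to C^0_{\mathfrak g}\otimes D_\bullet=D_\bullet$. In the graded case $S$ is bigraded with elements $x\in R$ of bidegree $(\deg x,0)$, $T_0$ of bidegree $(\deg b,1)$ and $T_i$ of bidegree $(\deg a_i,1)$, all maps above being bihomogeneous. *)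

theory Defs
  imports
    "HOL-Algebra.Algebra"
    "HOL-Algebra.Algebraic_Closure_Type"
    "HOL-Library.Poly_Mapping"
    "HOL-Library.Function_Algebras"
    "HOL-Library.Extended_Nat"
begin

text \<open>
  The ground ring \<open>R\<close> is a type of class \<open>comm_ring_1\<close>; \<open>RR\<close> is the same ring as a HOL-Algebra
  record. Modules over it are HOL-Algebra module records, whose two fields \<open>mult\<close> and \<open>one\<close> are
  irrelevant.
\<close>

abbreviation RR :: "'a::comm_ring_1 ring" where
  "RR \<equiv> ring_of_type_algebra"

section \<open>Modules and homology\<close>

definition module_on :: "('a \<Rightarrow> 'm \<Rightarrow> 'm) \<Rightarrow> 'm::ab_group_add set \<Rightarrow> ('a, 'm) module" where
  "module_on scale A =
     \<lparr>carrier = A, monoid.mult = undefined, one = undefined, ring.zero = 0, add = (+), module.smult = scale\<rparr>"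

definition quotient_module :: "('a, 'm) module \<Rightarrow> 'm set \<Rightarrow> ('a, 'm set) module" where
  "quotient_module M N =
     \<lparr>carrier = a_rcosets\<^bsub>M\<^esub> N, monoid.mult = undefined, one = undefined, ring.zero = N,
      add = set_add M, module.smult = (\<lambda>r Y. \<Union>x\<in>Y. N +>\<^bsub>M\<^esub> (r \<odot>\<^bsub>M\<^esub> x))\<rparr>"

definition module_iso :: "'a ring \<Rightarrow> ('a, 'm) module \<Rightarrow> ('a, 'n) module \<Rightarrow> ('m \<Rightarrow> 'n) set" where
  "module_iso R M N =
     {h \<in> iso (add_monoid M) (add_monoid N).
        \<forall>r\<in>carrier R. \<forall>x\<in>carrier M. h (r \<odot>\<^bsub>M\<^esub> x) = r \<odot>\<^bsub>N\<^esub> h x}"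

definition isomorphic_modules :: "'a ring \<Rightarrow> ('a, 'm) module \<Rightarrow> ('a, 'n) module \<Rightarrow> bool" where
  "isomorphic_modules R M N \<longleftrightarrow> module_iso R M N \<noteq> {}"

text \<open>\<open>homology_at A f B g C\<close> is the homology at \<open>B\<close> of \<open>f : A \<rightarrow> B\<close>, \<open>g : B \<rightarrow> C\<close>.\<close>

definition homology_at ::
  "('a, 'l) module \<Rightarrow> ('l \<Rightarrow> 'm) \<Rightarrow> ('a, 'm) module \<Rightarrow> ('m \<Rightarrow> 'n) \<Rightarrow> ('a, 'n) module
     \<Rightarrow> ('a, 'm set) module" where
  "homology_at A f B g C =
     quotient_module (B\<lparr>carrier := a_kernel B C g\<rparr>) (f ` carrier A)"

text \<open>The submodule \<open>b M\<close>.\<close>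

definition multiple_module :: "'a \<Rightarrow> ('a, 'm) module \<Rightarrow> ('a, 'm) module" where
  "multiple_module b M = M\<lparr>carrier := (\<lambda>x. b \<odot>\<^bsub>M\<^esub> x) ` carrier M\<rparr>"

text \<open>
  If \<open>M\<close> is a subquotient of a graded module and \<open>H\<close> is the set of homogeneous elements of a fixed
  degree upstairs, \<open>classes_of H M\<close> is the homogeneous component of \<open>M\<close> of that degree.
\<close>

definition classes_of :: "'m set \<Rightarrow> ('a, 'm set) module \<Rightarrow> 'm set set" where
  "classes_of H M = {Y \<in> carrier M. \<exists>x\<in>Y. x \<in> H}"

section \<open>Grade\<close>

definition regular_sequence :: "'a::comm_ring_1 list \<Rightarrow> bool" where
  "regular_sequence xs \<longleftrightarrow>
     (\<forall>i<length xs. \<forall>y. y * xs ! i \<in> Idl\<^bsub>RR\<^esub> (set (take i xs)) \<longrightarrow> y \<in> Idl\<^bsub>RR\<^esub> (set (take i xs))) \<and>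
     Idl\<^bsub>RR\<^esub> (set xs) \<noteq> UNIV"

definition grade :: "'a::comm_ring_1 set \<Rightarrow> enat" where
  "grade I = (if I = UNIV then \<infinity>
              else (SUP xs\<in>{xs. regular_sequence xs \<and> set xs \<subseteq> I}. enat (length xs)))"

definition colon :: "'a::comm_ring_1 set \<Rightarrow> 'a \<Rightarrow> 'a set" where
  "colon J b = {x. x * b \<in> J}"

section \<open>Koszul complexes\<close>

definition altsign :: "nat \<Rightarrow> 'm::ab_group_add \<Rightarrow> 'm" where
  "altsign n v = (if even n then v else - v)"

text \<open>
  For a finite \<open>N\<close>, an element \<open>\<Sum>\<^sub>K c\<^sub>K e\<^sub>K\<close> of the Koszul complex with coefficients in a module is
  the function \<open>c\<close>, where \<open>e\<^sub>K = e\<^sub>k\<^sub>1 \<and> \<dots> \<and> e\<^sub>k\<^sub>p\<close> for \<open>K = {k\<^sub>1 < \<dots> < k\<^sub>p} \<subseteq> N\<close>. The argument \<open>x l\<close> is the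
  action of the \<open>l\<close>-th element of the sequence on the coefficients, and the differential is
  \<open>e\<^sub>K \<mapsto> \<Sum>\<^sub>l\<^sub>\<in>\<^sub>K (-1)\<^bsup>#{k \<in> K. k < l}\<^esup> x\<^sub>l e\<^bsub>K - {l}\<^esub>\<close>.
\<close>

definition koszul_diff ::
  "nat set \<Rightarrow> (nat \<Rightarrow> 'm \<Rightarrow> 'm::ab_group_add) \<Rightarrow> (nat set \<Rightarrow> 'm) \<Rightarrow> nat set \<Rightarrow> 'm" where
  "koszul_diff N x c =
     (\<lambda>K. if K \<subseteq> N then \<Sum>l\<in>N - K. altsign (card {k \<in> K. k < l}) (x l (c (insert l K))) else 0)"

definition koszul_chains :: "nat set \<Rightarrow> nat \<Rightarrow> (nat set \<Rightarrow> 'm::zero) set" where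
  "koszul_chains N p = {c. \<forall>K. c K \<noteq> 0 \<longrightarrow> K \<subseteq> N \<and> card K = p}"

text \<open>\<open>K\<^sub>p((f\<^sub>l)\<^sub>l\<^sub>\<in>\<^sub>N; R)\<close>, its homology and its cycles.\<close>

definition koszul_module :: "nat set \<Rightarrow> nat \<Rightarrow> ('a::comm_ring_1, nat set \<Rightarrow> 'a) module" where
  "koszul_module N p = module_on (\<lambda>r c K. r * c K) (koszul_chains N p)"

text \<open>For \<open>p = 0\<close> the differential below leaving \<open>K\<^sub>0\<close> is zero.\<close>

definition koszul_homology ::
  "nat set \<Rightarrow> (nat \<Rightarrow> 'a) \<Rightarrow> nat \<Rightarrow> ('a::comm_ring_1, (nat set \<Rightarrow> 'a) set) module" where
  "koszul_homology N f p =
     (let d = koszul_diff N (\<lambda>l v. f l * v)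
      in homology_at (koszul_module N (p + 1)) d (koszul_module N p) d (koszul_module N (p - 1)))"

definition koszul_cycles :: "nat set \<Rightarrow> (nat \<Rightarrow> 'a) \<Rightarrow> nat \<Rightarrow> (nat set \<Rightarrow> 'a::comm_ring_1) set" where
  "koszul_cycles N f p = {c \<in> koszul_chains N p. koszul_diff N (\<lambda>l v. f l * v) c = 0}"

section \<open>The complex \<open>D = Tot (K(\<gamma>; S) \<otimes> \<Z>(f))\<close>\<close>

text \<open>
  Everything lives in the Laurent polynomial ring over \<open>R\<close> in variables \<open>T\<^sub>0, T\<^sub>1, \<dots>\<close>: the polynomial
  ring \<open>S = R[T\<^sub>0, \<dots>, T\<^sub>s]\<close> is the subring of \<open>poly_carrier s\<close>, and since the \<open>T\<^sub>j\<close> are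
  nonzerodivisors on \<open>S\<close>, its localizations at monomials are subrings as well.
  From here on \<open>f 0 = b\<close> and \<open>f i = a\<^sub>i\<close> for \<open>1 \<le> i \<le> s\<close>, so \<open>r = s + 1\<close>.
\<close>

type_synonym 'a laurent = "(nat \<Rightarrow>\<^sub>0 int) \<Rightarrow>\<^sub>0 'a"

definition Tvar :: "nat \<Rightarrow> 'a::comm_ring_1 laurent" where
  "Tvar j = Poly_Mapping.single (Poly_Mapping.single j 1) 1"

definition Const :: "'a::comm_ring_1 \<Rightarrow> 'a laurent" where
  "Const r = Poly_Mapping.single 0 r"

definition poly_carrier :: "nat \<Rightarrow> 'a::comm_ring_1 laurent set" where
  "poly_carrier s = {p. \<forall>\<alpha>\<in>Poly_Mapping.keys p.
     Poly_Mapping.keys \<alpha> \<subseteq> {..s} \<and> (\<forall>j. 0 \<le> Poly_Mapping.lookup \<alpha> j)}"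

text \<open>
  \<open>Z\<^sub>q(f) \<otimes>\<^sub>R S \<subseteq> K\<^sub>q(f; R) \<otimes>\<^sub>R S = K\<^sub>q(T\<^sub>0, \<dots>, T\<^sub>s; S)\<close> consists of the polynomials with coefficients
  in \<open>Z\<^sub>q(f)\<close>. The complex \<open>\<Z>(f)\<close> stops at \<open>q = r - 1 = s\<close>.
\<close>

definition approx_chains :: "nat \<Rightarrow> (nat \<Rightarrow> 'a) \<Rightarrow> nat \<Rightarrow> (nat set \<Rightarrow> 'a::comm_ring_1 laurent) set" where
  "approx_chains s f q =
     (if q \<le> s then {u. (\<forall>L. u L \<in> poly_carrier s) \<and>
                        (\<forall>\<alpha>. (\<lambda>L. Poly_Mapping.lookup (u L) \<alpha>) \<in> koszul_cycles {..s} f q)}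
      else {0})"

definition approx_diff :: "nat \<Rightarrow> (nat set \<Rightarrow> 'a::comm_ring_1 laurent) \<Rightarrow> nat set \<Rightarrow> 'a laurent" where
  "approx_diff s = koszul_diff {..s} (\<lambda>l p. Tvar l * p)"

text \<open>
  \<open>x M L\<close> is the coefficient of \<open>e\<^sub>M \<otimes> e\<^sub>L\<close>, where \<open>e\<^sub>M\<close> (\<open>M \<subseteq> {1..s}\<close>) belongs to \<open>K(\<gamma>; S)\<close> with
  \<open>\<gamma>\<^sub>m = T\<^sub>m\<close>, and \<open>e\<^sub>L\<close> (\<open>L \<subseteq> {0..s}\<close>) to the ambient Koszul complex of \<open>\<Z>(f)\<close>.
\<close>

type_synonym 'a dchain = "nat set \<Rightarrow> nat set \<Rightarrow> 'a laurent"

definition D_chains :: "nat \<Rightarrow> (nat \<Rightarrow> 'a) \<Rightarrow> nat \<Rightarrow> 'a::comm_ring_1 dchain set" where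
  "D_chains s f i =
     {x. \<forall>M. if M \<subseteq> {1..s} \<and> card M \<le> i then x M \<in> approx_chains s f (i - card M) else x M = 0}"

definition D_diff :: "nat \<Rightarrow> 'a::comm_ring_1 dchain \<Rightarrow> 'a dchain" where
  "D_diff s x =
     koszul_diff {1..s} (\<lambda>m u L. Tvar m * u L) x + (\<lambda>M. altsign (card M) (approx_diff s (x M)))"

text \<open>
  The \<open>T\<close>-degree: \<open>e\<^sub>M\<close> and \<open>e\<^sub>L\<close> generate copies of \<open>S(-#M)\<close> and \<open>S(-#L)\<close>.
\<close>

definition T_homogeneous :: "int \<Rightarrow> 'a::comm_ring_1 dchain set" where
  "T_homogeneous n =
     {x. \<forall>M L. \<forall>\<alpha>\<in>Poly_Mapping.keys (x M L).
        (\<Sum>j\<in>Poly_Mapping.keys \<alpha>. Poly_Mapping.lookup \<alpha> j) + int (card M) + int (card L) = n}"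

section \<open>Cech complex and local cohomology\<close>

text \<open>
  The localization of a \<open>T\<close>-torsion-free \<open>S\<close>-module \<open>Y\<close> at \<open>\<Prod>\<^sub>j\<^sub>\<in>\<^sub>J T\<^sub>j\<close>, inside the module of Laurent
  polynomial chains.
\<close>

definition localization :: "nat set \<Rightarrow> 'a::comm_ring_1 dchain set \<Rightarrow> 'a dchain set" where
  "localization J Y = {x. \<exists>n. (\<lambda>M L. (\<Prod>j\<in>J. Tvar j) ^ n * x M L) \<in> Y}"

text \<open>
  \<open>C\<^sup>p \<otimes> D\<^sub>i\<close> is the direct sum of the localizations of \<open>D\<^sub>i\<close> at \<open>J \<subseteq> {0..s}\<close> with \<open>#J = p\<close>; an element
  is given by its components \<open>c J\<close>.
\<close>

type_synonym 'a cchain = "nat set \<Rightarrow> 'a dchain"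

definition cech_module ::
  "nat \<Rightarrow> (nat \<Rightarrow> 'a) \<Rightarrow> nat \<Rightarrow> nat \<Rightarrow> ('a::comm_ring_1, 'a cchain) module" where
  "cech_module s f p i = module_on (\<lambda>r c J M L. Const r * c J M L)
     {c. \<forall>J. if J \<subseteq> {..s} \<and> card J = p then c J \<in> localization J (D_chains s f i) else c J = 0}"

definition cech_diff :: "nat \<Rightarrow> 'a::comm_ring_1 cchain \<Rightarrow> 'a cchain" where
  "cech_diff s c =
     (\<lambda>J. if J \<subseteq> {..s} then \<Sum>j\<in>J. altsign (card {k \<in> J. k < j}) (c (J - {j})) else 0)"

text \<open>\<open>H\<^sup>p\<^sub>g(D\<^sub>i)\<close>, for \<open>p \<ge> 1\<close>.\<close>

definition local_cohomology ::
  "nat \<Rightarrow> (nat \<Rightarrow> 'a) \<Rightarrow> nat \<Rightarrow> nat \<Rightarrow> ('a::comm_ring_1, 'a cchain set) module" where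
  "local_cohomology s f p i =
     homology_at (cech_module s f (p - 1) i) (cech_diff s) (cech_module s f p i)
       (cech_diff s) (cech_module s f (p + 1) i)"

text \<open>The class in \<open>H\<^sup>p\<^sub>g(D\<^sub>i)\<close> of a cocycle \<open>c\<close>, and the map \<open>H\<^sup>p\<^sub>g(D\<^sub>i) \<rightarrow> H\<^sup>p\<^sub>g(D\<^bsub>i-1\<^esub>)\<close> induced by \<open>D\<close>.\<close>

definition lc_class :: "nat \<Rightarrow> (nat \<Rightarrow> 'a) \<Rightarrow> nat \<Rightarrow> nat \<Rightarrow> 'a cchain \<Rightarrow> 'a::comm_ring_1 cchain set" where
  "lc_class s f p i c =
     (cech_diff s ` carrier (cech_module s f (p - 1) i)) +>\<^bsub>cech_module s f p i\<^esub> c"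

definition lc_map ::
  "nat \<Rightarrow> (nat \<Rightarrow> 'a) \<Rightarrow> nat \<Rightarrow> nat \<Rightarrow> 'a cchain set \<Rightarrow> 'a::comm_ring_1 cchain set" where
  "lc_map s f p i Y = (\<Union>c\<in>Y. lc_class s f p (i - 1) (\<lambda>J. D_diff s (c J)))"

section \<open>The total complex of \<open>C \<otimes> D\<close>\<close>

text \<open>
  In homological degree \<open>0\<close> it is the sum of all \<open>C\<^sup>p \<otimes> D\<^sub>p\<close>; such an element has its component
  at \<open>J\<close> in the localization of \<open>D\<^bsub>#J\<^esub>\<close>.
\<close>

definition tot_chains0 :: "nat \<Rightarrow> (nat \<Rightarrow> 'a) \<Rightarrow> 'a::comm_ring_1 cchain set" where
  "tot_chains0 s f =
     {c. \<forall>J. if J \<subseteq> {..s} then c J \<in> localization J (D_chains s f (card J)) else c J = 0}"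

definition tot_diff :: "nat \<Rightarrow> 'a::comm_ring_1 cchain \<Rightarrow> 'a cchain" where
  "tot_diff s c = cech_diff s c + (\<lambda>J. altsign (card J) (D_diff s (c J)))"

definition tot_cycles0 :: "nat \<Rightarrow> (nat \<Rightarrow> 'a) \<Rightarrow> 'a::comm_ring_1 cchain set" where
  "tot_cycles0 s f = {c \<in> tot_chains0 s f. tot_diff s c = 0}"

definition T_homogeneous_C :: "int \<Rightarrow> 'a::comm_ring_1 cchain set" where
  "T_homogeneous_C n = {c. \<forall>J. c J \<in> T_homogeneous n}"

section \<open>The complex \<open>\<^sub>0\<Z>\<^sup>+\<close>\<close>

text \<open>
  \<open>Zplus s f i\<close> is the term of degree \<open>i \<ge> 1\<close>, and \<open>Zplus0 s f\<close> the term of degree \<open>0\<close>.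
  For \<open>i > s\<close> the former is zero, because \<open>D\<^sub>n = 0\<close> for \<open>n > 2 s\<close>.
\<close>

definition Zplus :: "nat \<Rightarrow> (nat \<Rightarrow> 'a) \<Rightarrow> nat \<Rightarrow> ('a::comm_ring_1, 'a cchain set) module" where
  "Zplus s f i =
     (let H = local_cohomology s f (s + 1) (i + s)
      in H\<lparr>carrier := classes_of (T_homogeneous_C 0) H\<rparr>)"

definition Zplus_diff ::
  "nat \<Rightarrow> (nat \<Rightarrow> 'a) \<Rightarrow> nat \<Rightarrow> 'a cchain set \<Rightarrow> 'a::comm_ring_1 cchain set" where
  "Zplus_diff s f i = lc_map s f (s + 1) (i + s)"

definition Zplus0 :: "nat \<Rightarrow> (nat \<Rightarrow> 'a) \<Rightarrow> ('a::comm_ring_1, 'a dchain) module" where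
  "Zplus0 s f = module_on (\<lambda>r x M L. Const r * x M L) (D_chains s f 0 \<inter> T_homogeneous 0)"

text \<open>
  Let \<open>x\<close> be a \<open>0\<close>-cycle of \<open>Tot(C \<otimes> D)\<close> of \<open>T\<close>-degree \<open>0\<close>. The isomorphism from \<open>H\<^sub>0(Tot)\<^bsub>[0]\<^esub>\<close> to the
  cokernel of \<open>H\<^sup>r(D\<^bsub>r+1\<^esub>)\<^bsub>[0]\<^esub> \<rightarrow> H\<^sup>r(D\<^sub>r)\<^bsub>[0]\<^esub>\<close> sends the class of \<open>x\<close> to the image of the class of its
  component in \<open>C\<^sup>r \<otimes> D\<^sub>r\<close>, and the edge homomorphism sends it to its component \<open>x {}\<close> in
  \<open>C\<^sup>0 \<otimes> D\<^sub>0 = D\<^sub>0\<close>; here \<open>H\<^sub>0(D)\<^bsub>[0]\<^esub> = (D\<^sub>0)\<^bsub>[0]\<^esub>\<close> because \<open>(D\<^sub>1)\<^bsub>[0]\<^esub> = 0\<close>.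
\<close>

definition top_component :: "nat \<Rightarrow> 'a::comm_ring_1 cchain \<Rightarrow> 'a cchain" where
  "top_component s c = (\<lambda>J. if card J = s + 1 then c J else 0)"

definition tau0 :: "nat \<Rightarrow> (nat \<Rightarrow> 'a) \<Rightarrow> 'a cchain set \<Rightarrow> 'a::comm_ring_1 dchain" where
  "tau0 s f \<xi> =
     (THE z. \<exists>x \<in> tot_cycles0 s f \<inter> T_homogeneous_C 0.
        lc_class s f (s + 1) (s + 1) (top_component s x)
          \<in> (Zplus_diff s f 2 ` carrier (Zplus s f 2)) +>\<^bsub>Zplus s f 1\<^esub> \<xi> \<and>
        z = x {})"

text \<open>The homology in degree \<open>i \<ge> 1\<close> and in degree \<open>0\<close>.\<close>

definition Zplus_homology ::
  "nat \<Rightarrow> (nat \<Rightarrow> 'a) \<Rightarrow> nat \<Rightarrow> ('a::comm_ring_1, 'a cchain set set) module" where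
  "Zplus_homology s f i =
     (if i = 1
      then homology_at (Zplus s f 2) (Zplus_diff s f 2) (Zplus s f 1) (tau0 s f) (Zplus0 s f)
      else homology_at (Zplus s f (i + 1)) (Zplus_diff s f (i + 1)) (Zplus s f i)
             (Zplus_diff s f i) (Zplus s f (i - 1)))"

definition Zplus_homology0 :: "nat \<Rightarrow> (nat \<Rightarrow> 'a) \<Rightarrow> ('a::comm_ring_1, 'a dchain set) module" where
  "Zplus_homology0 s f = quotient_module (Zplus0 s f) (tau0 s f ` carrier (Zplus s f 1))"

section \<open>Gradings\<close>

definition graded_ring :: "(int \<Rightarrow> 'a::comm_ring_1 set) \<Rightarrow> bool" where
  "graded_ring G \<longleftrightarrow>
     (\<forall>n. additive_subgroup (G n) (RR :: 'a ring)) \<and>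
     (\<forall>m n. \<forall>x\<in>G m. \<forall>y\<in>G n. x * y \<in> G (m + n)) \<and>
     (\<forall>x. \<exists>!c. (\<forall>n. c n \<in> G n) \<and> finite {n. c n \<noteq> 0} \<and> x = (\<Sum>n | c n \<noteq> 0. c n))"

text \<open>
  In the following, \<open>dg l\<close> is the degree of \<open>f l\<close>. The basis element \<open>e\<^sub>l\<close> of a Koszul complex of \<open>f\<close>
  has degree \<open>dg l\<close>; the variable \<open>T\<^sub>l\<close>, and hence the basis element with image \<open>T\<^sub>l\<close> in a Koszul
  complex of variables, has bidegree \<open>(dg l, 1)\<close>. All differentials then preserve degrees.
\<close>

definition koszul_homogeneous ::
  "(int \<Rightarrow> 'a::comm_ring_1 set) \<Rightarrow> (nat \<Rightarrow> int) \<Rightarrow> int \<Rightarrow> (nat set \<Rightarrow> 'a) set" where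
  "koszul_homogeneous G dg d = {c. \<forall>K. c K \<in> G (d - (\<Sum>k\<in>K. dg k))}"

definition bihomogeneous ::
  "(int \<Rightarrow> 'a::comm_ring_1 set) \<Rightarrow> (nat \<Rightarrow> int) \<Rightarrow> int \<Rightarrow> int \<Rightarrow> 'a cchain set" where
  "bihomogeneous G dg d n =
     {c \<in> T_homogeneous_C n. \<forall>J M L \<alpha>. Poly_Mapping.lookup (c J M L) \<alpha> \<in>
        G (d - (\<Sum>j\<in>Poly_Mapping.keys \<alpha>. Poly_Mapping.lookup \<alpha> j * dg j)
             - (\<Sum>m\<in>M. dg m) - (\<Sum>l\<in>L. dg l))}"

text \<open>The components of degree \<open>d\<close> of \<open>H\<^sub>i(a\<^sub>1, \<dots>, a\<^sub>s)\<close>, of \<open>b H\<^sub>i(a\<^sub>1, \<dots>, a\<^sub>s)\<close> and of \<open>H\<^sub>i(\<^sub>0\<Z>\<^sup>+)\<close>.\<close>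

definition koszul_homology_part ::
  "(int \<Rightarrow> 'a::comm_ring_1 set) \<Rightarrow> (nat \<Rightarrow> int) \<Rightarrow> nat set \<Rightarrow> (nat \<Rightarrow> 'a) \<Rightarrow> nat \<Rightarrow> int
     \<Rightarrow> (nat set \<Rightarrow> 'a) set set" where
  "koszul_homology_part G dg N f i d =
     classes_of (koszul_homogeneous G dg d) (koszul_homology N f i)"

definition multiple_part ::
  "(int \<Rightarrow> 'a::comm_ring_1 set) \<Rightarrow> (nat \<Rightarrow> int) \<Rightarrow> nat set \<Rightarrow> (nat \<Rightarrow> 'a) \<Rightarrow> 'a \<Rightarrow> nat \<Rightarrow> int
     \<Rightarrow> (nat set \<Rightarrow> 'a) set set" where
  "multiple_part G dg N f b i d =
     carrier (multiple_module b (koszul_homology N f i)) \<inter> koszul_homology_part G dg N f i d"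

definition Zplus_homology_part ::
  "(int \<Rightarrow> 'a::comm_ring_1 set) \<Rightarrow> (nat \<Rightarrow> int) \<Rightarrow> nat \<Rightarrow> (nat \<Rightarrow> 'a) \<Rightarrow> nat \<Rightarrow> int
     \<Rightarrow> 'a cchain set set set" where
  "Zplus_homology_part G dg s f i d =
     classes_of (classes_of (bihomogeneous G dg d 0) (Zplus s f i)) (Zplus_homology s f i)"

end

theory Submission
  imports Defs
begin

text \<open>
  The complex \<open>\<^sub>0\<Z>\<^sup>+\<close> is compared with a much smaller one: the cycle modules \<open>Z\<^sub>i(f)\<close>, \<open>i \<ge> 0\<close>, with the
  contraction \<open>\<iota>\<^sub>0\<close> by the dual of \<open>e\<^sub>0\<close> as differential, where \<open>e\<^sub>0\<close> belongs to \<open>b\<close>. The homology of the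
  latter is elementary. An element of \<open>Z\<^sub>i(f)\<close> killed by \<open>\<iota>\<^sub>0\<close> is a cycle \<open>v \<in> Z\<^sub>i(a)\<close>, and \<open>v = \<iota>\<^sub>0 z\<close> with
  \<open>z = e\<^sub>0 \<and> v - u \<in> Z\<^bsub>i + 1\<^esub>(f)\<close> means \<open>b v = d u\<close>. So the homology in degree \<open>i \<ge> 1\<close> is \<open>Z\<^sub>i(a)\<close> modulo
  the \<open>v\<close> for which \<open>b v\<close> is a boundary, which multiplication by \<open>b\<close> identifies with \<open>b H\<^sub>i(a)\<close>
  (\<open>multiple_boundary_iff\<close>). In degree \<open>0\<close> it is \<open>R\<close> modulo the coefficients of \<open>e\<^sub>0\<close> in first syzygies, that
  is \<open>R / (\<aa> : b)\<close> (\<open>first_syzygy_iff\<close>).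

  For the comparison, let \<open>e'\<^sub>1, \<dots>, e'\<^sub>s\<close> be the basis of \<open>K\<^sub>1(\<gamma>; S)\<close>. The differential of \<open>D\<close> is \<open>\<Sum>\<^sub>l T\<^sub>l \<kappa>\<^sub>l\<close>,
  where \<open>\<kappa>\<^sub>l\<close> contracts with the duals of \<open>e'\<^sub>l\<close> and \<open>e\<^sub>l\<close> simultaneously (only with that of \<open>e\<^sub>0\<close> for \<open>l = 0\<close>). The
  \<open>\<kappa>\<^sub>l\<close> anticommute, square to zero, and satisfy \<open>\<kappa>\<^sub>l e'\<^sub>m + e'\<^sub>m \<kappa>\<^sub>l = \<delta>\<^sub>l\<^sub>m\<close>. The top local cohomology of \<open>S\<close> has
  the monomials with only negative exponents as a basis (\<open>image_cech_diff\<close>), so the terms of \<open>\<^sub>0\<Z>\<^sup>+\<close> are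
  modules of inverse polynomials. On these, \<open>T\<^sub>m\<^sup>-\<^sup>1 e'\<^sub>m\<close> is a homotopy between the identity and a projection to
  the part with exponent \<open>-1\<close> in \<open>T\<^sub>m\<close> that is divisible by \<open>e'\<^sub>m\<close> (\<open>homotopy\<close>). After doing this for
  \<open>m = 1, \<dots>, s\<close>, only \<open>Z\<^sub>i(f) T\<^sub>0\<^sup>-\<^sup>i T\<^sub>1\<^sup>-\<^sup>1 \<dots> T\<^sub>s\<^sup>-\<^sup>1 e'\<^sub>1 \<and> \<dots> \<and> e'\<^sub>s\<close> is left in degree \<open>i\<close>, with differential
  \<open>\<plusminus>\<iota>\<^sub>0\<close>. The map \<open>psi\<close> is the corresponding retraction \<open>\<kappa>\<^sub>1 \<dots> \<kappa>\<^sub>s\<close>, with the properties \<open>psi_Dinv\<close>,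
  \<open>cycle_reduction\<close> and \<open>psi_top_elem\<close>. The grade enters only through \<open>Z\<^bsub>s + 1\<^esub>(f) = 0\<close>, which makes the
  truncation of \<open>\<Z>(f)\<close> harmless.

  It remains to see that \<open>\<tau>\<^sub>0\<close> is \<open>\<iota>\<^sub>0 \<circ> psi\<close>. The class of \<open>w (T\<^sub>0 \<dots> T\<^sub>s)\<^sup>-\<^sup>1\<close> lifts to the total cycle with
  components \<open>\<plusminus>(\<Prod>\<^sub>j\<^sub>\<in>\<^sub>J T\<^sub>j\<^sup>-\<^sup>1) \<kappa>\<^bsub>J'\<^esub> w\<close>, \<open>J'\<close> being the complement of \<open>J\<close> (\<open>lift_cycle_tot_cycle\<close>), whose component at
  \<open>{}\<close> is \<open>\<kappa>\<^sub>0 \<dots> \<kappa>\<^sub>s w\<close>. That any lift gives this value follows by walking along \<open>{} \<subseteq> {0} \<subseteq> {0, 1} \<subseteq> \<dots>\<close>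
  (\<open>initial_coef_Suc\<close>).

  All these maps act on representatives and respect degrees. The exponent \<open>-i\<close> of \<open>T\<^sub>0\<close> together with the
  multiplication by \<open>b\<close> produces the shift by \<open>(i + 1) deg b\<close>.
\<close>

section \<open>Presented modules\<close>

text \<open>
  \<open>M\<close> is the quotient \<open>A / B\<close>, the class of \<open>x\<close> being \<open>\<phi> x\<close>; \<open>sc\<close> is the scalar multiplication on
  representatives. Every module of the proof is an iterated subquotient, whose elements are sets of
  sets of chains. Keeping track of representatives all the way reduces each statement about such a
  module to one about chains.
\<close>

definition presents ::
  "('a \<Rightarrow> 'm \<Rightarrow> 'm) \<Rightarrow> 'm::ab_group_add set \<Rightarrow> 'm set \<Rightarrow> ('m \<Rightarrow> 'n) \<Rightarrow> ('a, 'n) module \<Rightarrow> bool" where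
  "presents sc A B \<phi> M \<longleftrightarrow>
     (\<forall>r x y. sc r (x - y) = sc r x - sc r y) \<and>
     0 \<in> A \<and> (\<forall>x\<in>A. \<forall>y\<in>A. x - y \<in> A) \<and> (\<forall>r. \<forall>x\<in>A. sc r x \<in> A) \<and>
     carrier M = \<phi> ` A \<and> (\<forall>x\<in>A. \<forall>y\<in>A. \<phi> x = \<phi> y \<longleftrightarrow> x - y \<in> B) \<and>
     (\<forall>x\<in>A. \<forall>y\<in>A. \<phi> x \<oplus>\<^bsub>M\<^esub> \<phi> y = \<phi> (x + y)) \<and>
     (\<forall>r. \<forall>x\<in>A. r \<odot>\<^bsub>M\<^esub> \<phi> x = \<phi> (sc r x)) \<and> \<zero>\<^bsub>M\<^esub> = \<phi> 0"

lemma presents_plus: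
  assumes "presents sc A B \<phi> M" "x \<in> A" "y \<in> A"
  shows "x + y \<in> A"
proof -
  have *: "\<forall>x\<in>A. \<forall>y\<in>A. x - y \<in> A" "0 \<in> A"
    using assms(1) unfolding presents_def by blast+
  then have "x - (0 - y) \<in> A"
    using assms by blast
  then show ?thesis
    by simp
qed

lemma presents_scale_plus:
  assumes "presents sc A B \<phi> M"
  shows "sc r (x + y) = sc r x + sc r y"
proof -
  have *: "sc r (x - y) = sc r x - sc r y" for x y
    using assms unfolding presents_def by blast
  have "sc r 0 = 0"
    using *[of 0 0] by simp
  then show ?thesis
    using *[of x "0 - y"] *[of 0 y] by simp
qed

lemma presents_eq_iff:
  "presents sc A B \<phi> M \<Longrightarrow> x \<in> A \<Longrightarrow> y \<in> A \<Longrightarrow> \<phi> x = \<phi> y \<longleftrightarrow> x - y \<in> B"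
  unfolding presents_def by blast

lemma presents_carrier: "presents sc A B \<phi> M \<Longrightarrow> carrier M = \<phi> ` A"
  unfolding presents_def by blast

lemma presents_zero: "presents sc A B \<phi> M \<Longrightarrow> \<zero>\<^bsub>M\<^esub> = \<phi> 0"
  unfolding presents_def by blast

lemma presents_eq_zero_iff:
  assumes "presents sc A B \<phi> M" "x \<in> A"
  shows "\<phi> x = \<zero>\<^bsub>M\<^esub> \<longleftrightarrow> x \<in> B"
  using assms presents_eq_iff[OF assms(1,2), of 0] unfolding presents_def by simp

lemma presents_module_on:
  assumes "\<And>r x y. sc r (x - y) = sc r x - sc r y" "0 \<in> A" "\<And>x y. x \<in> A \<Longrightarrow> y \<in> A \<Longrightarrow> x - y \<in> A"
    "\<And>r x. x \<in> A \<Longrightarrow> sc r x \<in> A"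
  shows "presents sc A {0} (\<lambda>x. x) (module_on sc A)"
  using assms unfolding presents_def module_on_def by simp

lemma presents_restrict:
  assumes "presents sc A B \<phi> M" "A' \<subseteq> A" "0 \<in> A'"
    "\<And>x y. x \<in> A' \<Longrightarrow> y \<in> A' \<Longrightarrow> x - y \<in> A'" "\<And>r x. x \<in> A' \<Longrightarrow> sc r x \<in> A'"
    "Y = \<phi> ` A'" "\<And>x. x \<in> A' \<Longrightarrow> x \<in> B \<longleftrightarrow> x \<in> B'"
  shows "presents sc A' B' \<phi> (M\<lparr>carrier := Y\<rparr>)"
  using assms unfolding presents_def by (auto simp: subset_iff)

lemma presents_coset:
  assumes "presents sc A B \<phi> M" "C \<subseteq> A" "x \<in> A"
  shows "\<phi> ` C +>\<^bsub>M\<^esub> \<phi> x = (\<lambda>c. \<phi> (c + x)) ` C"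
  using assms unfolding presents_def a_r_coset_def r_coset_def by (auto simp: subset_iff image_iff)

text \<open>
  The quotient of \<open>A / B\<close> by the image of \<open>C\<close> is \<open>A / C\<close>, with the same representatives.
\<close>

lemma presents_quotient:
  assumes M: "presents sc A B \<phi> M" and C: "C \<subseteq> A" "0 \<in> C"
    "\<And>x y. x \<in> C \<Longrightarrow> y \<in> C \<Longrightarrow> x - y \<in> C" "\<And>r x. x \<in> C \<Longrightarrow> sc r x \<in> C"
    and B: "\<And>x. x \<in> A \<Longrightarrow> x \<in> B \<Longrightarrow> x \<in> C" and Y: "Y = \<phi> ` C"
  shows "presents sc A C (\<lambda>x. Y +>\<^bsub>M\<^esub> \<phi> x) (quotient_module M Y)"
proof -
  note M' = M[unfolded presents_def]
  have pA: "x + y \<in> A" if "x \<in> A" "y \<in> A" for x y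
    by (rule presents_plus[OF M that])
  have dA: "x - y \<in> A" if "x \<in> A" "y \<in> A" for x y
    using M' that by blast
  have addM: "\<phi> x \<oplus>\<^bsub>M\<^esub> \<phi> y = \<phi> (x + y)" if "x \<in> A" "y \<in> A" for x y
    using M' that by blast
  have CA: "c \<in> A" if "c \<in> C" for c
    using that C(1) by blast
  have Cp: "x + y \<in> C" if "x \<in> C" "y \<in> C" for x y
    using C(3)[of x "0 - y"] C(3)[of 0 y] C(2) that by simp
  have cos: "Y +>\<^bsub>M\<^esub> \<phi> x = (\<lambda>c. \<phi> (c + x)) ` C" if "x \<in> A" for x
    unfolding Y by (rule presents_coset[OF M C(1) that])
  have eqI: "Y +>\<^bsub>M\<^esub> \<phi> x = Y +>\<^bsub>M\<^esub> \<phi> y \<longleftrightarrow> x - y \<in> C" if xy: "x \<in> A" "y \<in> A" for x y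
  proof
    assume "Y +>\<^bsub>M\<^esub> \<phi> x = Y +>\<^bsub>M\<^esub> \<phi> y"
    then have "(\<lambda>c. \<phi> (c + x)) ` C = (\<lambda>c. \<phi> (c + y)) ` C"
      by (simp only: cos xy)
    then have "\<phi> (0 + x) \<in> (\<lambda>c. \<phi> (c + y)) ` C"
      using imageI[OF C(2), of "\<lambda>c. \<phi> (c + x)"] by simp
    then obtain c where c: "c \<in> C" "\<phi> x = \<phi> (c + y)"
      by auto
    then have "x - (c + y) \<in> B"
      using presents_eq_iff[OF M xy(1) pA[OF CA[OF c(1)] xy(2)]] by simp
    moreover have "x - (c + y) \<in> A"
      by (intro dA pA CA xy c(1))
    ultimately have "x - (c + y) + c \<in> C"
      using B Cp c by blast
    then show "x - y \<in> C"
      by simp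
  next
    assume xy': "x - y \<in> C"
    have *: "(\<lambda>c. \<phi> (c + x)) ` C \<subseteq> (\<lambda>c. \<phi> (c + y)) ` C" if "x - y \<in> C" for x y
    proof
      fix u assume "u \<in> (\<lambda>c. \<phi> (c + x)) ` C"
      then obtain c where "c \<in> C" "u = \<phi> (c + x)"
        by blast
      then have "c + (x - y) \<in> C" "u = \<phi> (c + (x - y) + y)"
        using Cp[OF _ that] by simp_all
      then show "u \<in> (\<lambda>c. \<phi> (c + y)) ` C"
        by blast
    qed
    have "y - x \<in> C"
      using C(3)[OF C(2) xy'] by simp
    then have "(\<lambda>c. \<phi> (c + x)) ` C = (\<lambda>c. \<phi> (c + y)) ` C"
      by (intro equalityI * xy')
    then show "Y +>\<^bsub>M\<^esub> \<phi> x = Y +>\<^bsub>M\<^esub> \<phi> y"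
      by (simp only: cos xy)
  qed
  have add: "(Y +>\<^bsub>M\<^esub> \<phi> x) <+>\<^bsub>M\<^esub> (Y +>\<^bsub>M\<^esub> \<phi> y) = Y +>\<^bsub>M\<^esub> \<phi> (x + y)" if xy: "x \<in> A" "y \<in> A" for x y
  proof -
    have "(Y +>\<^bsub>M\<^esub> \<phi> x) <+>\<^bsub>M\<^esub> (Y +>\<^bsub>M\<^esub> \<phi> y)
        = (\<Union>c\<in>C. \<Union>c'\<in>C. {\<phi> (c + x) \<oplus>\<^bsub>M\<^esub> \<phi> (c' + y)})"
      using cos xy unfolding set_add_def set_mult_def by auto
    also have "\<dots> = (\<Union>c\<in>C. \<Union>c'\<in>C. {\<phi> ((c + c') + (x + y))})"
    proof -
      have "\<phi> (c + x) \<oplus>\<^bsub>M\<^esub> \<phi> (c' + y) = \<phi> ((c + c') + (x + y))" if "c \<in> C" "c' \<in> C" for c c'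
      proof -
        have "\<phi> (c + x) \<oplus>\<^bsub>M\<^esub> \<phi> (c' + y) = \<phi> ((c + x) + (c' + y))"
          by (intro addM pA CA xy that)
        then show ?thesis
          by (simp add: algebra_simps)
      qed
      then show ?thesis
        by simp
    qed
    also have "\<dots> = (\<lambda>c. \<phi> (c + (x + y))) ` C"
    proof
      show "(\<Union>c\<in>C. \<Union>c'\<in>C. {\<phi> ((c + c') + (x + y))}) \<subseteq> (\<lambda>c. \<phi> (c + (x + y))) ` C"
        using Cp by auto
    next
      show "(\<lambda>c. \<phi> (c + (x + y))) ` C \<subseteq> (\<Union>c\<in>C. \<Union>c'\<in>C. {\<phi> ((c + c') + (x + y))})"
      proof
        fix u assume "u \<in> (\<lambda>c. \<phi> (c + (x + y))) ` C"
        then obtain c where "c \<in> C" "u = \<phi> ((c + 0) + (x + y))"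
          by auto
        then show "u \<in> (\<Union>c\<in>C. \<Union>c'\<in>C. {\<phi> ((c + c') + (x + y))})"
          using C(2) by blast
      qed
    qed
    also have "\<dots> = Y +>\<^bsub>M\<^esub> \<phi> (x + y)"
      using cos presents_plus[OF M] xy by simp
    finally show ?thesis .
  qed
  have smult: "(\<Union>u\<in>Y +>\<^bsub>M\<^esub> \<phi> x. Y +>\<^bsub>M\<^esub> (r \<odot>\<^bsub>M\<^esub> u)) = Y +>\<^bsub>M\<^esub> \<phi> (sc r x)" if x: "x \<in> A" for r x
  proof -
    have "Y +>\<^bsub>M\<^esub> (r \<odot>\<^bsub>M\<^esub> \<phi> (c + x)) = Y +>\<^bsub>M\<^esub> \<phi> (sc r x)" if c: "c \<in> C" for c
    proof -
      have cx: "c + x \<in> A"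
        using c x C(1) presents_plus[OF M] by blast
      have "sc r (c + x) - sc r x \<in> C"
        using presents_scale_plus[OF M] C(4)[OF c] by simp
      moreover have "sc r (c + x) \<in> A" "sc r x \<in> A" "r \<odot>\<^bsub>M\<^esub> \<phi> (c + x) = \<phi> (sc r (c + x))"
        using M' cx x by blast+
      ultimately show ?thesis
        using eqI by simp
    qed
    then show ?thesis
      using cos[OF x] C(2) by auto
  qed
  have zero: "Y = Y +>\<^bsub>M\<^esub> \<phi> 0"
    using cos[of 0] Y M' by simp
  have sc: "\<forall>r x y. sc r (x - y) = sc r x - sc r y" and A: "0 \<in> A" "\<forall>x\<in>A. \<forall>y\<in>A. x - y \<in> A"
    "\<forall>r. \<forall>x\<in>A. sc r x \<in> A"
    using M' by blast+
  have carr: "a_rcosets\<^bsub>M\<^esub> Y = (\<lambda>x. Y +>\<^bsub>M\<^esub> \<phi> x) ` A"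
    using presents_carrier[OF M] unfolding A_RCOSETS_def RCOSETS_def a_r_coset_def by auto
  show ?thesis
    unfolding presents_def quotient_module_def
    using sc A eqI add smult zero carr by simp
qed

lemma presents_multiple_module:
  assumes M: "presents sc A B \<phi> M" and comm: "\<And>r x. sc r (sc b x) = sc b (sc r x)"
  shows "presents sc A {x. sc b x \<in> B} (\<lambda>x. \<phi> (sc b x)) (multiple_module b M)"
proof -
  note M' = M[unfolded presents_def]
  have "sc b 0 = 0"
    using M' by (metis diff_self)
  then show ?thesis
    unfolding presents_def multiple_module_def
    using M' presents_scale_plus[OF M] comm by (auto simp: image_image)
qed

text \<open>
  A linear surjection of representatives \<open>\<theta> : A \<rightarrow> A'\<close> that pulls \<open>B'\<close> back to \<open>B\<close> induces an isomorphism,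
  whose value on the class of \<open>x\<close> is recorded for use in the graded case.
\<close>

lemma presents_iso:
  assumes M: "presents sc A B \<phi> M" and M': "presents sc' A' B' \<phi>' M'"
    and \<theta>: "\<And>x y. x \<in> A \<Longrightarrow> y \<in> A \<Longrightarrow> \<theta> (x + y) = \<theta> x + \<theta> y"
      "\<And>x y. x \<in> A \<Longrightarrow> y \<in> A \<Longrightarrow> \<theta> (x - y) = \<theta> x - \<theta> y"
      "\<And>r x. x \<in> A \<Longrightarrow> \<theta> (sc r x) = sc' r (\<theta> x)"
    and surj: "\<theta> ` A = A'" and ker: "\<And>x. x \<in> A \<Longrightarrow> \<theta> x \<in> B' \<longleftrightarrow> x \<in> B"
  obtains h where "h \<in> module_iso R M M'" "\<And>x. x \<in> A \<Longrightarrow> h (\<phi> x) = \<phi>' (\<theta> x)"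
proof -
  define h where "h = (\<lambda>y. \<phi>' (\<theta> (SOME x. x \<in> A \<and> \<phi> x = y)))"
  have cl: "\<And>x y. x \<in> A \<Longrightarrow> y \<in> A \<Longrightarrow> x - y \<in> A" "\<And>r x. x \<in> A \<Longrightarrow> sc r x \<in> A"
    using M unfolding presents_def by blast+
  have eq: "\<phi> x = \<phi> y \<longleftrightarrow> \<phi>' (\<theta> x) = \<phi>' (\<theta> y)" if "x \<in> A" "y \<in> A" for x y
    using presents_eq_iff[OF M that] presents_eq_iff[OF M', of "\<theta> x" "\<theta> y"] \<theta>(2)[OF that] surj that
      ker[OF cl(1)[OF that]] by auto
  have h: "h (\<phi> x) = \<phi>' (\<theta> x)" if "x \<in> A" for x
  proof -
    have "(SOME z. z \<in> A \<and> \<phi> z = \<phi> x) \<in> A \<and> \<phi> (SOME z. z \<in> A \<and> \<phi> z = \<phi> x) = \<phi> x"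
      using someI[of "\<lambda>z. z \<in> A \<and> \<phi> z = \<phi> x" x] that by simp
    then show ?thesis
      unfolding h_def using eq that by blast
  qed
  have M1: "\<And>x y. x \<in> A \<Longrightarrow> y \<in> A \<Longrightarrow> \<phi> x \<oplus>\<^bsub>M\<^esub> \<phi> y = \<phi> (x + y)"
    "\<And>r x. x \<in> A \<Longrightarrow> r \<odot>\<^bsub>M\<^esub> \<phi> x = \<phi> (sc r x)"
    using M unfolding presents_def by blast+
  have M2: "\<And>x y. x \<in> A' \<Longrightarrow> y \<in> A' \<Longrightarrow> \<phi>' x \<oplus>\<^bsub>M'\<^esub> \<phi>' y = \<phi>' (x + y)"
    "\<And>r x. x \<in> A' \<Longrightarrow> r \<odot>\<^bsub>M'\<^esub> \<phi>' x = \<phi>' (sc' r x)"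
    using M' unfolding presents_def by blast+
  have \<theta>A: "\<theta> x \<in> A'" if "x \<in> A" for x
    using surj that by blast
  have "bij_betw h (carrier M) (carrier M')"
    unfolding bij_betw_def
  proof
    show "inj_on h (carrier M)"
      using presents_carrier[OF M] h eq by (auto simp: inj_on_def)
    show "h ` carrier M = carrier M'"
    proof -
      have "h ` carrier M = (\<lambda>x. \<phi>' (\<theta> x)) ` A"
        using presents_carrier[OF M] h by (auto simp: image_image)
      also have "\<dots> = \<phi>' ` A'"
        using surj by (metis image_image)
      finally show ?thesis
        using presents_carrier[OF M'] by simp
    qed
  qed
  moreover have "h \<in> hom (add_monoid M) (add_monoid M')"
    using presents_carrier[OF M] presents_carrier[OF M'] h M1 M2 \<theta>A \<theta> presents_plus[OF M]
    by (auto simp: hom_def)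
  moreover have "h (r \<odot>\<^bsub>M\<^esub> x) = r \<odot>\<^bsub>M'\<^esub> h x" if "x \<in> carrier M" for r x
    using that presents_carrier[OF M] h M1 M2 \<theta>A \<theta> cl by auto
  ultimately have "h \<in> module_iso R M M'"
    unfolding module_iso_def iso_def by simp
  with h that show ?thesis
    by blast
qed

text \<open>
  Homogeneous elements of a subquotient are those with a homogeneous representative. The assumption on
  \<open>H\<close> says that this already holds for \<open>M\<close>; it is then inherited by the quotient.
\<close>

lemma classes_of_presented_quotient:
  assumes M: "presents sc A B \<phi> M" and C: "C \<subseteq> A" "0 \<in> C"
    "\<And>x y. x \<in> C \<Longrightarrow> y \<in> C \<Longrightarrow> x - y \<in> C" "\<And>r x. x \<in> C \<Longrightarrow> sc r x \<in> C"
    and B: "\<And>x. x \<in> A \<Longrightarrow> x \<in> B \<Longrightarrow> x \<in> C"  and Y: "Y = \<phi> ` C"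
    and H: "\<And>x. x \<in> A \<Longrightarrow> \<phi> x \<in> H \<longleftrightarrow> (\<exists>x'\<in>H'. x' \<in> A \<and> \<phi> x' = \<phi> x)"
  shows "classes_of H (quotient_module M Y) = (\<lambda>x. Y +>\<^bsub>M\<^esub> \<phi> x) ` (A \<inter> H')"
proof -
  have Q: "presents sc A C (\<lambda>x. Y +>\<^bsub>M\<^esub> \<phi> x) (quotient_module M Y)"
    by (rule presents_quotient[OF assms(1-7)])
  have cos: "Y +>\<^bsub>M\<^esub> \<phi> x = (\<lambda>c. \<phi> (c + x)) ` C" if "x \<in> A" for x
    unfolding Y by (rule presents_coset[OF M C(1) that])
  have pl: "c + x \<in> A" if "c \<in> C" "x \<in> A" for c x
    using presents_plus[OF M] C(1) that by blast
  show ?thesis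
  proof (intro equalityI subsetI)
    fix U assume "U \<in> classes_of H (quotient_module M Y)"
    then obtain x u where U: "x \<in> A" "U = Y +>\<^bsub>M\<^esub> \<phi> x" "u \<in> U" "u \<in> H"
      using presents_carrier[OF Q] unfolding classes_of_def by auto
    then obtain c where c: "c \<in> C" "u = \<phi> (c + x)"
      using cos by auto
    then obtain x' where x': "x' \<in> H'" "x' \<in> A" "\<phi> x' = \<phi> (c + x)"
      using H U pl by blast
    have "Y +>\<^bsub>M\<^esub> \<phi> (c + x) = Y +>\<^bsub>M\<^esub> \<phi> x"
      using presents_eq_iff[OF Q pl[OF c(1) U(1)] U(1)] c by simp
    then have "U = Y +>\<^bsub>M\<^esub> \<phi> x'"
      using x'(3) U(2) by simp
    then show "U \<in> (\<lambda>x. Y +>\<^bsub>M\<^esub> \<phi> x) ` (A \<inter> H')"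
      using x'(1,2) by (intro image_eqI[of _ _ x']) simp_all
  next
    fix U assume "U \<in> (\<lambda>x. Y +>\<^bsub>M\<^esub> \<phi> x) ` (A \<inter> H')"
    then obtain x where x: "x \<in> A" "x \<in> H'" "U = Y +>\<^bsub>M\<^esub> \<phi> x"
      by blast
    moreover have "\<phi> x \<in> U"
      using imageI[OF C(2), of "\<lambda>c. \<phi> (c + x)"] by (simp add: x(3) cos[OF x(1)])
    moreover have "\<phi> x \<in> H"
      using H x by blast
    ultimately show "U \<in> classes_of H (quotient_module M Y)"
      using presents_carrier[OF Q] unfolding classes_of_def by blast
  qed
qed

section \<open>Contractions on exterior algebras\<close>

lemma altsign_zero [simp]: "altsign n 0 = 0"
  by (simp add: altsign_def)

lemma altsign_0 [simp]: "altsign 0 v = v"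
  by (simp add: altsign_def)

lemma altsign_Suc [simp]: "altsign (Suc n) v = - altsign n v"
  by (simp add: altsign_def)

lemma altsign_add: "altsign n (v + w) = altsign n v + altsign n w"
  by (simp add: altsign_def)

lemma altsign_diff: "altsign n (v - w) = altsign n v - altsign n w"
  by (simp add: altsign_def)

lemma altsign_uminus: "altsign n (- v) = - altsign n v"
  by (simp add: altsign_def)

lemma altsign_altsign: "altsign m (altsign n v) = altsign (m + n) v"
  by (simp add: altsign_def)

lemma altsign_twice [simp]: "altsign n (altsign n v) = v"
  by (simp add: altsign_def)

lemma altsign_commute: "altsign m (altsign n v) = altsign n (altsign m v)"
  by (simp add: altsign_def)

lemma altsign_eq_0_iff [simp]: "altsign n v = 0 \<longleftrightarrow> v = 0"
  by (simp add: altsign_def)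

lemma altsign_mult: "altsign n ((c::'a::comm_ring_1) * v) = c * altsign n v"
  by (simp add: altsign_def)

lemma altsign_sum: "altsign n (sum g A) = (\<Sum>a\<in>A. altsign n (g a))"
  by (simp add: altsign_def sum_negf)

lemma altsign_apply: "altsign n g x = altsign n (g x)"
  by (simp add: altsign_def)

lemma sum_apply: "(sum g A) x = (\<Sum>a\<in>A. g a x)"
  by (induction A rule: infinite_finite_induct) auto

definition below :: "nat set \<Rightarrow> nat \<Rightarrow> nat" where
  "below K l = card {k \<in> K. k < l}"

text \<open>
  \<open>del l\<close> is the contraction with the dual of \<open>e\<^sub>l\<close> and \<open>ins m\<close> the multiplication by \<open>e\<^sub>m\<close> from the left.
  A Koszul differential is a linear combination of contractions, so that its formal properties follow
  from the Clifford relations \<open>del_del\<close>, \<open>del_self\<close> and \<open>del_ins\<close>.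
\<close>

definition del :: "nat \<Rightarrow> (nat set \<Rightarrow> 'm::ab_group_add) \<Rightarrow> nat set \<Rightarrow> 'm" where
  "del l c = (\<lambda>K. if l \<in> K then 0 else altsign (below K l) (c (insert l K)))"

definition ins :: "nat \<Rightarrow> (nat set \<Rightarrow> 'm::ab_group_add) \<Rightarrow> nat set \<Rightarrow> 'm" where
  "ins m c = (\<lambda>K. if m \<in> K then altsign (below K m) (c (K - {m})) else 0)"

lemma below_insert:
  fixes k l :: nat
  assumes "k \<notin> K"
  shows "below (insert k K) l = (if k < l then Suc (below K l) else below K l)"
proof (cases "k < l")
  case True
  then have "{j \<in> insert k K. j < l} = insert k {j \<in> K. j < l}"
    by auto
  then show ?thesis
    using True assms by (simp add: below_def)
next
  case False
  then have "{j \<in> insert k K. j < l} = {j \<in> K. j < l}"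
    by auto
  then show ?thesis
    using False by (simp add: below_def)
qed

lemma below_remove:
  fixes k l :: nat
  assumes "k \<in> K"
  shows "below K l = (if k < l then Suc (below (K - {k}) l) else below (K - {k}) l)"
  using below_insert[of k "K - {k}" l] assms by (simp add: insert_absorb)

lemma del_del: "del l (del k c) = - del k (del l c)"
proof
  fix K
  show "del l (del k c) K = (- del k (del l c)) K"
    by (auto simp: del_def altsign_uminus below_insert insert_commute altsign_commute)
qed

lemma del_self [simp]: "del l (del l c) = 0"
  by (auto simp: del_def fun_eq_iff)

lemma del_ins: "del l (ins m c) K + ins m (del l c) K = (if l = m then c K else 0)"
proof (cases "l = m")
  case True
  have "l \<in> K \<Longrightarrow> insert l (K - {l}) = K"
    by auto
  moreover have "below (K - {l}) l = below K l"
    by (auto simp: below_def intro: arg_cong[where f = card])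
  moreover have "below (insert l K) l = below K l"
    by (auto simp: below_def intro: arg_cong[where f = card])
  moreover have "l \<notin> K \<Longrightarrow> insert l K - {l} = K"
    by auto
  ultimately show ?thesis
    using True by (auto simp: del_def ins_def)
next
  case False
  show ?thesis
  proof (cases "l \<notin> K \<and> m \<in> K")
    case True
    then have eq: "insert l K - {m} = insert l (K - {m})"
      using False by auto
    show ?thesis
      using True False below_insert[of l K m] below_remove[of m K l]
      by (auto simp: del_def ins_def eq altsign_uminus altsign_commute)
  qed (use False in \<open>auto simp: del_def ins_def\<close>)
qed

lemma del_add: "del l (c + d) = del l c + del l d"
  by (auto simp: del_def fun_eq_iff altsign_add)

lemma del_diff: "del l (c - d) = del l c - del l d"
  by (auto simp: del_def fun_eq_iff altsign_diff)

lemma del_uminus: "del l (- c) = - del l c"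
  by (auto simp: del_def fun_eq_iff altsign_uminus)

lemma del_zero [simp]: "del l 0 = 0"
  by (auto simp: del_def fun_eq_iff)

lemma del_const_zero [simp]: "del l (\<lambda>_. 0) = (\<lambda>_. 0)"
  by (auto simp: del_def fun_eq_iff)

lemma del_altsign: "del l (altsign n c) = altsign n (del l c)"
  by (auto simp: altsign_def del_uminus)

lemma del_scale: "del l (\<lambda>K. (r::'a::comm_ring_1) * c K) = (\<lambda>K. r * del l c K)"
  by (auto simp: del_def fun_eq_iff altsign_mult)

lemma koszul_diff_eq_del:
  fixes c :: "nat set \<Rightarrow> 'm::ab_group_add"
  assumes N: "finite N" and c: "\<And>K. c K \<noteq> 0 \<Longrightarrow> K \<subseteq> N"
    and x: "\<And>l v. x l (- v) = - (x l v :: 'm)" "\<And>l. x l 0 = 0"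
  shows "koszul_diff N x c = (\<lambda>K. \<Sum>l\<in>N. x l (del l c K))"
proof
  fix K
  have x': "x l (altsign n v) = altsign n (x l v)" for l n v
    by (simp add: altsign_def x)
  show "koszul_diff N x c K = (\<Sum>l\<in>N. x l (del l c K))"
  proof (cases "K \<subseteq> N")
    case True
    have "(\<Sum>l\<in>N. x l (del l c K)) = (\<Sum>l\<in>N - K. x l (del l c K))"
      by (rule sum.mono_neutral_right) (use N in \<open>auto simp: del_def x\<close>)
    also have "\<dots> = (\<Sum>l\<in>N - K. altsign (below K l) (x l (c (insert l K))))"
      by (rule sum.cong) (auto simp: del_def below_def x')
    finally show ?thesis
      using True by (simp add: koszul_diff_def below_def)
  next
    case False
    then have "c (insert l K) = 0" for l
      using c by blast
    then have "del l c K = 0" for l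
      by (simp add: del_def)
    then show ?thesis
      using False by (simp add: koszul_diff_def x)
  qed
qed

section \<open>Koszul cycles\<close>

lemma koszul_chainsD: "c \<in> koszul_chains N p \<Longrightarrow> c K \<noteq> 0 \<Longrightarrow> K \<subseteq> N \<and> card K = p"
  by (simp add: koszul_chains_def)

lemma koszul_chainsI: "(\<And>K. c K \<noteq> 0 \<Longrightarrow> K \<subseteq> N \<and> card K = p) \<Longrightarrow> c \<in> koszul_chains N p"
  by (simp add: koszul_chains_def)

lemma koszul_diff_mult_eq:
  fixes f :: "nat \<Rightarrow> 'a::comm_ring_1"
  assumes "finite N" "c \<in> koszul_chains N p"
  shows "koszul_diff N (\<lambda>l v. f l * v) c = (\<lambda>K. \<Sum>l\<in>N. f l * del l c K)"
  by (rule koszul_diff_eq_del) (use assms koszul_chainsD[OF assms(2)] in auto)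

lemma koszul_chains_zero: "0 \<in> koszul_chains N p"
  by (simp add: koszul_chains_def)

lemma koszul_chains_diff:
  fixes c :: "nat set \<Rightarrow> 'm::ab_group_add"
  assumes "c \<in> koszul_chains N p" "d \<in> koszul_chains N p"
  shows "c - d \<in> koszul_chains N p"
proof -
  have "K \<subseteq> N \<and> card K = p" if "(c - d) K \<noteq> 0" for K
  proof -
    have "c K \<noteq> 0 \<or> d K \<noteq> 0"
      using that by auto
    then show ?thesis
      using koszul_chainsD[OF assms(1), of K] koszul_chainsD[OF assms(2), of K] by blast
  qed
  then show ?thesis
    by (rule koszul_chainsI)
qed

lemma koszul_chains_scale:
  "c \<in> koszul_chains N p \<Longrightarrow> (\<lambda>K. (r::'a::comm_ring_1) * c K) \<in> koszul_chains N p"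
  unfolding koszul_chains_def mem_Collect_eq by (metis mult_zero_right)

lemma koszul_chains_del:
  assumes "finite N" "c \<in> koszul_chains N (Suc p)"
  shows "del l c \<in> koszul_chains N p"
proof -
  have "K \<subseteq> N \<and> card K = p" if "del l c K \<noteq> 0" for K
  proof -
    have l: "l \<notin> K" and "c (insert l K) \<noteq> 0"
      using that by (simp_all add: del_def split: if_splits)
    have "insert l K \<subseteq> N \<and> card (insert l K) = Suc p"
      by (rule koszul_chainsD[OF assms(2)]) fact
    have "finite (insert l K)"
      by (rule finite_subset[OF _ assms(1)]) (use \<open>insert l K \<subseteq> N \<and> _\<close> in blast)
    show ?thesis
      using l \<open>finite (insert l K)\<close> \<open>insert l K \<subseteq> N \<and> _\<close> by simp
  qed
  then show ?thesis
    by (rule koszul_chainsI)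
qed

lemma koszul_chains_0_del:
  assumes "finite N" "c \<in> koszul_chains N 0"
  shows "del l c = 0"
proof
  fix K
  have "c (insert l K) = 0"
  proof (rule ccontr)
    assume "c (insert l K) \<noteq> 0"
    then have *: "insert l K \<subseteq> N \<and> card (insert l K) = 0"
      by (rule koszul_chainsD[OF assms(2)])
    then have "finite (insert l K)"
      using finite_subset[OF _ assms(1)] by simp
    then show False
      using * by (simp only: card_0_eq) simp
  qed
  then show "del l c K = 0 K"
    by (simp add: del_def)
qed

lemma koszul_cycles_iff:
  fixes f :: "nat \<Rightarrow> 'a::comm_ring_1"
  assumes "finite N"
  shows "c \<in> koszul_cycles N f p \<longleftrightarrow> c \<in> koszul_chains N p \<and> (\<forall>K. (\<Sum>l\<in>N. f l * del l c K) = 0)"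
  unfolding koszul_cycles_def using koszul_diff_mult_eq[OF assms, of c p f]
  by (auto simp: fun_eq_iff)

lemma koszul_cycles_zero: "finite N \<Longrightarrow> 0 \<in> koszul_cycles N f p"
  by (simp add: koszul_cycles_iff koszul_chains_zero)

lemma koszul_cycles_diff:
  "finite N \<Longrightarrow> c \<in> koszul_cycles N f p \<Longrightarrow> d \<in> koszul_cycles N f p \<Longrightarrow> c - d \<in> koszul_cycles N f p"
  by (simp add: koszul_cycles_iff koszul_chains_diff del_diff right_diff_distrib sum_subtractf)

lemma koszul_cycles_uminus:
  "finite N \<Longrightarrow> c \<in> koszul_cycles N f p \<Longrightarrow> - c \<in> koszul_cycles N f p"
  using koszul_cycles_diff[of N 0 f p c] koszul_cycles_zero[of N f p] by simp

lemma koszul_cycles_add: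
  "finite N \<Longrightarrow> c \<in> koszul_cycles N f p \<Longrightarrow> d \<in> koszul_cycles N f p \<Longrightarrow> c + d \<in> koszul_cycles N f p"
  using koszul_cycles_diff[of N c f p "- d"] koszul_cycles_uminus[of N d f p] by simp

lemma koszul_cycles_altsign:
  "finite N \<Longrightarrow> c \<in> koszul_cycles N f p \<Longrightarrow> altsign n c \<in> koszul_cycles N f p"
  by (simp add: altsign_def koszul_cycles_uminus)

lemma koszul_cycles_scale:
  assumes "finite N" "c \<in> koszul_cycles N f p"
  shows "(\<lambda>K. r * c K) \<in> koszul_cycles N f p"
proof -
  have "(\<Sum>l\<in>N. f l * (r * del l c K)) = r * (\<Sum>l\<in>N. f l * del l c K)" for K
    by (simp add: sum_distrib_left mult.left_commute)
  then show ?thesis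
    using assms by (simp add: koszul_cycles_iff koszul_chains_scale del_scale)
qed

lemma koszul_cycles_del:
  assumes N: "finite N" and c: "c \<in> koszul_cycles N f (Suc p)"
  shows "del l c \<in> koszul_cycles N f p"
proof -
  have "(\<Sum>k\<in>N. f k * del k (del l c) K) = 0" for K
  proof -
    have "(\<Sum>k\<in>N. f k * del k (del l c) K) = - (\<Sum>k\<in>N. f k * del l (del k c) K)"
      by (subst del_del) (simp add: sum_negf)
    also have "(\<Sum>k\<in>N. f k * del l (del k c) K) = del l (\<lambda>K. \<Sum>k\<in>N. f k * del k c K) K"
      by (auto simp: del_def altsign_sum altsign_mult intro!: sum.cong)
    also have "(\<lambda>K. \<Sum>k\<in>N. f k * del k c K) = 0"
      using c N by (auto simp: koszul_cycles_iff)
    finally show ?thesis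
      by simp
  qed
  then show ?thesis
    using c N koszul_chains_del[of N c p l] by (simp add: koszul_cycles_iff)
qed

section \<open>Contractions on the coefficients of \<open>D\<close>\<close>

type_synonym 'a wchain = "nat set \<Rightarrow> nat set \<Rightarrow> 'a"

text \<open>
  The coefficients of \<open>D\<close> lie in \<open>\<And>(e'\<^sub>1, \<dots>, e'\<^sub>s) \<otimes> \<And>(e\<^sub>0, \<dots>, e\<^sub>s)\<close>, and \<open>kap l\<close> is the contraction
  with the sum of the duals of \<open>e'\<^sub>l\<close> and \<open>e\<^sub>l\<close>. The differential of \<open>D\<close> becomes \<open>\<Sum>\<^sub>l T\<^sub>l \<kappa>\<^sub>l\<close>; for \<open>l = 0\<close>
  only the part \<open>e\<^sub>0\<close> remains, because \<open>e'\<^sub>0\<close> does not occur. Sets \<open>M\<close> that are infinite carry no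
  coefficients; there \<open>card M = 0\<close> would give the wrong sign, whence the value \<open>0\<close>.
\<close>

definition kap :: "nat \<Rightarrow> 'a::comm_ring_1 wchain \<Rightarrow> 'a wchain" where
  "kap l w = (\<lambda>M. if finite M then del l w M + altsign (card M) (del l (w M)) else 0)"

definition wscale :: "'a::comm_ring_1 \<Rightarrow> 'a wchain \<Rightarrow> 'a wchain" where
  "wscale r w = (\<lambda>M L. r * w M L)"

lemma kap_add: "kap l (v + w) = kap l v + kap l w"
  by (auto simp: kap_def fun_eq_iff del_add altsign_add)

lemma kap_uminus: "kap l (- w) = - kap l w"
  by (auto simp: kap_def fun_eq_iff del_uminus altsign_uminus)

lemma kap_diff: "kap l (v - w) = kap l v - kap l w"
  by (auto simp: kap_def fun_eq_iff del_diff altsign_diff)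

lemma kap_zero [simp]: "kap l 0 = 0"
  by (auto simp: kap_def fun_eq_iff)

lemma kap_altsign: "kap l (altsign n w) = altsign n (kap l w)"
  by (simp add: altsign_def kap_uminus)

lemma kap_scale: "kap l (wscale r w) = wscale r (kap l w)"
proof -
  have "del l (\<lambda>M L. r * w M L) M L = r * del l w M L" for M L
    by (auto simp: del_def altsign_apply altsign_mult)
  then show ?thesis
    by (auto simp: kap_def wscale_def fun_eq_iff del_scale altsign_apply altsign_mult distrib_left)
qed

lemma kap_kap_expand:
  assumes "finite M"
  shows "kap l (kap k w) M
    = del l (del k w) M - altsign (card M) (del k (del l w M)) + altsign (card M) (del l (del k w M))
      + del l (del k (w M))"
proof -
  have "del l (kap k w) M = del l (del k w) M - altsign (card M) (del k (del l w M))"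
    using assms
    by (auto simp: del_def[of l] kap_def altsign_diff altsign_uminus del_altsign altsign_commute)
  then show ?thesis
    using assms by (simp add: kap_def del_add altsign_add del_altsign)
qed

lemma kap_anticommute: "kap l (kap k w) = - kap k (kap l w)"
proof
  fix M
  show "kap l (kap k w) M = (- kap k (kap l w)) M"
  proof (cases "finite M")
    case True
    then show ?thesis
      using del_del[of l k w] del_del[of l k "w M"] by (simp add: kap_kap_expand)
  qed (simp add: kap_def)
qed

lemma kap_self [simp]: "kap l (kap l w) = 0"
proof
  fix M
  show "kap l (kap l w) M = 0 M"
    by (cases "finite M") (simp_all add: kap_kap_expand, simp add: kap_def)
qed

text \<open>
  Multiplication by \<open>e'\<^sub>m\<close> is a contracting homotopy for \<open>\<kappa>\<^sub>m\<close> that anticommutes with all other \<open>\<kappa>\<^sub>l\<close>: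
  the summand of \<open>\<kappa>\<^sub>l\<close> that contracts \<open>e\<^sub>l\<close> anticommutes with it anyway. This is why no change of basis
  is needed to separate the two factors of \<open>D\<close>.
\<close>

lemma kap_ins:
  assumes "finite M"
  shows "kap l (ins m w) M + ins m (kap l w) M = (if l = m then w M else 0)"
proof -
  have "altsign (card M) (del l (ins m w M)) + ins m (\<lambda>M. altsign (card M) (del l (w M))) M = 0"
  proof (cases "m \<in> M")
    case True
    then have "card M = Suc (card (M - {m}))"
      using card.remove[OF assms, of m] by blast
    then obtain n where "card M = Suc n" "card (M - {m}) = n"
      by blast
    then show ?thesis
      using True by (simp add: ins_def del_altsign altsign_commute altsign_uminus)
  qed (simp add: ins_def)
  moreover have "ins m (kap l w) M = ins m (del l w) M + ins m (\<lambda>M. altsign (card M) (del l (w M))) M"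
    using assms by (simp add: ins_def kap_def altsign_add)
  ultimately show ?thesis
    using assms del_ins[of l m w M] by (simp add: kap_def algebra_simps)
qed

lemma ins_add: "ins l (c + d) = ins l c + ins l d"
  by (auto simp: ins_def fun_eq_iff altsign_add)

lemma ins_zero [simp]: "ins l 0 = 0"
  by (auto simp: ins_def fun_eq_iff)

lemma kap_sum: "kap l (sum g A) = (\<Sum>a\<in>A. kap l (g a))"
  by (induction A rule: infinite_finite_induct) (simp_all only: sum.infinite sum.empty sum.insert kap_zero kap_add not_False_eq_True)

lemma ins_sum: "ins l (sum g A) = (\<Sum>a\<in>A. ins l (g a))"
  by (induction A rule: infinite_finite_induct) (simp_all only: sum.infinite sum.empty sum.insert ins_zero ins_add not_False_eq_True)

lemma ins_self [simp]: "ins m (ins m w) = 0"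
  by (auto simp: ins_def fun_eq_iff)

lemma ins_ins: "ins l (ins k c) = - ins k (ins l c)"
proof
  fix K
  show "ins l (ins k c) K = (- ins k (ins l c)) K"
  proof (cases "l = k")
    case False
    have "K - {l} - {k} = K - {k} - {l}"
      by auto
    then show ?thesis
      using below_remove[of k K l] below_remove[of l K k] False
      by (auto simp: ins_def altsign_uminus altsign_commute)
  qed (simp add: ins_def)
qed

definition kaps :: "nat list \<Rightarrow> 'a::comm_ring_1 wchain \<Rightarrow> 'a wchain" where
  "kaps ls w = foldr kap ls w"

lemma kaps_Nil [simp]: "kaps [] w = w"
  and kaps_Cons [simp]: "kaps (l # ls) w = kap l (kaps ls w)"
  and kaps_append: "kaps (ls @ ks) w = kaps ls (kaps ks w)"
  by (simp_all add: kaps_def)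

lemma kaps_add: "kaps ls (v + w) = kaps ls v + kaps ls w"
  by (induction ls) (simp_all only: kaps_Nil kaps_Cons kap_add)

lemma kaps_diff: "kaps ls (v - w) = kaps ls v - kaps ls w"
  by (induction ls) (simp_all only: kaps_Nil kaps_Cons kap_diff)

lemma kaps_zero [simp]: "kaps ls 0 = 0"
  by (induction ls) (simp_all only: kaps_Nil kaps_Cons kap_zero)

lemma kaps_sum: "kaps ls (sum g A) = (\<Sum>a\<in>A. kaps ls (g a))"
  by (induction A rule: infinite_finite_induct) (simp_all only: sum.infinite sum.empty sum.insert kaps_zero kaps_add not_False_eq_True)

lemma kaps_scale: "kaps ls (wscale r w) = wscale r (kaps ls w)"
  by (induction ls) (simp_all only: kaps_Nil kaps_Cons kap_scale)

lemma kaps_kap: "kaps ls (kap l w) = altsign (length ls) (kap l (kaps ls w))"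
proof (induction ls)
  case (Cons k ls)
  then show ?case
    by (simp only: kaps_Cons kap_altsign kap_anticommute[of k l] list.size add_Suc_right add_0_right altsign_Suc altsign_uminus)
qed simp

lemma kap_kaps_mem: "l \<in> set ls \<Longrightarrow> kap l (kaps ls w) = 0"
proof (induction ls)
  case (Cons k ls)
  show ?case
  proof (cases "l = k")
    case True
    then show ?thesis
      by (simp only: kaps_Cons kap_self)
  next
    case False
    then have "l \<in> set ls"
      using Cons.prems by simp
    then have z: "kap l (kaps ls w) = 0"
      by (rule Cons.IH)
    show ?thesis
      by (simp only: kaps_Cons kap_anticommute[of l k] z kap_zero minus_zero)
  qed
qed simp

lemma kaps_kap_mem: "l \<in> set ls \<Longrightarrow> kaps ls (kap l w) = 0"
  by (simp only: kaps_kap kap_kaps_mem altsign_zero)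

text \<open>
  The sign that moves \<open>\<kappa>\<^sub>l\<close> to its place in an increasing product.
\<close>

lemma kap_kaps_insort:
  assumes "sorted ls" "l \<notin> set ls"
  shows "kap l (kaps ls w) = altsign (below (set ls) l) (kaps (insort l ls) w)"
  using assms
proof (induction ls)
  case (Cons k ls)
  show ?case
  proof (cases "l \<le> k")
    case True
    then have "{j \<in> set (k # ls). j < l} = {}"
      using Cons.prems by auto
    then have "below (set (k # ls)) l = 0"
      by (simp only: below_def card.empty)
    then show ?thesis
      using True by (simp del: kaps_Cons)
        (simp add: kaps_def)
  next
    case False
    show ?thesis
    proof (cases "k \<in> set ls")
      case True
      then have "k \<in> set (insort l ls)"
        by (simp add: set_insort_key)
      then have 1: "kaps (insort l (k # ls)) w = 0"
        using False by (simp only: insort_key.simps if_False kaps_Cons kap_kaps_mem)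
      have 2: "kaps (k # ls) w = 0"
        using True by (simp only: kaps_Cons kap_kaps_mem)
      show ?thesis
        by (simp only: 1 2 kap_zero altsign_zero)
    next
      case k: False
      have c: "below (set (k # ls)) l = Suc (below (set ls) l)"
        using below_insert[OF k, of l] False by simp
      have "kap l (kaps (k # ls) w) = - kap k (kap l (kaps ls w))"
        by (simp only: kaps_Cons kap_anticommute[of l k])
      also have "kap l (kaps ls w) = altsign (below (set ls) l) (kaps (insort l ls) w)"
        by (rule Cons.IH) (use Cons.prems in auto)
      also have "- kap k \<dots> = - altsign (below (set ls) l) (kaps (insort l (k # ls)) w)"
        using False by (simp only: kap_altsign insort_key.simps if_False kaps_Cons)
      finally show ?thesis
        by (simp only: c altsign_Suc)
    qed
  qed
qed (simp add: below_def)

section \<open>The coefficient modules of \<open>D\<close>\<close>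

text \<open>
  The coefficients of \<open>D\<^sub>n\<close>, that is \<open>\<Oplus>\<^sub>M Z\<^bsub>n - #M\<^esub>(f) e'\<^sub>M\<close>. It is closed under the contractions because
  \<open>del\<close> commutes with the Koszul differential up to sign, so that it maps cycles to cycles.
\<close>

definition coef_module :: "nat \<Rightarrow> (nat \<Rightarrow> 'a) \<Rightarrow> nat \<Rightarrow> 'a::comm_ring_1 wchain set" where
  "coef_module s f n = {w. \<forall>M. if M \<subseteq> {1..s} \<and> card M \<le> n
     then w M \<in> koszul_cycles {..s} f (n - card M) else w M = 0}"

lemma coef_module_zero: "0 \<in> coef_module s f n"
  by (simp add: coef_module_def koszul_cycles_zero)

lemma coef_module_diff: "v \<in> coef_module s f n \<Longrightarrow> w \<in> coef_module s f n \<Longrightarrow> v - w \<in> coef_module s f n"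
  unfolding coef_module_def by (auto simp: koszul_cycles_diff)

lemma coef_module_uminus: "w \<in> coef_module s f n \<Longrightarrow> - w \<in> coef_module s f n"
  unfolding coef_module_def by (auto simp: koszul_cycles_uminus)

lemma coef_module_add: "v \<in> coef_module s f n \<Longrightarrow> w \<in> coef_module s f n \<Longrightarrow> v + w \<in> coef_module s f n"
  unfolding coef_module_def by (auto simp: koszul_cycles_add)

lemma coef_module_altsign: "w \<in> coef_module s f n \<Longrightarrow> altsign k w \<in> coef_module s f n"
  by (simp add: altsign_def coef_module_uminus)

lemma coef_module_sum: "(\<And>a. a \<in> A \<Longrightarrow> g a \<in> coef_module s f n) \<Longrightarrow> sum g A \<in> coef_module s f n"
  by (induction A rule: infinite_finite_induct) (simp_all only: sum.infinite sum.empty sum.insert coef_module_zero coef_module_add insert_iff simp_thms not_False_eq_True)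

lemma coef_module_scale: "w \<in> coef_module s f n \<Longrightarrow> wscale r w \<in> coef_module s f n"
  unfolding coef_module_def wscale_def by (auto simp: koszul_cycles_scale fun_eq_iff)

lemma coef_module_subset: "w \<in> coef_module s f n \<Longrightarrow> w M \<noteq> 0 \<Longrightarrow> M \<subseteq> {1..s}"
  unfolding coef_module_def by (auto split: if_splits)

lemma coef_module_subset2:
  assumes "w \<in> coef_module s f n" "w M L \<noteq> 0"
  shows "M \<subseteq> {1..s} \<and> L \<subseteq> {..s} \<and> card M + card L = n"
proof -
  have w: "if M \<subseteq> {1..s} \<and> card M \<le> n
     then w M \<in> koszul_cycles {..s} f (n - card M) else w M = 0"
    using assms(1) unfolding coef_module_def by blast
  then have "M \<subseteq> {1..s} \<and> card M \<le> n" "w M \<in> koszul_cycles {..s} f (n - card M)"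
    using assms(2) by (auto split: if_splits)
  then show ?thesis
    using assms(2) unfolding koszul_cycles_def koszul_chains_def by auto
qed

lemma coef_module_cycle:
  assumes "w \<in> coef_module s f (n + card M)"
  shows "w M \<in> koszul_cycles {..s} f n"
proof -
  have "if M \<subseteq> {1..s} \<and> card M \<le> n + card M
     then w M \<in> koszul_cycles {..s} f (n + card M - card M) else w M = 0"
    using assms unfolding coef_module_def by blast
  then show ?thesis
    by (auto simp: koszul_cycles_zero split: if_splits)
qed

lemma coef_module_kap:
  assumes w: "w \<in> coef_module s f (Suc n)"
  shows "kap l w \<in> coef_module s f n"
proof -
  have w': "if M \<subseteq> {1..s} \<and> card M \<le> Suc n
     then w M \<in> koszul_cycles {..s} f (Suc n - card M) else w M = 0" for M
    using w unfolding coef_module_def by blast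
  have *: "if M \<subseteq> {1..s} \<and> card M \<le> n
     then kap l w M \<in> koszul_cycles {..s} f (n - card M) else kap l w M = 0" for M
  proof (cases "M \<subseteq> {1..s}")
    case True
    then have fin: "finite M"
      using finite_subset by blast
    show ?thesis
    proof (cases "card M \<le> n")
      case le: True
      have "w M \<in> koszul_cycles {..s} f (Suc (n - card M))"
        using w'[of M] True le by (simp add: Suc_diff_le)
      then have 1: "del l (w M) \<in> koszul_cycles {..s} f (n - card M)"
        by (simp add: koszul_cycles_del)
      have 2: "del l w M \<in> koszul_cycles {..s} f (n - card M)"
      proof (cases "l \<in> M")
        case False
        then show ?thesis
          using w'[of "insert l M"] le fin
          by (auto simp: del_def koszul_cycles_altsign koszul_cycles_zero split: if_splits)
      qed (simp add: del_def koszul_cycles_zero)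
      show ?thesis
        using True le fin 1 2 by (simp add: kap_def koszul_cycles_add koszul_cycles_altsign)
    next
      case False
      have 1: "del l w M = 0"
        using w'[of "insert l M"] False fin by (auto simp: del_def split: if_splits)
      have "del l (w M) = 0"
      proof (cases "card M = Suc n")
        case True
        then have "w M \<in> koszul_chains {..s} 0"
          using w'[of M] by (auto simp: koszul_cycles_def koszul_chains_zero split: if_splits)
        then show ?thesis
          by (rule koszul_chains_0_del[rotated]) simp
      next
        case c: False
        then have "w M = 0"
          using w'[of M] False by (auto split: if_splits)
        then show ?thesis
          by simp
      qed
      then show ?thesis
        using 1 False by (simp add: kap_def)
    qed
  next
    case False
    then have "w M = 0" "w (insert l M) = 0"
      using w'[of M] w'[of "insert l M"] by auto
    then have "del l w M = 0" "del l (w M) = 0"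
      by (simp_all only: del_def[of l w] altsign_zero if_cancel del_zero)
    then have "kap l w M = 0"
      by (simp add: kap_def)
    then show ?thesis
      using False by simp
  qed
  then show ?thesis
    unfolding coef_module_def by blast
qed

lemma coef_module_kaps: "w \<in> coef_module s f (n + length ls) \<Longrightarrow> kaps ls w \<in> coef_module s f n"
  by (induction ls arbitrary: n) (auto simp: coef_module_kap)

lemma coef_module_ins:
  assumes w: "w \<in> coef_module s f n" and m: "m \<in> {1..s}"
  shows "ins m w \<in> coef_module s f (Suc n)"
proof -
  have w': "if M \<subseteq> {1..s} \<and> card M \<le> n
     then w M \<in> koszul_cycles {..s} f (n - card M) else w M = 0" for M
    using w unfolding coef_module_def by blast
  have *: "if M \<subseteq> {1..s} \<and> card M \<le> Suc n
     then ins m w M \<in> koszul_cycles {..s} f (Suc n - card M) else ins m w M = 0" for M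
  proof (cases "M \<subseteq> {1..s} \<and> m \<in> M")
    case True
    then have "finite M"
      using finite_subset by blast
    then have "card M = Suc (card (M - {m}))"
      using card.remove[of M m] True by blast
    then obtain k where k: "card M = Suc k" "card (M - {m}) = k"
      by blast
    have "M - {m} \<subseteq> {1..s}"
      using True by blast
    then show ?thesis
      using w'[of "M - {m}"] True by (auto simp: k ins_def koszul_cycles_altsign)
  next
    case False
    have "w (M - {m}) = 0" if "\<not> M \<subseteq> {1..s}"
      using w'[of "M - {m}"] that m by (auto split: if_splits)
    then show ?thesis
      using False by (auto simp: ins_def koszul_cycles_zero)
  qed
  then show ?thesis
    unfolding coef_module_def by blast
qed

lemma kap_0_coef_module:
  assumes "w \<in> coef_module s f n"
  shows "kap 0 w M = altsign (card M) (del 0 (w M))"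
proof (cases "finite M")
  case True
  have "w (insert 0 M) = 0"
    using coef_module_subset[OF assms, of "insert 0 M"] by fastforce
  then show ?thesis
    using True by (simp add: kap_def del_def)
next
  case False
  then have "w M = 0"
    using coef_module_subset[OF assms, of M] finite_subset by blast
  then show ?thesis
    using False by (simp add: kap_def)
qed

section \<open>Laurent polynomials by their coefficients\<close>

text \<open>
  The coefficient of a monomial \<open>T\<^sup>\<alpha>\<close> in a chain of \<open>D\<close>, and the chain with given coefficients, which is
  meaningful for a family with finite support.
\<close>

definition cof :: "'a::comm_ring_1 dchain \<Rightarrow> (nat \<Rightarrow>\<^sub>0 int) \<Rightarrow> 'a wchain" where
  "cof x \<alpha> = (\<lambda>M L. Poly_Mapping.lookup (x M L) \<alpha>)"

definition of_cof :: "((nat \<Rightarrow>\<^sub>0 int) \<Rightarrow> 'a::comm_ring_1 wchain) \<Rightarrow> 'a dchain" where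
  "of_cof x = (\<lambda>M L. Poly_Mapping.Abs_poly_mapping (\<lambda>\<alpha>. x \<alpha> M L))"

definition mon :: "int \<Rightarrow> nat set \<Rightarrow> nat \<Rightarrow>\<^sub>0 int" where
  "mon c J = (\<Sum>j\<in>J. Poly_Mapping.single j c)"

definition deg :: "(nat \<Rightarrow>\<^sub>0 int) \<Rightarrow> int" where
  "deg \<alpha> = (\<Sum>j\<in>Poly_Mapping.keys \<alpha>. Poly_Mapping.lookup \<alpha> j)"

text \<open>
  \<open>mono_ok s J \<alpha>\<close>: the monomial \<open>T\<^sup>\<alpha>\<close> lies in the localization of \<open>R[T\<^sub>0, \<dots>, T\<^sub>s]\<close> at \<open>\<Prod>\<^sub>j\<^sub>\<in>\<^sub>J T\<^sub>j\<close>. The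
  monomials with \<open>neg s \<alpha>\<close> are those that lie in the full localization but in no smaller one; they form
  a basis of the top local cohomology.
\<close>

definition mono_ok :: "nat \<Rightarrow> nat set \<Rightarrow> (nat \<Rightarrow>\<^sub>0 int) \<Rightarrow> bool" where
  "mono_ok s J \<alpha> \<longleftrightarrow> (\<forall>j>s. Poly_Mapping.lookup \<alpha> j = 0) \<and> (\<forall>j. j \<notin> J \<longrightarrow> 0 \<le> Poly_Mapping.lookup \<alpha> j)"

definition neg :: "nat \<Rightarrow> (nat \<Rightarrow>\<^sub>0 int) \<Rightarrow> bool" where
  "neg s \<alpha> \<longleftrightarrow> (\<forall>j>s. Poly_Mapping.lookup \<alpha> j = 0) \<and> (\<forall>j\<le>s. Poly_Mapping.lookup \<alpha> j < 0)"

lemma lookup_mon: "finite J \<Longrightarrow> Poly_Mapping.lookup (mon c J) j = (if j \<in> J then c else 0)"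
  by (simp add: mon_def lookup_sum lookup_single when_def)

lemma mon_insert: "finite J \<Longrightarrow> j \<notin> J \<Longrightarrow> mon c (insert j J) = Poly_Mapping.single j c + mon c J"
  by (simp add: mon_def)

lemma keys_subset_atMost:
  "Poly_Mapping.keys \<alpha> \<subseteq> {..s} \<longleftrightarrow> (\<forall>j>s. Poly_Mapping.lookup \<alpha> j = 0)" for s :: nat
  by (auto simp: in_keys_iff subset_iff) (metis not_le)+

lemma wchain_nonzeroE:
  assumes "w \<noteq> (0 :: 'a::zero wchain)"
  obtains M L where "w M L \<noteq> 0"
  using assms by (auto simp: fun_eq_iff)

lemma deg_eq_sum:
  assumes "finite A" "Poly_Mapping.keys \<alpha> \<subseteq> A"
  shows "deg \<alpha> = (\<Sum>j\<in>A. Poly_Mapping.lookup \<alpha> j)"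
  unfolding deg_def
  by (rule sum.mono_neutral_left) (use assms in \<open>auto simp: in_keys_iff\<close>)

lemma deg_atMost: "\<forall>j>s. Poly_Mapping.lookup \<alpha> j = 0 \<Longrightarrow> deg \<alpha> = (\<Sum>j\<le>s. Poly_Mapping.lookup \<alpha> j)"
  by (rule deg_eq_sum) (simp_all add: keys_subset_atMost)

lemma deg_diff_single: "deg (\<alpha> - Poly_Mapping.single l c) = deg \<alpha> - c"
proof -
  let ?A = "insert l (Poly_Mapping.keys \<alpha>)"
  have "deg (\<alpha> - Poly_Mapping.single l c) = (\<Sum>j\<in>?A. Poly_Mapping.lookup (\<alpha> - Poly_Mapping.single l c) j)"
    by (rule deg_eq_sum) (auto simp: in_keys_iff lookup_minus lookup_single when_def split: if_splits)
  also have "\<dots> = (\<Sum>j\<in>?A. Poly_Mapping.lookup \<alpha> j) - (\<Sum>j\<in>?A. if l = j then c else 0)"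
    by (simp only: lookup_minus lookup_single when_def sum_subtractf)
  also have "(\<Sum>j\<in>?A. Poly_Mapping.lookup \<alpha> j) = deg \<alpha>"
    by (rule deg_eq_sum[symmetric]) auto
  also have "(\<Sum>j\<in>?A. if l = j then c else 0) = c"
    by (subst sum.delta') auto
  finally show ?thesis .
qed

lemma deg_add_single: "deg (\<alpha> + Poly_Mapping.single l c) = deg \<alpha> + c"
  using deg_diff_single[of \<alpha> l "- c"] by (simp add: single_uminus)

lemma cof_eqI:
  assumes "\<And>\<alpha>. cof x \<alpha> = cof y \<alpha>"
  shows "x = y"
proof (intro ext poly_mapping_eqI)
  fix M L \<alpha>
  show "Poly_Mapping.lookup (x M L) \<alpha> = Poly_Mapping.lookup (y M L) \<alpha>"
    using fun_cong[OF fun_cong[OF assms[of \<alpha>], of M], of L] by (simp only: cof_def)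
qed

lemma cof_zero [simp]: "cof 0 \<alpha> = 0"
  by (simp add: cof_def fun_eq_iff)

lemma cof_add: "cof (x + y) \<alpha> = cof x \<alpha> + cof y \<alpha>"
  by (simp add: cof_def fun_eq_iff lookup_add)

lemma cof_diff: "cof (x - y) \<alpha> = cof x \<alpha> - cof y \<alpha>"
  by (simp add: cof_def fun_eq_iff lookup_minus)

lemma cof_uminus: "cof (- x) \<alpha> = - cof x \<alpha>"
  by (simp add: cof_def fun_eq_iff)

lemma cof_altsign: "cof (altsign n x) \<alpha> = altsign n (cof x \<alpha>)"
  by (simp add: altsign_def cof_uminus)

lemma cof_sum: "cof (sum g A) \<alpha> = (\<Sum>a\<in>A. cof (g a) \<alpha>)"
  by (induction A rule: infinite_finite_induct)
    (simp_all only: sum.infinite sum.empty sum.insert cof_zero cof_add not_False_eq_True)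

lemma lookup_single_mult:
  "Poly_Mapping.lookup (Poly_Mapping.single k c * p) \<alpha> = c * Poly_Mapping.lookup p (\<alpha> - k)"
  for p :: "'a::comm_ring_1 laurent"
proof -
  have "\<alpha> = k + q \<longleftrightarrow> q = \<alpha> - k" for q
    by (auto simp: algebra_simps)
  then show ?thesis
    by (simp add: lookup_mult lookup_single when_mult)
qed

lemma cof_Const: "cof (\<lambda>M L. Const r * x M L) \<alpha> = wscale r (cof x \<alpha>)"
  by (simp add: cof_def Const_def wscale_def lookup_single_mult)

lemma prod_Tvar_power:
  assumes "finite J"
  shows "(\<Prod>j\<in>J. Tvar j) ^ n = (Poly_Mapping.single (mon (int n) J) 1 :: 'a::comm_ring_1 laurent)"
proof (induction n)
  case 0
  have "mon 0 J = 0"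
    by (simp add: mon_def)
  then show ?case
    by simp
next
  case (Suc n)
  have 1: "(\<Prod>j\<in>J. Tvar j) = (Poly_Mapping.single (mon 1 J) 1 :: 'a laurent)"
    using assms
  proof (induction J rule: finite_induct)
    case empty
    then show ?case
      by (simp add: mon_def)
  next
    case (insert j J)
    then show ?case
      by (simp add: mon_insert Tvar_def mult_single)
  qed
  have "mon 1 J + mon (int n) J = mon (int (Suc n)) J"
    by (rule poly_mapping_eqI) (simp add: lookup_add lookup_mon assms)
  then show ?case
    using Suc 1 by (simp add: mult_single)
qed

lemma cof_prod_Tvar:
  "finite J \<Longrightarrow> cof (\<lambda>M L. (\<Prod>j\<in>J. Tvar j) ^ n * x M L) \<alpha> = cof x (\<alpha> - mon (int n) J)"
  by (simp only: prod_Tvar_power cof_def lookup_single_mult mult_1)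

lemma cof_of_cof:
  assumes "finite {\<alpha>. x \<alpha> \<noteq> 0}"
  shows "cof (of_cof x) \<alpha> = x \<alpha>"
proof (intro ext)
  fix M L
  have "{\<alpha>. x \<alpha> M L \<noteq> 0} \<subseteq> {\<alpha>. x \<alpha> \<noteq> 0}"
    by auto
  then have "finite {\<alpha>. x \<alpha> M L \<noteq> 0}"
    using assms finite_subset by blast
  then show "cof (of_cof x) \<alpha> M L = x \<alpha> M L"
    by (simp add: cof_def of_cof_def)
qed

lemma finite_cof_support:
  assumes "\<And>\<alpha>. cof x \<alpha> \<in> coef_module s f n"
  shows "finite {\<alpha>. cof x \<alpha> \<noteq> 0}"
proof (rule finite_subset)
  show "finite (\<Union>M\<in>Pow {1..s}. \<Union>L\<in>Pow {..s}. Poly_Mapping.keys (x M L))"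
    by auto
  show "{\<alpha>. cof x \<alpha> \<noteq> 0} \<subseteq> (\<Union>M\<in>Pow {1..s}. \<Union>L\<in>Pow {..s}. Poly_Mapping.keys (x M L))"
  proof
    fix \<alpha> assume "\<alpha> \<in> {\<alpha>. cof x \<alpha> \<noteq> 0}"
    then obtain M L where nz: "cof x \<alpha> M L \<noteq> 0"
      by (auto simp: fun_eq_iff)
    then have "M \<subseteq> {1..s} \<and> L \<subseteq> {..s}"
      using coef_module_subset2[OF assms nz] by blast
    moreover have "\<alpha> \<in> Poly_Mapping.keys (x M L)"
      using nz by (simp add: cof_def in_keys_iff)
    ultimately show "\<alpha> \<in> (\<Union>M\<in>Pow {1..s}. \<Union>L\<in>Pow {..s}. Poly_Mapping.keys (x M L))"
      by blast
  qed
qed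

text \<open>
  The differential of \<open>D\<close> is \<open>\<Sum>\<^sub>l T\<^sub>l \<kappa>\<^sub>l\<close>.
\<close>

lemma cof_D_diff:
  assumes x: "\<And>\<alpha>. cof x \<alpha> \<in> coef_module s f n"
  shows "cof (D_diff s x) \<alpha> = (\<Sum>l\<le>s. kap l (cof x (\<alpha> - Poly_Mapping.single l 1)))"
proof (intro ext)
  fix M L
  have supp: "M \<subseteq> {1..s} \<and> L \<subseteq> {..s}" if "x M L \<noteq> 0" for M L
  proof -
    have "\<exists>\<beta>. cof x \<beta> M L \<noteq> 0"
      using that by (auto simp: cof_def poly_mapping_eq_iff fun_eq_iff)
    then obtain \<beta> where "cof x \<beta> M L \<noteq> 0" ..
    then show ?thesis
      using coef_module_subset2[OF x] by blast
  qed
  have suppM: "M \<subseteq> {1..s}" if "x M \<noteq> 0" for M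
    using that supp[of M] by (auto simp: fun_eq_iff)
  have sl: "Poly_Mapping.lookup (altsign n p) \<beta> = altsign n (Poly_Mapping.lookup p \<beta>)"
    for n \<beta> and p :: "'a laurent"
    by (simp add: altsign_def)
  have l1: "Poly_Mapping.lookup (del l x M L) \<beta> = del l (cof x \<beta>) M L" for l \<beta>
    by (simp add: del_def cof_def altsign_apply sl)
  have l2: "Poly_Mapping.lookup (del l (x M) L) \<beta> = del l (cof x \<beta> M) L" for l \<beta>
    by (simp add: del_def cof_def altsign_apply sl)
  have T: "Poly_Mapping.lookup (Tvar l * p) \<beta> = Poly_Mapping.lookup p (\<beta> - Poly_Mapping.single l 1)"
    for l \<beta> and p :: "'a laurent"
    by (simp add: Tvar_def lookup_single_mult)
  have "koszul_diff {1..s} (\<lambda>m u L. Tvar m * u L) x = (\<lambda>K. \<Sum>l\<in>{1..s}. (\<lambda>L. Tvar l * del l x K L))"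
    by (rule koszul_diff_eq_del) (use suppM in \<open>auto simp: fun_eq_iff\<close>)
  then have "koszul_diff {1..s} (\<lambda>m u L. Tvar m * u L) x M L = (\<Sum>l\<in>{1..s}. Tvar l * del l x M L)"
    by (simp only: sum_apply)
  also have "\<dots> = (\<Sum>l\<le>s. Tvar l * del l x M L)"
  proof (rule sum.mono_neutral_left)
    have "x (insert 0 M) = 0"
      using suppM[of "insert 0 M"] by fastforce
    then have "del 0 x M = 0"
      by (simp only: del_def altsign_zero if_cancel)
    then have "del 0 x M L = 0"
      by (simp only: zero_fun_apply)
    moreover have "i = 0" if "i \<in> {..s} - {1..s}" for i
      using that by auto
    ultimately show "\<forall>i\<in>{..s} - {1..s}. Tvar i * del i x M L = 0"
      by (metis mult_zero_right)
  qed auto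
  finally have 1: "koszul_diff {1..s} (\<lambda>m u L. Tvar m * u L) x M L = (\<Sum>l\<le>s. Tvar l * del l x M L)" .
  have "approx_diff s (x M) = (\<lambda>K. \<Sum>l\<in>{..s}. Tvar l * del l (x M) K)"
    unfolding approx_diff_def by (rule koszul_diff_eq_del) (use supp[of M] in auto)
  then have "approx_diff s (x M) L = (\<Sum>l\<le>s. Tvar l * del l (x M) L)"
    by (simp only:)
  with 1 have "D_diff s x M L
      = (\<Sum>l\<le>s. Tvar l * del l x M L) + altsign (card M) (\<Sum>l\<le>s. Tvar l * del l (x M) L)"
    by (simp only: D_diff_def plus_fun_apply altsign_apply)
  then have 2: "cof (D_diff s x) \<alpha> M L
      = (\<Sum>l\<le>s. del l (cof x (\<alpha> - Poly_Mapping.single l 1)) M L)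
        + altsign (card M) (\<Sum>l\<le>s. del l (cof x (\<alpha> - Poly_Mapping.single l 1) M) L)"
    by (simp only: cof_def[of "D_diff s x"] lookup_add lookup_sum sl T l1 l2)
  show "cof (D_diff s x) \<alpha> M L = (\<Sum>l\<le>s. kap l (cof x (\<alpha> - Poly_Mapping.single l 1))) M L"
  proof (cases "finite M")
    case True
    then show ?thesis
      by (simp add: 2 sum_apply kap_def sum.distrib altsign_sum altsign_apply)
  next
    case False
    then have z: "cof x \<beta> M = 0" "cof x \<beta> (insert l M) = 0" for \<beta> l
      using coef_module_subset[OF x, of \<beta> M] coef_module_subset[OF x, of \<beta> "insert l M"]
        finite_subset[of M "{1..s}"] by auto
    have "del l (cof x \<beta>) M = 0" "del l (cof x \<beta> M) = 0" for l \<beta>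
      by (simp_all only: z del_zero) (simp only: del_def z altsign_zero if_cancel)
    then show ?thesis
      using False by (simp add: 2 sum_apply kap_def)
  qed
qed

section \<open>The localizations of \<open>D\<close>\<close>

lemma poly_carrier_iff: "p \<in> poly_carrier s \<longleftrightarrow> (\<forall>\<alpha>. Poly_Mapping.lookup p \<alpha> \<noteq> 0 \<longrightarrow> mono_ok s {} \<alpha>)"
  unfolding poly_carrier_def mono_ok_def by (auto simp: in_keys_iff keys_subset_atMost)

text \<open>
  The assumption is what \<open>grade (f) \<ge> 1\<close> contributes: no nonzero element is annihilated by all \<open>f\<^sub>l\<close>.
  It makes the truncation of \<open>\<Z>(f)\<close> at \<open>q = s\<close> invisible, since the omitted cycles vanish.
\<close>

locale approximation_complex =
  fixes s :: nat and f :: "nat \<Rightarrow> 'a::comm_ring_1"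
  assumes top_cycles: "koszul_cycles {..s} f (Suc s) = {0}"
begin

lemma koszul_cycles_trivial:
  assumes "s < q" "c \<in> koszul_cycles {..s} f q"
  shows "c = 0"
proof (cases "q = Suc s")
  case True
  then show ?thesis
    using assms top_cycles by blast
next
  case False
  have "c K = 0" for K
  proof (rule ccontr)
    assume "c K \<noteq> 0"
    then have "K \<subseteq> {..s} \<and> card K = q"
      using assms(2) koszul_chainsD unfolding koszul_cycles_def by blast
    then show False
      using card_mono[of "{..s}" K] False assms(1) by simp
  qed
  then show ?thesis
    by (simp add: fun_eq_iff)
qed

lemma approx_chains_iff:
  "u \<in> approx_chains s f q \<longleftrightarrow> (\<forall>L. u L \<in> poly_carrier s) \<and>
     (\<forall>\<alpha>. (\<lambda>L. Poly_Mapping.lookup (u L) \<alpha>) \<in> koszul_cycles {..s} f q)"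
proof (cases "q \<le> s")
  case False
  have "u = 0" if "\<forall>\<alpha>. (\<lambda>L. Poly_Mapping.lookup (u L) \<alpha>) \<in> koszul_cycles {..s} f q"
  proof (intro ext poly_mapping_eqI)
    fix L \<alpha>
    have "(\<lambda>L. Poly_Mapping.lookup (u L) \<alpha>) = 0"
      using koszul_cycles_trivial[of q] False that by simp
    from fun_cong[OF this, of L] show "Poly_Mapping.lookup (u L) \<alpha> = Poly_Mapping.lookup (0 L) \<alpha>"
      by simp
  qed
  moreover have "(\<lambda>L. 0) \<in> koszul_cycles {..s} f q"
    using koszul_cycles_zero[of "{..s}" f q] by (simp add: zero_fun_def)
  ultimately show ?thesis
    using False by (auto simp: approx_chains_def poly_carrier_def)
qed (simp add: approx_chains_def)

lemma D_chains_iff: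
  "x \<in> D_chains s f i \<longleftrightarrow>
     (\<forall>\<alpha>. cof x \<alpha> \<in> coef_module s f i \<and> (cof x \<alpha> \<noteq> 0 \<longrightarrow> mono_ok s {} \<alpha>))"
proof
  assume x: "x \<in> D_chains s f i"
  have xM: "if M \<subseteq> {1..s} \<and> card M \<le> i then x M \<in> approx_chains s f (i - card M) else x M = 0" for M
    using x unfolding D_chains_def by blast
  have cM: "cof x \<alpha> M = (\<lambda>L. Poly_Mapping.lookup (x M L) \<alpha>)" for M \<alpha>
    by (simp only: cof_def)
  have *: "if M \<subseteq> {1..s} \<and> card M \<le> i
     then cof x \<alpha> M \<in> koszul_cycles {..s} f (i - card M) else cof x \<alpha> M = 0" for M \<alpha>
    using xM[of M] unfolding cM by (auto simp: approx_chains_iff fun_eq_iff split: if_splits)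
  have "mono_ok s {} \<alpha>" if nonzero: "cof x \<alpha> \<noteq> 0" for \<alpha>
  proof -
    obtain M L where nz: "cof x \<alpha> M L \<noteq> 0"
      by (rule wchain_nonzeroE[OF nonzero])
    then have "x M L \<in> poly_carrier s"
      using xM[of M] by (auto simp: cof_def approx_chains_iff split: if_splits)
    then show ?thesis
      using nz by (simp add: poly_carrier_iff cof_def)
  qed
  with * show "\<forall>\<alpha>. cof x \<alpha> \<in> coef_module s f i \<and> (cof x \<alpha> \<noteq> 0 \<longrightarrow> mono_ok s {} \<alpha>)"
    unfolding coef_module_def by blast
next
  assume x: "\<forall>\<alpha>. cof x \<alpha> \<in> coef_module s f i \<and> (cof x \<alpha> \<noteq> 0 \<longrightarrow> mono_ok s {} \<alpha>)"
  have cM: "if M \<subseteq> {1..s} \<and> card M \<le> i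
     then cof x \<alpha> M \<in> koszul_cycles {..s} f (i - card M) else cof x \<alpha> M = 0" for M \<alpha>
    using x unfolding coef_module_def by blast
  have pc: "x M L \<in> poly_carrier s" for M L
  proof -
    have "mono_ok s {} \<alpha>" if "Poly_Mapping.lookup (x M L) \<alpha> \<noteq> 0" for \<alpha>
    proof -
      have "cof x \<alpha> M L \<noteq> 0"
        using that by (simp add: cof_def)
      then have "cof x \<alpha> \<noteq> 0"
        by (metis zero_fun_apply)
      then show ?thesis
        using x by blast
    qed
    then show ?thesis
      by (simp add: poly_carrier_iff)
  qed
  have "if M \<subseteq> {1..s} \<and> card M \<le> i then x M \<in> approx_chains s f (i - card M) else x M = 0" for M
  proof (cases "M \<subseteq> {1..s} \<and> card M \<le> i")
    case True
    then have "cof x \<alpha> M \<in> koszul_cycles {..s} f (i - card M)" for \<alpha>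
      using cM[of M \<alpha>] by simp
    then show ?thesis
      using True pc by (simp add: approx_chains_iff cof_def)
  next
    case False
    then have "cof x \<alpha> M = 0" for \<alpha>
      using cM[of M \<alpha>] by (simp only: if_False)
    then have "x M L = 0" for L
      by (intro poly_mapping_eqI) (metis cof_def lookup_zero zero_fun_apply)
    then have "x M = 0"
      by (simp add: fun_eq_iff)
    with False show ?thesis
      by (simp only: if_False)
  qed
  then show "x \<in> D_chains s f i"
    unfolding D_chains_def by blast
qed

text \<open>
  A family of coefficients with finite support has bounded pole order, so one power of \<open>\<Prod>\<^sub>j\<^sub>\<in>\<^sub>J T\<^sub>j\<close> clears
  all denominators. Hence localizations can be recognized one monomial at a time.
\<close>

lemma localization_iff:
  assumes J: "J \<subseteq> {..s}"
  shows "x \<in> localization J (D_chains s f i) \<longleftrightarrow>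
     (\<forall>\<alpha>. cof x \<alpha> \<in> coef_module s f i \<and> (cof x \<alpha> \<noteq> 0 \<longrightarrow> mono_ok s J \<alpha>))"
proof
  have fin: "finite J"
    using J finite_subset by blast
  assume "x \<in> localization J (D_chains s f i)"
  then obtain n where n: "(\<lambda>M L. (\<Prod>j\<in>J. Tvar j) ^ n * x M L) \<in> D_chains s f i"
    unfolding localization_def by blast
  show "\<forall>\<alpha>. cof x \<alpha> \<in> coef_module s f i \<and> (cof x \<alpha> \<noteq> 0 \<longrightarrow> mono_ok s J \<alpha>)"
  proof
    fix \<alpha>
    have *: "cof x (\<beta> - mon (int n) J) \<in> coef_module s f i
        \<and> (cof x (\<beta> - mon (int n) J) \<noteq> 0 \<longrightarrow> mono_ok s {} \<beta>)" for \<beta>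
      using n unfolding D_chains_iff cof_prod_Tvar[OF fin] by blast
    have "mono_ok s J \<alpha>" if "mono_ok s {} (\<alpha> + mon (int n) J)"
      using that J by (auto simp: mono_ok_def lookup_add lookup_mon[OF fin] split: if_splits)
    then show "cof x \<alpha> \<in> coef_module s f i \<and> (cof x \<alpha> \<noteq> 0 \<longrightarrow> mono_ok s J \<alpha>)"
      using *[of "\<alpha> + mon (int n) J"] unfolding add_diff_cancel_right' by blast
  qed
next
  have fin: "finite J"
    using J finite_subset by blast
  assume x: "\<forall>\<alpha>. cof x \<alpha> \<in> coef_module s f i \<and> (cof x \<alpha> \<noteq> 0 \<longrightarrow> mono_ok s J \<alpha>)"
  \<comment> \<open>the pole orders that occur\<close>
  define B where "B = (\<lambda>(\<alpha>, j). - Poly_Mapping.lookup \<alpha> j) ` ({\<alpha>. cof x \<alpha> \<noteq> 0} \<times> J)"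
  have "finite B"
    unfolding B_def using finite_cof_support[of x s f i] x fin by simp
  define n where "n = nat (Max (insert 0 B))"
  have bound: "- Poly_Mapping.lookup \<alpha> j \<le> int n" if "cof x \<alpha> \<noteq> 0" "j \<in> J" for \<alpha> j
  proof -
    have "- Poly_Mapping.lookup \<alpha> j \<in> insert 0 B"
      unfolding B_def using that by force
    then have "- Poly_Mapping.lookup \<alpha> j \<le> Max (insert 0 B)"
      using \<open>finite B\<close> by (intro Max_ge) auto
    then show ?thesis
      by (simp add: n_def)
  qed
  have "mono_ok s {} \<beta>" if "cof x (\<beta> - mon (int n) J) \<noteq> 0" for \<beta>
  proof -
    have ok: "mono_ok s J (\<beta> - mon (int n) J)"
      using x that by blast
    have "0 \<le> Poly_Mapping.lookup \<beta> j" for j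
    proof (cases "j \<in> J")
      case True
      then show ?thesis
        using bound[OF that True] by (simp add: lookup_minus lookup_mon[OF fin])
    next
      case False
      then show ?thesis
        using ok by (simp add: mono_ok_def lookup_minus lookup_mon[OF fin])
    qed
    moreover have "Poly_Mapping.lookup \<beta> j = 0" if "j > s" for j
    proof -
      have "j \<notin> J"
        using that J by auto
      then show ?thesis
        using ok that by (simp add: mono_ok_def lookup_minus lookup_mon[OF fin])
    qed
    ultimately show ?thesis
      by (simp add: mono_ok_def)
  qed
  then have "(\<lambda>M L. (\<Prod>j\<in>J. Tvar j) ^ n * x M L) \<in> D_chains s f i"
    unfolding D_chains_iff cof_prod_Tvar[OF fin] using x by blast
  then show "x \<in> localization J (D_chains s f i)"
    unfolding localization_def by blast
qed

end

section \<open>Chains in a localization\<close>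

text \<open>
  The reason why differentials of the form \<open>\<Sum>\<^sub>l x\<^sub>l \<kappa>\<^sub>l\<close> square to zero. The vanishing of the diagonal is a
  separate assumption because \<open>2\<close> may be a zero divisor.
\<close>

lemma sum_antisymmetric:
  fixes g :: "nat \<Rightarrow> nat \<Rightarrow> 'm::ab_group_add"
  assumes "\<And>k l. g k l = - g l k" "\<And>l. g l l = 0"
  shows "(\<Sum>l\<le>n. \<Sum>k\<le>n. g l k) = 0"
proof (induction n)
  case 0
  then show ?case
    by (simp only: atMost_0 sum.insert_remove sum.empty Diff_empty finite.emptyI insert_Diff_if Diff_insert0 assms(2)) simp
next
  case (Suc n)
  have "(\<Sum>k\<le>n. g (Suc n) k) = - (\<Sum>k\<le>n. g k (Suc n))"
    by (subst assms(1)) (simp only: sum_negf)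
  then have "(\<Sum>l\<le>Suc n. \<Sum>k\<le>Suc n. g l k) = (\<Sum>l\<le>n. \<Sum>k\<le>n. g l k)"
    by (simp only: sum.atMost_Suc sum.distrib assms(2)) simp
  with Suc show ?case
    by (simp only:)
qed

definition cscale :: "'a::comm_ring_1 \<Rightarrow> 'a cchain \<Rightarrow> 'a cchain" where
  "cscale r c = (\<lambda>J M L. Const r * c J M L)"

lemma cof_cscale: "cof (cscale r c J) \<alpha> = wscale r (cof (c J) \<alpha>)"
  unfolding cscale_def by (rule cof_Const)

lemma cchain_apply:
  fixes c d :: "'a::comm_ring_1 cchain"
  shows "(c - d) J = c J - d J" "(c + d) J = c J + d J" "(0 :: 'a cchain) J = 0"
  by simp_all

lemma inv_apply:
  fixes x y :: "(nat \<Rightarrow>\<^sub>0 int) \<Rightarrow> 'a::comm_ring_1 wchain"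
  shows "(x - y) \<alpha> = x \<alpha> - y \<alpha>" "(x + y) \<alpha> = x \<alpha> + y \<alpha>"
    "(0 :: (nat \<Rightarrow>\<^sub>0 int) \<Rightarrow> 'a wchain) \<alpha> = 0"
  by simp_all

lemma wscale_zero [simp]: "wscale r 0 = 0"
  by (simp add: wscale_def fun_eq_iff)

context approximation_complex
begin

definition loc_chains :: "nat set \<Rightarrow> nat \<Rightarrow> 'a dchain set" where
  "loc_chains J i = {x. \<forall>\<alpha>. cof x \<alpha> \<in> coef_module s f i \<and> (cof x \<alpha> \<noteq> 0 \<longrightarrow> mono_ok s J \<alpha>)}"

lemma loc_chainsI:
  assumes "\<And>\<alpha>. cof x \<alpha> \<in> coef_module s f i" "\<And>\<alpha>. cof x \<alpha> \<noteq> 0 \<Longrightarrow> mono_ok s J \<alpha>"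
  shows "x \<in> loc_chains J i"
  using assms unfolding loc_chains_def by blast

lemma loc_chains_coef: "x \<in> loc_chains J i \<Longrightarrow> cof x \<alpha> \<in> coef_module s f i"
  unfolding loc_chains_def by blast

lemma loc_chains_mono: "x \<in> loc_chains J i \<Longrightarrow> cof x \<alpha> \<noteq> 0 \<Longrightarrow> mono_ok s J \<alpha>"
  unfolding loc_chains_def by blast

lemma localization_eq: "J \<subseteq> {..s} \<Longrightarrow> localization J (D_chains s f i) = loc_chains J i"
  unfolding loc_chains_def using localization_iff[of J _ i] by blast

lemma loc_chains_zero: "0 \<in> loc_chains J i"
  by (rule loc_chainsI) (simp_all only: cof_zero coef_module_zero simp_thms)

lemma loc_chains_diff:
  assumes "x \<in> loc_chains J i" "y \<in> loc_chains J i"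
  shows "x - y \<in> loc_chains J i"
proof (rule loc_chainsI)
  fix \<alpha>
  show "cof (x - y) \<alpha> \<in> coef_module s f i"
    unfolding cof_diff by (intro coef_module_diff loc_chains_coef[OF assms(1)] loc_chains_coef[OF assms(2)])
  assume "cof (x - y) \<alpha> \<noteq> 0"
  then have "cof x \<alpha> \<noteq> 0 \<or> cof y \<alpha> \<noteq> 0"
    unfolding cof_diff by (metis diff_self)
  then show "mono_ok s J \<alpha>"
    using loc_chains_mono assms by blast
qed

lemma mono_ok_shift:
  assumes l: "l \<le> s" and ok: "mono_ok s J (\<alpha> - Poly_Mapping.single l 1)"
  shows "mono_ok s J \<alpha>"
proof -
  have e: "Poly_Mapping.lookup (\<alpha> - Poly_Mapping.single l 1) j
      = (if j = l then Poly_Mapping.lookup \<alpha> l - 1 else Poly_Mapping.lookup \<alpha> j)" for j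
    by (simp add: lookup_minus lookup_single when_def)
  have "Poly_Mapping.lookup \<alpha> j = 0" if j: "j > s" for j
  proof -
    have "Poly_Mapping.lookup (\<alpha> - Poly_Mapping.single l 1) j = 0"
      using ok j unfolding mono_ok_def by blast
    then show ?thesis
      using l j by (simp add: e)
  qed
  moreover have "0 \<le> Poly_Mapping.lookup \<alpha> j" if j: "j \<notin> J" for j
  proof -
    have "0 \<le> Poly_Mapping.lookup (\<alpha> - Poly_Mapping.single l 1) j"
      using ok j unfolding mono_ok_def by blast
    then show ?thesis
      by (simp add: e split: if_splits)
  qed
  ultimately show ?thesis
    unfolding mono_ok_def by blast
qed

lemma D_diff_loc_chains:
  assumes x: "x \<in> loc_chains J (Suc i)"
  shows "D_diff s x \<in> loc_chains J i"
proof (rule loc_chainsI)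
  fix \<alpha>
  note D = cof_D_diff[OF loc_chains_coef[OF x]]
  show "cof (D_diff s x) \<alpha> \<in> coef_module s f i"
    unfolding D by (intro coef_module_sum coef_module_kap loc_chains_coef[OF x])
  assume nz: "cof (D_diff s x) \<alpha> \<noteq> 0"
  have "\<exists>l\<le>s. cof x (\<alpha> - Poly_Mapping.single l 1) \<noteq> 0"
  proof (rule ccontr)
    assume "\<not> ?thesis"
    then have "kap l (cof x (\<alpha> - Poly_Mapping.single l 1)) = 0" if "l \<in> {..s}" for l
      using that kap_zero by (metis atMost_iff)
    then have "cof (D_diff s x) \<alpha> = 0"
      unfolding D by (rule sum.neutral[rule_format])
    with nz show False
      by blast
  qed
  then obtain l where l: "l \<le> s" "cof x (\<alpha> - Poly_Mapping.single l 1) \<noteq> 0"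
    by blast
  show "mono_ok s J \<alpha>"
    by (rule mono_ok_shift[OF l(1) loc_chains_mono[OF x l(2)]])
qed

lemma D_diff_diff:
  assumes "x \<in> loc_chains J i" "y \<in> loc_chains J i"
  shows "D_diff s (x - y) = D_diff s x - D_diff s y"
proof (rule cof_eqI)
  fix \<alpha>
  show "cof (D_diff s (x - y)) \<alpha> = cof (D_diff s x - D_diff s y) \<alpha>"
    by (simp only: cof_D_diff[OF loc_chains_coef[OF assms(1)]] cof_D_diff[OF loc_chains_coef[OF assms(2)]]
        cof_D_diff[OF loc_chains_coef[OF loc_chains_diff[OF assms]]] cof_diff kap_diff sum_subtractf)
qed

lemma D_diff_zero: "D_diff s (0 :: 'a dchain) = 0"
  using D_diff_diff[OF loc_chains_zero loc_chains_zero] by (simp only: diff_self)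

lemma T_homogeneous_iff:
  assumes "x \<in> loc_chains J i"
  shows "x \<in> T_homogeneous 0 \<longleftrightarrow> (\<forall>\<alpha>. cof x \<alpha> \<noteq> 0 \<longrightarrow> deg \<alpha> = - int i)"
proof -
  have *: "card M + card L = i" if "cof x \<alpha> M L \<noteq> 0" for \<alpha> M L
    using coef_module_subset2[OF loc_chains_coef[OF assms] that] by blast
  have "x \<in> T_homogeneous 0 \<longleftrightarrow> (\<forall>M L \<alpha>. cof x \<alpha> M L \<noteq> 0 \<longrightarrow> deg \<alpha> + int (card M) + int (card L) = 0)"
    unfolding T_homogeneous_def deg_def cof_def by (simp add: in_keys_iff Ball_def)
  also have "\<dots> \<longleftrightarrow> (\<forall>M L \<alpha>. cof x \<alpha> M L \<noteq> 0 \<longrightarrow> deg \<alpha> = - int i)"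
  proof -
    have "deg \<alpha> + int (card M) + int (card L) = 0 \<longleftrightarrow> deg \<alpha> = - int i" if "cof x \<alpha> M L \<noteq> 0" for \<alpha> M L
      using *[OF that] by linarith
    then show ?thesis
      by (simp cong: imp_cong)
  qed
  also have "\<dots> \<longleftrightarrow> (\<forall>\<alpha>. cof x \<alpha> \<noteq> 0 \<longrightarrow> deg \<alpha> = - int i)"
  proof (intro iffI allI impI)
    fix \<alpha> assume a: "\<forall>M L \<alpha>. cof x \<alpha> M L \<noteq> 0 \<longrightarrow> deg \<alpha> = - int i" and nz: "cof x \<alpha> \<noteq> 0"
    obtain M L where "cof x \<alpha> M L \<noteq> 0"
      by (rule wchain_nonzeroE[OF nz])
    with a show "deg \<alpha> = - int i"
      by simp
  next
    fix M L \<alpha> assume a: "\<forall>\<alpha>. cof x \<alpha> \<noteq> 0 \<longrightarrow> deg \<alpha> = - int i" and nz: "cof x \<alpha> M L \<noteq> 0"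
    have "cof x \<alpha> \<noteq> 0"
    proof
      assume "cof x \<alpha> = 0"
      from nz[unfolded this] show False
        by simp
    qed
    with a show "deg \<alpha> = - int i"
      by simp
  qed
  finally show ?thesis .
qed

section \<open>Cech cochains\<close>

definition cech_chains :: "nat \<Rightarrow> nat \<Rightarrow> 'a cchain set" where
  "cech_chains p i = {c. \<forall>J. if J \<subseteq> {..s} \<and> card J = p then c J \<in> loc_chains J i else c J = 0}"

lemma cech_chainsD: "c \<in> cech_chains p i \<Longrightarrow> J \<subseteq> {..s} \<Longrightarrow> card J = p \<Longrightarrow> c J \<in> loc_chains J i"
  unfolding cech_chains_def mem_Collect_eq by (elim allE[of _ J]) simp

lemma cech_chains_eq_0: "c \<in> cech_chains p i \<Longrightarrow> \<not> (J \<subseteq> {..s} \<and> card J = p) \<Longrightarrow> c J = 0"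
  unfolding cech_chains_def mem_Collect_eq by (elim allE[of _ J]) (simp only: if_False)

lemma cech_chainsI:
  assumes "\<And>J. J \<subseteq> {..s} \<Longrightarrow> card J = p \<Longrightarrow> c J \<in> loc_chains J i"
    "\<And>J. \<not> (J \<subseteq> {..s} \<and> card J = p) \<Longrightarrow> c J = 0"
  shows "c \<in> cech_chains p i"
  unfolding cech_chains_def mem_Collect_eq
proof
  fix J
  show "if J \<subseteq> {..s} \<and> card J = p then c J \<in> loc_chains J i else c J = 0"
    by (cases "J \<subseteq> {..s} \<and> card J = p") (simp_all only: if_True if_False assms simp_thms)
qed

lemma cech_module_eq: "cech_module s f p i = module_on cscale (cech_chains p i)"
proof -
  have "(if J \<subseteq> {..s} \<and> card J = p then c J \<in> localization J (D_chains s f i) else c J = 0)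
    \<longleftrightarrow> (if J \<subseteq> {..s} \<and> card J = p then c J \<in> loc_chains J i else c J = 0)" for c J
    by (cases "J \<subseteq> {..s} \<and> card J = p") (simp_all only: localization_eq simp_thms if_True if_False)
  then show ?thesis
    unfolding cech_module_def cech_chains_def cscale_def[abs_def] by (simp only:)
qed

lemma cech_chains_diff:
  assumes c: "c \<in> cech_chains p i" and d: "d \<in> cech_chains p i"
  shows "c - d \<in> cech_chains p i"
proof (rule cech_chainsI)
  fix J
  show "(c - d) J \<in> loc_chains J i" if "J \<subseteq> {..s}" "card J = p"
    unfolding cchain_apply by (intro loc_chains_diff cech_chainsD[OF c that] cech_chainsD[OF d that])
  show "(c - d) J = 0" if "\<not> (J \<subseteq> {..s} \<and> card J = p)"
    unfolding cchain_apply cech_chains_eq_0[OF c that] cech_chains_eq_0[OF d that] by simp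
qed

lemma cech_chains_zero: "0 \<in> cech_chains p i"
  by (rule cech_chainsI) (simp_all only: cchain_apply loc_chains_zero)

lemma cech_chains_cscale:
  assumes c: "c \<in> cech_chains p i"
  shows "cscale r c \<in> cech_chains p i"
proof (rule cech_chainsI)
  fix J
  assume J: "J \<subseteq> {..s}" "card J = p"
  note cJ = cech_chainsD[OF c J]
  show "cscale r c J \<in> loc_chains J i"
  proof (rule loc_chainsI)
    fix \<alpha>
    show "cof (cscale r c J) \<alpha> \<in> coef_module s f i"
      unfolding cof_cscale by (rule coef_module_scale[OF loc_chains_coef[OF cJ]])
    assume "cof (cscale r c J) \<alpha> \<noteq> 0"
    then have "cof (c J) \<alpha> \<noteq> 0"
      unfolding cof_cscale using wscale_zero by metis
    then show "mono_ok s J \<alpha>"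
      by (rule loc_chains_mono[OF cJ])
  qed
next
  fix J
  assume "\<not> (J \<subseteq> {..s} \<and> card J = p)"
  then have "c J = 0"
    by (rule cech_chains_eq_0[OF c])
  then show "cscale r c J = 0"
    by (simp add: cscale_def fun_eq_iff)
qed

lemma cof_cech_diff:
  assumes "J \<subseteq> {..s}"
  shows "cof (cech_diff s c J) \<alpha> = (\<Sum>j\<in>J. altsign (below J j) (cof (c (J - {j})) \<alpha>))"
  by (simp only: cech_diff_def assms if_True cof_sum cof_altsign below_def)

text \<open>
  The coefficients of a top cochain at the monomials with only negative exponents. They determine its
  class in the top local cohomology, by \<open>image_cech_diff\<close> below.
\<close>

definition neg_part :: "'a cchain \<Rightarrow> (nat \<Rightarrow>\<^sub>0 int) \<Rightarrow> 'a wchain" where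
  "neg_part c = (\<lambda>\<alpha>. if neg s \<alpha> then cof (c {..s}) \<alpha> else 0)"

lemma neg_part_diff: "neg_part (c - d) = neg_part c - neg_part d"
proof
  fix \<alpha>
  show "neg_part (c - d) \<alpha> = (neg_part c - neg_part d) \<alpha>"
    by (cases "neg s \<alpha>") (simp_all only: neg_part_def inv_apply cchain_apply cof_diff if_True if_False diff_self)
qed

lemma neg_part_zero [simp]: "neg_part 0 = 0"
  using neg_part_diff[of 0 0] by (simp only: diff_self)

lemma neg_part_cscale: "neg_part (cscale r c) = (\<lambda>\<alpha>. wscale r (neg_part c \<alpha>))"
proof
  fix \<alpha>
  show "neg_part (cscale r c) \<alpha> = wscale r (neg_part c \<alpha>)"
    by (cases "neg s \<alpha>") (simp_all only: neg_part_def cof_cscale wscale_zero if_True if_False)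
qed

lemma top_index: "J \<subseteq> {..s} \<and> card J = Suc s \<longleftrightarrow> J = {..s}"
  using card_subset_eq[of "{..s}" J] by auto

lemma coboundary_neg_part:
  assumes w: "w \<in> cech_chains s i"
  shows "neg_part (cech_diff s w) = 0"
proof
  fix \<alpha>
  show "neg_part (cech_diff s w) \<alpha> = 0 \<alpha>"
  proof (cases "neg s \<alpha>")
    case True
    have "altsign (below {..s} j) (cof (w ({..s} - {j})) \<alpha>) = 0" if j: "j \<in> {..s}" for j
    proof (rule ccontr)
      assume "\<not> ?thesis"
      then have nz: "cof (w ({..s} - {j})) \<alpha> \<noteq> 0"
        by (metis altsign_zero)
      have "w ({..s} - {j}) \<in> loc_chains ({..s} - {j}) i"
        by (rule cech_chainsD[OF w]) (use j in auto)
      then have "mono_ok s ({..s} - {j}) \<alpha>"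
        using nz by (rule loc_chains_mono)
      then have "0 \<le> Poly_Mapping.lookup \<alpha> j"
        unfolding mono_ok_def by blast
      moreover have "Poly_Mapping.lookup \<alpha> j < 0"
        using True j unfolding neg_def by blast
      ultimately show False
        by simp
    qed
    then have "cof (cech_diff s w {..s}) \<alpha> = 0"
      unfolding cof_cech_diff[OF order_refl] by (rule sum.neutral[rule_format])
    then show ?thesis
      by (simp only: neg_part_def True if_True inv_apply)
  qed (simp only: neg_part_def if_False inv_apply)
qed

text \<open>
  For a fixed monomial \<open>T\<^sup>\<alpha>\<close> with some exponent \<open>\<alpha>\<^sub>m \<ge> 0\<close>, the top coefficient already lives in the
  localization at \<open>{..s} - {m}\<close>. Choosing for \<open>m\<close> the least such index for each \<open>\<alpha>\<close> exhibits the cochain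
  as a coboundary.
\<close>

lemma neg_part_zero_coboundary:
  assumes c: "c \<in> cech_chains (Suc s) i" and neg0: "neg_part c = 0"
  shows "c \<in> cech_diff s ` cech_chains s i"
proof -
  define m where "m = (\<lambda>\<alpha> :: nat \<Rightarrow>\<^sub>0 int. LEAST j. j \<le> s \<and> 0 \<le> Poly_Mapping.lookup \<alpha> j)"
  \<comment> \<open>indices \<open>j\<close> with \<open>\<alpha>\<^sub>j \<ge> 0\<close> exist exactly for \<open>P \<alpha>\<close>; the sign in \<open>g\<close> cancels that of the differential\<close>
  define P where "P = (\<lambda>\<alpha> :: nat \<Rightarrow>\<^sub>0 int. \<exists>j\<le>s. 0 \<le> Poly_Mapping.lookup \<alpha> j)"
  define g where "g = (\<lambda>J \<alpha>. if P \<alpha> \<and> m \<alpha> \<notin> J then altsign (m \<alpha>) (cof (c {..s}) \<alpha>) else 0)"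
  define w where "w = (\<lambda>J. if J \<subseteq> {..s} \<and> card J = s then of_cof (g J) else 0)"
  have m: "m \<alpha> \<le> s \<and> 0 \<le> Poly_Mapping.lookup \<alpha> (m \<alpha>)" if "P \<alpha>" for \<alpha>
    using that LeastI_ex[of "\<lambda>j. j \<le> s \<and> 0 \<le> Poly_Mapping.lookup \<alpha> j"] unfolding m_def P_def by blast
  have cs: "c {..s} \<in> loc_chains {..s} i"
    by (rule cech_chainsD[OF c]) auto
  have g0: "g J \<alpha> \<noteq> 0 \<Longrightarrow> cof (c {..s}) \<alpha> \<noteq> 0 \<and> P \<alpha> \<and> m \<alpha> \<notin> J" for J \<alpha>
    unfolding g_def by (metis altsign_zero)
  have "finite {\<alpha>. g J \<alpha> \<noteq> 0}" for J
    by (rule finite_subset[OF _ finite_cof_support[of "c {..s}" s f i]])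
      (use g0 loc_chains_coef[OF cs] in blast)+
  then have cof_g: "cof (of_cof (g J)) \<alpha> = g J \<alpha>" for J \<alpha>
    by (rule cof_of_cof)
  have "w \<in> cech_chains s i"
  proof (rule cech_chainsI)
    fix J assume J: "J \<subseteq> {..s}" "card J = s"
    have "w J = of_cof (g J)"
      by (simp only: w_def J simp_thms if_True)
    moreover have "of_cof (g J) \<in> loc_chains J i"
    proof (rule loc_chainsI)
      fix \<alpha>
      show "cof (of_cof (g J)) \<alpha> \<in> coef_module s f i"
        unfolding cof_g
        by (cases "P \<alpha> \<and> m \<alpha> \<notin> J")
          (simp_all only: g_def if_True if_False coef_module_zero coef_module_altsign[OF loc_chains_coef[OF cs]] simp_thms)
      assume "cof (of_cof (g J)) \<alpha> \<noteq> 0"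
      then have nz: "cof (c {..s}) \<alpha> \<noteq> 0" and P: "P \<alpha>" "m \<alpha> \<notin> J"
        unfolding cof_g using g0 by blast+
      have "insert (m \<alpha>) J = {..s}"
        using card_subset_eq[of "{..s}" "insert (m \<alpha>) J"] J P m[OF P(1)] finite_subset[OF J(1)] by simp
      moreover have "mono_ok s {..s} \<alpha>"
        by (rule loc_chains_mono[OF cs nz])
      ultimately have ok: "\<forall>j>s. Poly_Mapping.lookup \<alpha> j = 0"
        "\<forall>j. j \<notin> insert (m \<alpha>) J \<longrightarrow> 0 \<le> Poly_Mapping.lookup \<alpha> j"
        unfolding mono_ok_def by simp_all
      have "0 \<le> Poly_Mapping.lookup \<alpha> j" if "j \<notin> J" for j
        using ok(2) m[OF P(1)] that by (cases "j = m \<alpha>") simp_all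
      with ok(1) show "mono_ok s J \<alpha>"
        unfolding mono_ok_def by blast
    qed
    ultimately show "w J \<in> loc_chains J i"
      by (simp only:)
  next
    fix J assume "\<not> (J \<subseteq> {..s} \<and> card J = s)"
    then show "w J = 0"
      by (simp only: w_def if_False)
  qed
  moreover have "c = cech_diff s w"
  proof
    fix J
    show "c J = cech_diff s w J"
    proof (cases "J = {..s}")
      case True
      show ?thesis
        unfolding True
      proof (rule cof_eqI)
        fix \<alpha>
        have wj: "cof (w ({..s} - {j})) \<alpha> = g ({..s} - {j}) \<alpha>" if "j \<in> {..s}" for j
        proof -
          have "{..s} - {j} \<subseteq> {..s}" "card ({..s} - {j}) = s"
            using that by auto
          then have "w ({..s} - {j}) = of_cof (g ({..s} - {j}))"
            by (simp only: w_def simp_thms if_True)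
          then show ?thesis
            by (simp only: cof_g)
        qed
        have "cof (cech_diff s w {..s}) \<alpha> = (\<Sum>j\<le>s. altsign (below {..s} j) (g ({..s} - {j}) \<alpha>))"
          unfolding cof_cech_diff[OF order_refl] by (rule sum.cong[OF refl]) (simp only: wj)
        also have "\<dots> = cof (c {..s}) \<alpha>"
        proof (cases "P \<alpha>")
          case True
          have "altsign (below {..s} j) (g ({..s} - {j}) \<alpha>) = (if j = m \<alpha> then cof (c {..s}) \<alpha> else 0)"
            if "j \<in> {..s}" for j
          proof (cases "j = m \<alpha>")
            case True
            have "{k \<in> {..s}. k < j} = {..<j}"
              using that by auto
            then have "below {..s} j = j"
              by (simp only: below_def card_lessThan)
            then show ?thesis
              using \<open>P \<alpha>\<close> True by (simp add: g_def)
          next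
            case False
            then show ?thesis
              using m[OF \<open>P \<alpha>\<close>] by (simp add: g_def)
          qed
          then have "(\<Sum>j\<le>s. altsign (below {..s} j) (g ({..s} - {j}) \<alpha>))
              = (\<Sum>j\<le>s. if j = m \<alpha> then cof (c {..s}) \<alpha> else 0)"
            by (rule sum.cong[OF refl])
          also have "\<dots> = cof (c {..s}) \<alpha>"
            using m[OF True] by (subst sum.delta) auto
          finally show ?thesis .
        next
          case False
          then have "cof (c {..s}) \<alpha> = 0"
          proof (cases "neg s \<alpha>")
            case True
            then have "cof (c {..s}) \<alpha> = neg_part c \<alpha>"
              by (simp only: neg_part_def if_True)
            then show ?thesis
              by (simp only: neg0 inv_apply)
          next
            case neg: False
            show ?thesis
            proof (rule ccontr)
              assume "cof (c {..s}) \<alpha> \<noteq> 0"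
              then have "mono_ok s {..s} \<alpha>"
                by (rule loc_chains_mono[OF cs])
              then have "neg s \<alpha>"
                using False unfolding P_def neg_def mono_ok_def by (auto simp: not_le dest: leD)
              with neg show False ..
            qed
          qed
          moreover have "(\<Sum>j\<le>s. altsign (below {..s} j) (g ({..s} - {j}) \<alpha>)) = 0"
            by (rule sum.neutral) (intro ballI, simp only: g_def False simp_thms if_False altsign_zero)
          ultimately show ?thesis
            by (simp only:)
        qed
        finally show "cof (c {..s}) \<alpha> = cof (cech_diff s w {..s}) \<alpha>" ..
      qed
    next
      case False
      then have "c J = 0"
        using cech_chains_eq_0[OF c, of J] top_index by blast
      moreover have "cech_diff s w J = 0"
      proof (cases "J \<subseteq> {..s}")
        case True
        have "w (J - {j}) = 0" if "j \<in> J" for j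
        proof -
          have "finite J" "card J \<noteq> Suc s"
            using True False top_index finite_subset by blast+
          then have "card (J - {j}) \<noteq> s"
            using that card_Suc_Diff1[of J j] by metis
          then show ?thesis
            by (simp only: w_def simp_thms if_False)
        qed
        then have "altsign (card {k \<in> J. k < j}) (w (J - {j})) = 0" if "j \<in> J" for j
          using that by (simp only: altsign_zero)
        then have "(\<Sum>j\<in>J. altsign (card {k \<in> J. k < j}) (w (J - {j}))) = 0"
          by (rule sum.neutral[rule_format])
        then show ?thesis
          by (simp only: cech_diff_def True if_True)
      qed (simp only: cech_diff_def if_False)
      ultimately show ?thesis
        by (simp only:)
    qed
  qed
  ultimately show ?thesis
    by blast
qed

section \<open>The top local cohomology of \<open>D\<close> in degree zero\<close>

text \<open>
  Representatives of the degree \<open>0\<close> part of \<open>H\<^sup>r(D\<^sub>n)\<close> as cochains, and the same elements as families of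
  coefficients of inverse monomials: since \<open>e\<^sub>M \<otimes> e\<^sub>L\<close> has degree \<open>n\<close>, these monomials have degree \<open>-n\<close>.
\<close>

definition top_chains :: "nat \<Rightarrow> 'a cchain set" where
  "top_chains n = cech_chains (Suc s) n \<inter> T_homogeneous_C 0"

definition inv_chains :: "nat \<Rightarrow> ((nat \<Rightarrow>\<^sub>0 int) \<Rightarrow> 'a wchain) set" where
  "inv_chains n = {x. \<forall>\<alpha>. x \<alpha> \<in> coef_module s f n \<and> (x \<alpha> \<noteq> 0 \<longrightarrow> neg s \<alpha> \<and> deg \<alpha> = - int n)}"

lemma inv_chainsI:
  assumes "\<And>\<alpha>. x \<alpha> \<in> coef_module s f n" "\<And>\<alpha>. x \<alpha> \<noteq> 0 \<Longrightarrow> neg s \<alpha> \<and> deg \<alpha> = - int n"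
  shows "x \<in> inv_chains n"
  using assms unfolding inv_chains_def by blast

lemma inv_chains_coef: "x \<in> inv_chains n \<Longrightarrow> x \<alpha> \<in> coef_module s f n"
  unfolding inv_chains_def by blast

lemma inv_chains_supp: "x \<in> inv_chains n \<Longrightarrow> x \<alpha> \<noteq> 0 \<Longrightarrow> neg s \<alpha> \<and> deg \<alpha> = - int n"
  unfolding inv_chains_def by blast

lemma inv_chains_eq_0: "x \<in> inv_chains n \<Longrightarrow> \<not> neg s \<alpha> \<Longrightarrow> x \<alpha> = 0"
  unfolding inv_chains_def by blast

lemma top_chains_loc: "c \<in> top_chains n \<Longrightarrow> c {..s} \<in> loc_chains {..s} n"
  unfolding top_chains_def using cech_chainsD[of c "Suc s" n "{..s}"] by simp

lemma top_chains_iff: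
  "c \<in> top_chains n \<longleftrightarrow> c {..s} \<in> loc_chains {..s} n \<and> (\<forall>J. J \<noteq> {..s} \<longrightarrow> c J = 0) \<and>
     (\<forall>\<alpha>. cof (c {..s}) \<alpha> \<noteq> 0 \<longrightarrow> deg \<alpha> = - int n)"
proof -
  have "0 \<in> T_homogeneous (0 :: int)"
    by (simp add: T_homogeneous_def)
  have 1: "c \<in> cech_chains (Suc s) n \<longleftrightarrow> c {..s} \<in> loc_chains {..s} n \<and> (\<forall>J. J \<noteq> {..s} \<longrightarrow> c J = 0)"
    unfolding cech_chains_def top_index mem_Collect_eq by (simp add: if_bool_eq_conj all_conj_distrib)
  have 2: "c \<in> T_homogeneous_C 0 \<longleftrightarrow> c {..s} \<in> T_homogeneous 0" if "\<forall>J. J \<noteq> {..s} \<longrightarrow> c J = 0"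
  proof -
    have "c J \<in> T_homogeneous 0" if "c {..s} \<in> T_homogeneous 0" for J
    proof (cases "J = {..s}")
      case False
      then have "c J = 0"
        using \<open>\<forall>J. J \<noteq> {..s} \<longrightarrow> c J = 0\<close> by blast
      then show ?thesis
        using \<open>0 \<in> T_homogeneous 0\<close> by (simp only:)
    qed (use that in simp)
    then show ?thesis
      unfolding T_homogeneous_C_def by blast
  qed
  show ?thesis
    unfolding top_chains_def Int_iff 1 using 2 T_homogeneous_iff[of "c {..s}" "{..s}" n] by blast
qed

lemma neg_part_inv_chains:
  assumes c: "c \<in> top_chains n"
  shows "neg_part c \<in> inv_chains n"
proof (rule inv_chainsI)
  fix \<alpha>
  show "neg_part c \<alpha> \<in> coef_module s f n"
    by (cases "neg s \<alpha>")
      (simp_all only: neg_part_def if_True if_False coef_module_zero loc_chains_coef[OF top_chains_loc[OF c]])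
  assume "neg_part c \<alpha> \<noteq> 0"
  then have "neg s \<alpha> \<and> cof (c {..s}) \<alpha> \<noteq> 0"
    unfolding neg_part_def by presburger
  then show "neg s \<alpha> \<and> deg \<alpha> = - int n"
    using c unfolding top_chains_iff by blast
qed

text \<open>
  Negative exponents with a given sum are bounded, so only finitely many monomials occur.
\<close>

lemma finite_inv_support:
  assumes x: "x \<in> inv_chains n"
  shows "finite {\<alpha>. x \<alpha> \<noteq> 0}"
proof -
  let ?F = "{g. \<forall>j. (j \<in> {..s} \<longrightarrow> g j \<in> {- int n..0}) \<and> (j \<notin> {..s} \<longrightarrow> g j = (0::int))}"
  have "finite ?F"
    by (rule finite_set_of_finite_funs) auto
  moreover have "Poly_Mapping.lookup ` {\<alpha>. x \<alpha> \<noteq> 0} \<subseteq> ?F"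
  proof
    fix g assume "g \<in> Poly_Mapping.lookup ` {\<alpha>. x \<alpha> \<noteq> 0}"
    then obtain \<alpha> where \<alpha>: "g = Poly_Mapping.lookup \<alpha>" "x \<alpha> \<noteq> 0"
      by blast
    then have neg: "neg s \<alpha>" and deg: "deg \<alpha> = - int n"
      using inv_chains_supp[OF x] by blast+
    have "- int n \<le> g j" "g j \<le> 0" if j: "j \<le> s" for j
    proof -
      have "deg \<alpha> = (\<Sum>k\<le>s. g k)"
        using neg deg_atMost[of s \<alpha>] unfolding neg_def \<alpha>(1) by blast
      also have "\<dots> = g j + (\<Sum>k\<in>{..s} - {j}. g k)"
        by (rule sum.remove) (use j in auto)
      also have "(\<Sum>k\<in>{..s} - {j}. g k) \<le> 0"
        by (rule sum_nonpos) (use neg in \<open>auto simp: neg_def \<alpha>(1) intro: less_imp_le\<close>)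
      finally show "- int n \<le> g j"
        using deg by simp
      show "g j \<le> 0"
        using neg j unfolding neg_def \<alpha>(1) by (simp add: less_imp_le)
    qed
    then show "g \<in> ?F"
      using neg unfolding neg_def \<alpha>(1) by auto
  qed
  ultimately have "finite (Poly_Mapping.lookup ` {\<alpha>. x \<alpha> \<noteq> 0})"
    using finite_subset by blast
  then show ?thesis
    by (rule finite_imageD) (auto intro: inj_onI poly_mapping_eqI)
qed

definition realize :: "((nat \<Rightarrow>\<^sub>0 int) \<Rightarrow> 'a wchain) \<Rightarrow> 'a cchain" where
  "realize x = (\<lambda>J. if J = {..s} then of_cof x else 0)"

lemma
  assumes x: "x \<in> inv_chains n"
  shows cof_realize: "cof (realize x {..s}) \<alpha> = x \<alpha>"
    and realize_top_chains: "realize x \<in> top_chains n"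
    and neg_part_realize: "neg_part (realize x) = x"
proof -
  show cof: "cof (realize x {..s}) \<alpha> = x \<alpha>" for \<alpha>
    unfolding realize_def by (simp only: simp_thms if_True cof_of_cof[OF finite_inv_support[OF x]])
  show "neg_part (realize x) = x"
  proof
    fix \<alpha>
    show "neg_part (realize x) \<alpha> = x \<alpha>"
      unfolding neg_part_def cof using inv_chains_eq_0[OF x, of \<alpha>] by presburger
  qed
  have "realize x {..s} \<in> loc_chains {..s} n"
  proof (rule loc_chainsI)
    fix \<alpha>
    show "cof (realize x {..s}) \<alpha> \<in> coef_module s f n"
      unfolding cof by (rule inv_chains_coef[OF x])
    assume "cof (realize x {..s}) \<alpha> \<noteq> 0"
    then have "neg s \<alpha>"
      unfolding cof using inv_chains_supp[OF x] by blast
    then show "mono_ok s {..s} \<alpha>"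
      unfolding neg_def mono_ok_def by (metis atMost_iff leI order_refl)
  qed
  then show "realize x \<in> top_chains n"
    unfolding top_chains_iff cof using inv_chains_supp[OF x] by (simp add: realize_def)
qed

text \<open>
  The differential that \<open>D\<close> induces on the top local cohomology: monomials that lose their last negative
  exponent in some variable are dropped.
\<close>

definition Dinv :: "((nat \<Rightarrow>\<^sub>0 int) \<Rightarrow> 'a wchain) \<Rightarrow> (nat \<Rightarrow>\<^sub>0 int) \<Rightarrow> 'a wchain" where
  "Dinv x = (\<lambda>\<alpha>. if neg s \<alpha> then \<Sum>l\<le>s. kap l (x (\<alpha> - Poly_Mapping.single l 1)) else 0)"

lemma neg_diff_single: "neg s \<alpha> \<Longrightarrow> l \<le> s \<Longrightarrow> neg s (\<alpha> - Poly_Mapping.single l 1)"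
  unfolding neg_def lookup_minus lookup_single when_def by auto

lemma D_diff_top_chains:
  assumes c: "c \<in> top_chains (Suc n)"
  shows "(\<lambda>J. D_diff s (c J)) \<in> top_chains n"
proof -
  have "D_diff s (0 :: 'a dchain) = 0"
    by (rule D_diff_zero)
  moreover have "deg \<alpha> = - int n" if nz: "cof (D_diff s (c {..s})) \<alpha> \<noteq> 0" for \<alpha>
  proof -
    have "\<exists>l\<le>s. cof (c {..s}) (\<alpha> - Poly_Mapping.single l 1) \<noteq> 0"
    proof (rule ccontr)
      assume "\<not> ?thesis"
      then have "kap l (cof (c {..s}) (\<alpha> - Poly_Mapping.single l 1)) = 0" if "l \<in> {..s}" for l
        using that kap_zero by (metis atMost_iff)
      then have "cof (D_diff s (c {..s})) \<alpha> = 0"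
        unfolding cof_D_diff[OF loc_chains_coef[OF top_chains_loc[OF c]]] by (rule sum.neutral[rule_format])
      with nz show False
        by blast
    qed
    then obtain l where "deg (\<alpha> - Poly_Mapping.single l 1) = - int (Suc n)"
      using c unfolding top_chains_iff by blast
    then show ?thesis
      by (simp add: deg_diff_single)
  qed
  ultimately show ?thesis
    using c D_diff_loc_chains[OF top_chains_loc[OF c]] unfolding top_chains_iff by metis
qed

lemma neg_part_D_diff:
  assumes c: "c {..s} \<in> loc_chains {..s} n"
  shows "neg_part (\<lambda>J. D_diff s (c J)) = Dinv (neg_part c)"
proof
  fix \<alpha>
  show "neg_part (\<lambda>J. D_diff s (c J)) \<alpha> = Dinv (neg_part c) \<alpha>"
  proof (cases "neg s \<alpha>")
    case True
    have "cof (D_diff s (c {..s})) \<alpha> = (\<Sum>l\<le>s. kap l (neg_part c (\<alpha> - Poly_Mapping.single l 1)))"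
      unfolding cof_D_diff[OF loc_chains_coef[OF c]]
      by (rule sum.cong[OF refl]) (simp only: neg_part_def neg_diff_single[OF True] if_True atMost_iff)
    then show ?thesis
      by (simp only: neg_part_def[of "\<lambda>J. D_diff s (c J)"] Dinv_def True if_True)
  qed (simp only: neg_part_def[of "\<lambda>J. D_diff s (c J)"] Dinv_def if_False)
qed

lemma Dinv_diff: "Dinv (x - y) = Dinv x - Dinv y"
proof
  fix \<alpha>
  show "Dinv (x - y) \<alpha> = (Dinv x - Dinv y) \<alpha>"
    by (cases "neg s \<alpha>") (simp_all only: Dinv_def inv_apply kap_diff sum_subtractf if_True if_False diff_self)
qed

lemma Dinv_zero [simp]: "Dinv 0 = 0"
  using Dinv_diff[of 0 0] by (simp only: diff_self)

lemma Dinv_add: "Dinv (x + y) = Dinv x + Dinv y"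
proof
  fix \<alpha>
  show "Dinv (x + y) \<alpha> = (Dinv x + Dinv y) \<alpha>"
    by (cases "neg s \<alpha>") (simp_all only: Dinv_def inv_apply kap_add sum.distrib if_True if_False add_0_right)
qed

lemma Dinv_inv_chains:
  assumes x: "x \<in> inv_chains (Suc n)"
  shows "Dinv x \<in> inv_chains n"
  using neg_part_inv_chains[OF D_diff_top_chains[OF realize_top_chains[OF x]]]
  unfolding neg_part_D_diff[where c = "realize x", OF top_chains_loc[OF realize_top_chains[OF x]]] neg_part_realize[OF x] .

lemma Dinv_Dinv: "Dinv (Dinv x) = 0"
proof
  fix \<alpha>
  show "Dinv (Dinv x) \<alpha> = 0 \<alpha>"
  proof (cases "neg s \<alpha>")
    case True
    define g where "g = (\<lambda>l k. kap l (kap k (x (\<alpha> - (Poly_Mapping.single l 1 + Poly_Mapping.single k 1)))))"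
    have "Dinv (Dinv x) \<alpha> = (\<Sum>l\<le>s. kap l (\<Sum>k\<le>s. kap k (x (\<alpha> - Poly_Mapping.single l 1 - Poly_Mapping.single k 1))))"
      unfolding Dinv_def[of "Dinv x"] using True
      by (simp only: if_True) (rule sum.cong[OF refl], simp only: Dinv_def neg_diff_single[OF True] if_True atMost_iff)
    also have "\<dots> = (\<Sum>l\<le>s. \<Sum>k\<le>s. g l k)"
      by (simp only: kap_sum g_def diff_diff_eq)
    also have "\<dots> = 0"
    proof (rule sum_antisymmetric)
      fix k l
      show "g k l = - g l k"
        unfolding g_def by (subst add.commute) (rule kap_anticommute)
      show "g l l = 0"
        unfolding g_def by (rule kap_self)
    qed
    finally show ?thesis
      by (simp only: inv_apply)
  qed (simp only: Dinv_def if_False inv_apply)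
qed

lemma inv_chains_diff:
  assumes "x \<in> inv_chains n" "y \<in> inv_chains n"
  shows "x - y \<in> inv_chains n"
proof (rule inv_chainsI)
  fix \<alpha>
  show "(x - y) \<alpha> \<in> coef_module s f n"
    unfolding inv_apply by (intro coef_module_diff inv_chains_coef[OF assms(1)] inv_chains_coef[OF assms(2)])
  assume "(x - y) \<alpha> \<noteq> 0"
  then have "x \<alpha> \<noteq> 0 \<or> y \<alpha> \<noteq> 0"
    unfolding inv_apply by (metis diff_self)
  then show "neg s \<alpha> \<and> deg \<alpha> = - int n"
    using inv_chains_supp assms by blast
qed

lemma inv_chains_zero: "0 \<in> inv_chains n"
  by (rule inv_chainsI) (simp_all only: inv_apply coef_module_zero simp_thms)

lemma inv_chains_add:
  assumes "x \<in> inv_chains n" "y \<in> inv_chains n"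
  shows "x + y \<in> inv_chains n"
  using inv_chains_diff[OF assms(1) inv_chains_diff[OF inv_chains_zero assms(2)]] by (simp only: diff_0 diff_minus_eq_add)

section \<open>The contracting homotopy\<close>

lemma kap_ins_coef_module:
  assumes w: "w \<in> coef_module s f n"
  shows "kap l (ins m w) + ins m (kap l w) = (if l = m then w else 0)"
proof
  fix M
  show "(kap l (ins m w) + ins m (kap l w)) M = (if l = m then w else 0) M"
  proof (cases "finite M")
    case True
    then show ?thesis
      using kap_ins[OF True, of l m w] by (simp add: if_distrib[of "\<lambda>w. w M"])
  next
    case False
    then have "w M = 0"
      using coef_module_subset[OF w, of M] finite_subset by blast
    then show ?thesis
      using False by (simp add: kap_def ins_def)
  qed
qed

text \<open>
  \<open>hom_op m\<close> is \<open>T\<^sub>m\<^sup>-\<^sup>1 e'\<^sub>m\<close>, and \<open>proj_op m\<close> is \<open>e'\<^sub>m \<kappa>\<^sub>m\<close> on the monomials with \<open>\<alpha>\<^sub>m = -1\<close> and zero elsewhere.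
\<close>

definition hom_op :: "nat \<Rightarrow> ((nat \<Rightarrow>\<^sub>0 int) \<Rightarrow> 'a wchain) \<Rightarrow> (nat \<Rightarrow>\<^sub>0 int) \<Rightarrow> 'a wchain" where
  "hom_op m x = (\<lambda>\<alpha>. ins m (x (\<alpha> + Poly_Mapping.single m 1)))"

definition proj_op :: "nat \<Rightarrow> ((nat \<Rightarrow>\<^sub>0 int) \<Rightarrow> 'a wchain) \<Rightarrow> (nat \<Rightarrow>\<^sub>0 int) \<Rightarrow> 'a wchain" where
  "proj_op m x = (\<lambda>\<alpha>. if Poly_Mapping.lookup \<alpha> m = -1 then ins m (kap m (x \<alpha>)) else 0)"

lemma neg_add_single:
  assumes "m \<le> s"
  shows "neg s (\<alpha> + Poly_Mapping.single m 1) \<longleftrightarrow> neg s \<alpha> \<and> Poly_Mapping.lookup \<alpha> m \<noteq> -1"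
proof -
  have l: "Poly_Mapping.lookup (\<alpha> + Poly_Mapping.single m 1) j
      = (if j = m then Poly_Mapping.lookup \<alpha> m + 1 else Poly_Mapping.lookup \<alpha> j)" for j
    by (simp add: lookup_add lookup_single when_def)
  show ?thesis
  proof
    assume n: "neg s (\<alpha> + Poly_Mapping.single m 1)"
    have "Poly_Mapping.lookup \<alpha> m + 1 < 0"
      using n assms unfolding neg_def l by metis
    moreover have "Poly_Mapping.lookup \<alpha> j = 0" if "j > s" for j
      using n assms that unfolding neg_def l by (metis leD)
    moreover have "Poly_Mapping.lookup \<alpha> j < 0" if "j \<le> s" for j
    proof (cases "j = m")
      case False
      then show ?thesis
        using n that unfolding neg_def l by metis
    qed (use \<open>Poly_Mapping.lookup \<alpha> m + 1 < 0\<close> in simp)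
    ultimately show "neg s \<alpha> \<and> Poly_Mapping.lookup \<alpha> m \<noteq> -1"
      unfolding neg_def by force
  next
    assume n: "neg s \<alpha> \<and> Poly_Mapping.lookup \<alpha> m \<noteq> -1"
    then have "Poly_Mapping.lookup \<alpha> m < 0"
      using assms unfolding neg_def by blast
    then have "Poly_Mapping.lookup \<alpha> m + 1 < 0"
      using n by linarith
    then show "neg s (\<alpha> + Poly_Mapping.single m 1)"
      using n assms unfolding neg_def l by auto
  qed
qed

lemma hom_op_inv_chains:
  assumes x: "x \<in> inv_chains n" and m: "m \<in> {1..s}"
  shows "hom_op m x \<in> inv_chains (Suc n)"
proof (rule inv_chainsI)
  fix \<alpha>
  show "hom_op m x \<alpha> \<in> coef_module s f (Suc n)"
    unfolding hom_op_def by (rule coef_module_ins[OF inv_chains_coef[OF x] m])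
  assume "hom_op m x \<alpha> \<noteq> 0"
  then have "x (\<alpha> + Poly_Mapping.single m 1) \<noteq> 0"
    unfolding hom_op_def using ins_zero by metis
  then have "neg s (\<alpha> + Poly_Mapping.single m 1)" "deg (\<alpha> + Poly_Mapping.single m 1) = - int n"
    using inv_chains_supp[OF x] by blast+
  then show "neg s \<alpha> \<and> deg \<alpha> = - int (Suc n)"
    using neg_add_single[of m \<alpha>] m by (simp add: deg_add_single)
qed

text \<open>
  Multiplication by \<open>T\<^sub>l\<close> commutes with \<open>T\<^sub>m\<^sup>-\<^sup>1\<close> except that, for \<open>l = m\<close>, multiplying by \<open>T\<^sub>m\<close> first kills the
  monomials with \<open>\<alpha>\<^sub>m = -1\<close>. By the relation \<open>\<kappa>\<^sub>l e'\<^sub>m + e'\<^sub>m \<kappa>\<^sub>l = \<delta>\<^sub>l\<^sub>m\<close> the sum \<open>D h + h D\<close> is therefore the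
  identity up to a correction on those monomials, which is the projection.
\<close>

lemma homotopy:
  assumes x: "x \<in> inv_chains n" and m: "m \<in> {1..s}"
  shows "x = Dinv (hom_op m x) + hom_op m (Dinv x) + proj_op m x"
proof
  fix \<alpha> :: "nat \<Rightarrow>\<^sub>0 int"
  have ms: "m \<le> s"
    using m by simp
  have comm: "\<alpha> - Poly_Mapping.single l 1 + Poly_Mapping.single m 1
      = \<alpha> + Poly_Mapping.single m 1 - Poly_Mapping.single l 1" for l
    by (rule diff_add_eq)
  show "x \<alpha> = (Dinv (hom_op m x) + hom_op m (Dinv x) + proj_op m x) \<alpha>"
  proof (cases "neg s \<alpha>")
    case False
    then have "\<not> neg s (\<alpha> + Poly_Mapping.single m 1)"
      using neg_add_single[OF ms] by blast
    then have "Dinv (hom_op m x) \<alpha> = 0" "hom_op m (Dinv x) \<alpha> = 0"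
      unfolding hom_op_def[of m "Dinv x"] using False by (simp_all only: Dinv_def if_False ins_zero)
    moreover have "x \<alpha> = 0"
      by (rule inv_chains_eq_0[OF x False])
    moreover have "proj_op m x \<alpha> = 0"
      unfolding proj_op_def \<open>x \<alpha> = 0\<close> by (simp only: kap_zero ins_zero if_cancel)
    ultimately show ?thesis
      by (simp only: inv_apply add_0_right)
  next
    case True
    have D1: "Dinv (hom_op m x) \<alpha>
        = (\<Sum>l\<le>s. kap l (ins m (x (\<alpha> + Poly_Mapping.single m 1 - Poly_Mapping.single l 1))))"
      by (simp only: Dinv_def True if_True hom_op_def comm)
    show ?thesis
    proof (cases "Poly_Mapping.lookup \<alpha> m = -1")
      case m1: True
      have "\<not> neg s (\<alpha> + Poly_Mapping.single m 1)"
        using neg_add_single[OF ms] m1 by blast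
      then have D2: "hom_op m (Dinv x) \<alpha> = 0"
        by (simp only: hom_op_def Dinv_def if_False ins_zero)
      have "x (\<alpha> + Poly_Mapping.single m 1 - Poly_Mapping.single l 1) = (if l = m then x \<alpha> else 0)" for l
      proof (cases "l = m")
        case False
        have "Poly_Mapping.lookup (\<alpha> + Poly_Mapping.single m 1 - Poly_Mapping.single l 1) m = 0"
          using False m1 by (simp add: lookup_add lookup_minus lookup_single when_def)
        then have "\<not> neg s (\<alpha> + Poly_Mapping.single m 1 - Poly_Mapping.single l 1)"
          using ms unfolding neg_def by (metis less_irrefl)
        then have "x (\<alpha> + Poly_Mapping.single m 1 - Poly_Mapping.single l 1) = 0"
          by (rule inv_chains_eq_0[OF x])
        then show ?thesis
          using False by (simp only: if_False)
      qed simp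
      then have "Dinv (hom_op m x) \<alpha> = (\<Sum>l\<le>s. if l = m then kap m (ins m (x \<alpha>)) else 0)"
        unfolding D1 by (intro sum.cong[OF refl]) (simp only: if_distrib[of "\<lambda>w. kap _ (ins m w)"] ins_zero kap_zero cong: if_cong)
      also have "\<dots> = kap m (ins m (x \<alpha>))"
        by (subst sum.delta) (use ms in auto)
      finally have D1': "Dinv (hom_op m x) \<alpha> = kap m (ins m (x \<alpha>))" .
      have "kap m (ins m (x \<alpha>)) + ins m (kap m (x \<alpha>)) = x \<alpha>"
        using kap_ins_coef_module[OF inv_chains_coef[OF x], of m m \<alpha>] by (simp only: if_True simp_thms)
      then show ?thesis
        by (simp only: inv_apply D1' D2 proj_op_def m1 simp_thms if_True add_0_right)
    next
      case m1: False
      have "neg s (\<alpha> + Poly_Mapping.single m 1)"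
        using neg_add_single[OF ms] m1 True by blast
      then have D2: "hom_op m (Dinv x) \<alpha>
          = (\<Sum>l\<le>s. ins m (kap l (x (\<alpha> + Poly_Mapping.single m 1 - Poly_Mapping.single l 1))))"
        by (simp only: hom_op_def Dinv_def if_True ins_sum)
      have "Dinv (hom_op m x) \<alpha> + hom_op m (Dinv x) \<alpha>
          = (\<Sum>l\<le>s. if l = m then x (\<alpha> + Poly_Mapping.single m 1 - Poly_Mapping.single l 1) else 0)"
        unfolding D1 D2 sum.distrib[symmetric]
        by (simp only: kap_ins_coef_module[OF inv_chains_coef[OF x]])
      also have "\<dots> = (\<Sum>l\<le>s. if l = m then x \<alpha> else 0)"
        by (intro sum.cong refl if_cong) (simp only: add_diff_cancel_right')
      also have "\<dots> = x \<alpha>"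
        by (subst sum.delta) (use ms in auto)
      finally show ?thesis
        by (simp only: inv_apply proj_op_def m1 if_False add_0_right)
    qed
  qed
qed


section \<open>The retraction onto Koszul cycles\<close>

text \<open>
  The exponent \<open>(-i, -1, \<dots>, -1)\<close>, which is the only one that survives the projections \<open>proj_op m\<close> for
  \<open>1 \<le> m \<le> s\<close> in degree \<open>-(i + s)\<close>.
\<close>

definition top_mon :: "nat \<Rightarrow> nat \<Rightarrow>\<^sub>0 int" where
  "top_mon i = mon (-1) {1..s} + Poly_Mapping.single 0 (- int i)"

lemma lookup_top_mon:
  "Poly_Mapping.lookup (top_mon i) j = (if j = 0 then - int i else if j \<le> s then -1 else 0)"
  by (simp add: top_mon_def lookup_add lookup_mon lookup_single when_def)

lemma neg_top_mon: "0 < i \<Longrightarrow> neg s (top_mon i)"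
  by (simp add: neg_def lookup_top_mon)

lemma deg_top_mon: "deg (top_mon i) = - int (i + s)"
proof -
  have "deg (mon (-1) {1..s}) = (\<Sum>j\<in>{1..s}. -1)"
  proof -
    have "deg (mon (-1) {1..s}) = (\<Sum>j\<in>{1..s}. Poly_Mapping.lookup (mon (-1) {1..s}) j)"
      by (rule deg_eq_sum) (auto simp: in_keys_iff lookup_mon split: if_splits)
    also have "\<dots> = (\<Sum>j\<in>{1..s}. -1)"
      by (rule sum.cong) (simp_all add: lookup_mon)
    finally show ?thesis .
  qed
  then show ?thesis
    unfolding top_mon_def deg_add_single by simp
qed

lemma top_mon_minus: "top_mon i - Poly_Mapping.single 0 1 = top_mon (Suc i)"
  by (rule poly_mapping_eqI) (simp add: lookup_top_mon lookup_minus lookup_one when_def)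

text \<open>
  The coefficient of \<open>T\<^bsup>(-i, -1, \<dots>, -1)\<^esup>\<close>, contracted by \<open>\<kappa>\<^sub>1 \<dots> \<kappa>\<^sub>s\<close> and restricted to \<open>\<And>\<^sup>0\<close> in the \<open>e'\<close>, is an
  element of \<open>Z\<^sub>i(f)\<close>. This is the map to the complex of the \<open>Z\<^sub>i(f)\<close> with differential \<open>del 0\<close>.
\<close>

definition psi :: "nat \<Rightarrow> ((nat \<Rightarrow>\<^sub>0 int) \<Rightarrow> 'a wchain) \<Rightarrow> nat set \<Rightarrow> 'a" where
  "psi i x = kaps [1..<Suc s] (x (top_mon i)) {}"

lemma fun2_apply:
  fixes v w :: "'a wchain"
  shows "(v - w) M = v M - w M" "(v + w) M = v M + w M" "(0 :: 'a wchain) M = 0"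
  by simp_all

lemma psi_diff: "psi i (x - y) = psi i x - psi i y"
  by (simp only: psi_def inv_apply kaps_diff fun2_apply)

lemma psi_zero [simp]: "psi i 0 = 0"
  by (simp only: psi_def inv_apply kaps_zero fun2_apply)

lemma psi_scale: "psi i (\<lambda>\<alpha>. wscale r (x \<alpha>)) = (\<lambda>L. r * psi i x L)"
  by (simp only: psi_def kaps_scale) (simp only: wscale_def)

lemma psi_cycle:
  assumes x: "x \<in> inv_chains (i + s)"
  shows "psi i x \<in> koszul_cycles {..s} f i"
proof -
  have "kaps [1..<Suc s] (x (top_mon i)) \<in> coef_module s f i"
    using coef_module_kaps[of "x (top_mon i)" s f i "[1..<Suc s]"] inv_chains_coef[OF x]
    by (simp only: length_upt diff_Suc_1)
  then show ?thesis
    unfolding psi_def using coef_module_cycle[of _ s f i "{}"] by simp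
qed

text \<open>
  In \<open>\<kappa>\<^sub>1 \<dots> \<kappa>\<^sub>s (\<Sum>\<^sub>l T\<^sub>l \<kappa>\<^sub>l)\<close> all summands with \<open>l \<ge> 1\<close> vanish because \<open>\<kappa>\<^sub>l\<close> squares to zero. What remains is
  \<open>T\<^sub>0 \<kappa>\<^sub>0\<close>, which lowers \<open>i\<close> by one.
\<close>

lemma psi_Dinv:
  assumes x: "x \<in> inv_chains (Suc i + s)" and i: "0 < i"
  shows "psi i (Dinv x) = altsign s (del 0 (psi (Suc i) x))"
proof -
  let ?ls = "[1..<Suc s]"
  have z: "kaps ?ls (kap l (x (top_mon i - Poly_Mapping.single l 1))) = 0" if "l \<in> {..s} - {0}" for l
    by (rule kaps_kap_mem) (use that in auto)
  have "kaps ?ls (Dinv x (top_mon i)) = (\<Sum>l\<le>s. kaps ?ls (kap l (x (top_mon i - Poly_Mapping.single l 1))))"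
    by (simp only: Dinv_def neg_top_mon[OF i] if_True kaps_sum)
  also have "\<dots> = kaps ?ls (kap 0 (x (top_mon i - Poly_Mapping.single 0 1)))
      + (\<Sum>l\<in>{..s} - {0}. kaps ?ls (kap l (x (top_mon i - Poly_Mapping.single l 1))))"
    by (rule sum.remove) auto
  also have "(\<Sum>l\<in>{..s} - {0}. kaps ?ls (kap l (x (top_mon i - Poly_Mapping.single l 1)))) = 0"
    using z by (rule sum.neutral[rule_format])
  also have "kaps ?ls (kap 0 (x (top_mon i - Poly_Mapping.single 0 1))) + 0
      = altsign s (kap 0 (kaps ?ls (x (top_mon (Suc i)))))"
    by (simp only: add_0_right kaps_kap top_mon_minus length_upt diff_Suc_1)
  finally have 1: "psi i (Dinv x) = altsign s (kap 0 (kaps ?ls (x (top_mon (Suc i))))) {}"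
    by (simp only: psi_def)
  have "kaps ?ls (x (top_mon (Suc i))) \<in> coef_module s f (Suc i)"
    using coef_module_kaps[of "x (top_mon (Suc i))" s f "Suc i" "[1..<Suc s]"] inv_chains_coef[OF x]
    by (simp only: length_upt diff_Suc_1)
  from kap_0_coef_module[OF this, of "{}"]
  have "kap 0 (kaps ?ls (x (top_mon (Suc i)))) {} = del 0 (psi (Suc i) x)"
    by (simp only: psi_def card.empty altsign_0)
  then show ?thesis
    by (simp only: 1 altsign_apply)
qed

text \<open>
  On a coefficient concentrated in \<open>e'\<^sub>1 \<and> \<dots> \<and> e'\<^sub>s\<close> each \<open>\<kappa>\<^sub>m\<close> must remove \<open>e'\<^sub>m\<close>, for otherwise \<open>\<And>\<^sup>0\<close> is not
  reached. The induction runs downwards, and the statement about supports is what excludes the other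
  summand of \<open>\<kappa>\<^sub>m\<close>. The exponent \<open>e\<close> does not depend on \<open>w\<close>.
\<close>

lemma kaps_top:
  "\<exists>e. \<forall>w :: 'a wchain. (\<forall>M. w M \<noteq> 0 \<longrightarrow> M = {1..s}) \<longrightarrow>
     (\<forall>M. kaps [Suc n..<Suc s] w M \<noteq> 0 \<longrightarrow> {1..n} \<subseteq> M) \<and>
     kaps [Suc n..<Suc s] w {1..n} = altsign e (w {1..s})" (is "?P n") if "n \<le> s" for n
  using that
proof (induction n rule: inc_induct)
  case base
  have "kaps [Suc s..<Suc s] w = w" for w :: "'a wchain"
    by simp
  then show ?case
    by (intro exI[of _ 0]) auto
next
  case (step n)
  then obtain e where e: "\<And>w :: 'a wchain. (\<forall>M. w M \<noteq> 0 \<longrightarrow> M = {1..s}) \<Longrightarrow>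
     (\<forall>M. kaps [Suc (Suc n)..<Suc s] w M \<noteq> 0 \<longrightarrow> {1..Suc n} \<subseteq> M) \<and>
     kaps [Suc (Suc n)..<Suc s] w {1..Suc n} = altsign e (w {1..s})"
    by blast
  show ?case
  proof (intro exI[of _ "below {1..n} (Suc n) + e"] allI impI)
    fix w :: "'a wchain" assume w: "\<forall>M. w M \<noteq> 0 \<longrightarrow> M = {1..s}"
    define G where "G = kaps [Suc (Suc n)..<Suc s] w"
    have G1: "{1..Suc n} \<subseteq> M" if "G M \<noteq> 0" for M
      using e[OF w] that unfolding G_def by blast
    have G2: "G {1..Suc n} = altsign e (w {1..s})"
      using e[OF w] unfolding G_def by blast
    have "[Suc n..<Suc s] = Suc n # [Suc (Suc n)..<Suc s]"
      using step.hyps by (intro upt_conv_Cons) simp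
    then have k: "kaps [Suc n..<Suc s] w = kap (Suc n) G"
      by (simp only: kaps_Cons G_def)
    have "{1..n} \<subseteq> M" if nz: "kap (Suc n) G M \<noteq> 0" for M
    proof -
      have "G (insert (Suc n) M) \<noteq> 0 \<or> G M \<noteq> 0"
      proof (rule ccontr)
        assume "\<not> ?thesis"
        then have z: "G (insert (Suc n) M) = 0" "G M = 0"
          by simp_all
        have "del (Suc n) G M = 0"
          by (simp only: del_def z altsign_zero if_cancel)
        then have "kap (Suc n) G M = 0"
          by (simp only: kap_def z del_zero altsign_zero add_0_right if_cancel)
        with nz show False ..
      qed
      then have "{1..Suc n} \<subseteq> insert (Suc n) M"
        using G1 by blast
      moreover have "j \<in> {1..Suc n}" "j \<noteq> Suc n" if "j \<in> {1..n}" for j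
        using that by simp_all
      ultimately show ?thesis
        by blast
    qed
    moreover have "kap (Suc n) G {1..n} = altsign (below {1..n} (Suc n) + e) (w {1..s})"
    proof -
      have z: "G {1..n} = 0"
        using G1[of "{1..n}"] by fastforce
      have "insert (Suc n) {1..n} = {1..Suc n}"
        by auto
      then have d: "del (Suc n) G {1..n} = altsign (below {1..n} (Suc n)) (G {1..Suc n})"
        by (simp add: del_def)
      have "kap (Suc n) G {1..n} = del (Suc n) G {1..n}"
        by (simp only: kap_def finite_atLeastAtMost if_True z del_zero altsign_zero add_0_right)
      then show ?thesis
        by (simp only: d G2 altsign_altsign)
    qed
    ultimately show "(\<forall>M. kaps [Suc n..<Suc s] w M \<noteq> 0 \<longrightarrow> {1..n} \<subseteq> M) \<and>
     kaps [Suc n..<Suc s] w {1..n} = altsign (below {1..n} (Suc n) + e) (w {1..s})"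
      unfolding k by blast
  qed
qed

lemma kaps_top_value:
  obtains e where "\<And>w :: 'a wchain. (\<And>M. w M \<noteq> 0 \<Longrightarrow> M = {1..s}) \<Longrightarrow>
     kaps [1..<Suc s] w {} = altsign e (w {1..s})"
proof -
  have "{1..0::nat} = {}" "Suc 0 = 1"
    by auto
  with kaps_top[of 0] show ?thesis
    using that by (metis le0)
qed

text \<open>
  Applying the homotopies for \<open>m = 1, \<dots>, s\<close> in turn replaces a cycle by a homologous one that is killed by
  every \<open>e'\<^sub>m\<close> and supported on \<open>\<alpha>\<^sub>m = -1\<close>, hence of the form \<open>v T\<^bsup>(-i, -1, \<dots>, -1)\<^esup> e'\<^sub>1 \<and> \<dots> \<and> e'\<^sub>s\<close>. The map
  \<open>psi\<close> is unchanged on the way and reads off \<open>v\<close> up to sign, so \<open>v = 0\<close>.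
\<close>

lemma cycle_reduction:
  assumes x: "x \<in> inv_chains (i + s)" and i: "0 < i" and D: "Dinv x = 0" and psi: "psi i x = 0"
  shows "\<exists>y\<in>inv_chains (Suc (i + s)). x = Dinv y"
proof -
  let ?n = "i + s"
  have step: "\<exists>y\<in>inv_chains (Suc ?n). Dinv (x - Dinv y) = 0 \<and> psi i (x - Dinv y) = 0 \<and>
      (\<forall>k\<in>{1..m}. \<forall>\<alpha>. ins k ((x - Dinv y) \<alpha>) = 0 \<and>
         ((x - Dinv y) \<alpha> \<noteq> 0 \<longrightarrow> Poly_Mapping.lookup \<alpha> k = -1))" if "m \<le> s" for m
    using that
  proof (induction m)
    case 0
    have e: "x - Dinv 0 = x"
      unfolding Dinv_zero by (rule diff_0_right)
    show ?case
      by (rule bexI[OF _ inv_chains_zero]) (unfold e, intro conjI D psi ballI, simp)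
  next
    case (Suc m)
    then obtain y where y: "y \<in> inv_chains (Suc ?n)" and Dy: "Dinv (x - Dinv y) = 0"
      and psiy: "psi i (x - Dinv y) = 0"
      and ins_y: "\<And>k \<alpha>. k \<in> {1..m} \<Longrightarrow> ins k ((x - Dinv y) \<alpha>) = 0"
      and supp_y: "\<And>k \<alpha>. k \<in> {1..m} \<Longrightarrow> (x - Dinv y) \<alpha> \<noteq> 0 \<Longrightarrow> Poly_Mapping.lookup \<alpha> k = -1"
      by (meson Suc_leD)
    define x' where "x' = x - Dinv y"
    let ?m = "Suc m"
    have m: "?m \<in> {1..s}"
      using Suc.prems by simp
    have x': "x' \<in> inv_chains ?n"
      unfolding x'_def by (intro inv_chains_diff x Dinv_inv_chains y)
    \<comment> \<open>the correction that the homotopy prescribes for the index \<open>m + 1\<close>\<close>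
    define y' where "y' = y + hom_op ?m x'"
    have y': "y' \<in> inv_chains (Suc ?n)"
      unfolding y'_def by (intro inv_chains_add y hom_op_inv_chains x' m)
    have "hom_op ?m (Dinv x') = 0"
      unfolding hom_op_def x'_def Dy by (rule ext) (simp only: inv_apply ins_zero)
    with homotopy[OF x' m] have x'_eq: "x' = Dinv (hom_op ?m x') + proj_op ?m x'"
      by (simp only: add_0_right)
    have "x - Dinv y' = x' - Dinv (hom_op ?m x')"
      unfolding y'_def Dinv_add x'_def by (rule diff_diff_eq[symmetric])
    also have "\<dots> = proj_op ?m x'"
      using x'_eq by (metis add_diff_cancel_left')
    finally have xy': "x - Dinv y' = proj_op ?m x'" .
    have "Dinv (x - Dinv y') = Dinv x - Dinv (Dinv y')"
      by (rule Dinv_diff)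
    then have 1: "Dinv (x - Dinv y') = 0"
      by (simp only: D Dinv_Dinv diff_self)
    have "psi i (proj_op ?m x') = psi i x'"
    proof -
      have "Poly_Mapping.lookup (top_mon i) ?m = -1"
        using m by (simp add: lookup_top_mon)
      then have "proj_op ?m x' (top_mon i) = ins ?m (kap ?m (x' (top_mon i)))"
        by (simp only: proj_op_def if_True simp_thms)
      also have "\<dots> = x' (top_mon i) - kap ?m (ins ?m (x' (top_mon i)))"
        using kap_ins_coef_module[OF inv_chains_coef[OF x'], of ?m ?m "top_mon i"]
        by (simp only: simp_thms if_True) (metis add_diff_cancel_left')
      finally have "kaps [1..<Suc s] (proj_op ?m x' (top_mon i))
          = kaps [1..<Suc s] (x' (top_mon i)) - kaps [1..<Suc s] (kap ?m (ins ?m (x' (top_mon i))))"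
        by (simp only: kaps_diff)
      also have "kaps [1..<Suc s] (kap ?m (ins ?m (x' (top_mon i)))) = 0"
        by (rule kaps_kap_mem) (use m in auto)
      finally show ?thesis
        by (simp only: psi_def diff_0_right)
    qed
    then have 2: "psi i (x - Dinv y') = 0"
      unfolding xy' using psiy by (simp only: x'_def)
    have 3: "ins k (proj_op ?m x' \<alpha>) = 0" if k: "k \<in> {1..?m}" for k \<alpha>
    proof (cases "Poly_Mapping.lookup \<alpha> ?m = -1")
      case True
      then have p: "proj_op ?m x' \<alpha> = ins ?m (kap ?m (x' \<alpha>))"
        by (simp only: proj_op_def if_True simp_thms)
      show ?thesis
      proof (cases "k = ?m")
        case True
        then show ?thesis
          by (simp only: p ins_self)
      next
        case False
        then have k': "k \<in> {1..m}" "?m \<noteq> k"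
          using k by auto
        have "kap ?m (ins k (x' \<alpha>)) + ins k (kap ?m (x' \<alpha>)) = 0"
          using kap_ins_coef_module[OF inv_chains_coef[OF x'], of ?m k \<alpha>] k'(2) by (simp only: if_False)
        moreover have "ins k (x' \<alpha>) = 0"
          unfolding x'_def by (rule ins_y[OF k'(1)])
        ultimately have "ins k (kap ?m (x' \<alpha>)) = 0"
          by (simp only: kap_zero add_0_left)
        then show ?thesis
          by (simp only: p ins_ins[of k ?m] ins_zero minus_zero)
      qed
    next
      case False
      then show ?thesis
        by (simp only: proj_op_def if_False ins_zero)
    qed
    have 4: "Poly_Mapping.lookup \<alpha> k = -1" if k: "k \<in> {1..?m}" and nz: "proj_op ?m x' \<alpha> \<noteq> 0" for k \<alpha>
    proof -
      have a: "Poly_Mapping.lookup \<alpha> ?m = -1"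
        using nz unfolding proj_op_def by presburger
      have b: "x' \<alpha> \<noteq> 0"
      proof
        assume "x' \<alpha> = 0"
        then have "proj_op ?m x' \<alpha> = 0"
          by (simp only: proj_op_def kap_zero ins_zero if_cancel)
        with nz show False ..
      qed
      show ?thesis
      proof (cases "k = ?m")
        case False
        then have "k \<in> {1..m}"
          using k by auto
        then show ?thesis
          using supp_y b unfolding x'_def by blast
      qed (use a in simp)
    qed
    show ?case
      by (rule bexI[OF _ y']) (use 1 2 3 4 in \<open>unfold xy', blast\<close>)
  qed
  obtain y where y: "y \<in> inv_chains (Suc ?n)"
    and psiy: "psi i (x - Dinv y) = 0"
    and ins_y: "\<And>k \<alpha>. k \<in> {1..s} \<Longrightarrow> ins k ((x - Dinv y) \<alpha>) = 0"
    and supp_y: "\<And>k \<alpha>. k \<in> {1..s} \<Longrightarrow> (x - Dinv y) \<alpha> \<noteq> 0 \<Longrightarrow> Poly_Mapping.lookup \<alpha> k = -1"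
    using step[of s] by (meson order_refl)
  define x' where "x' = x - Dinv y"
  have x': "x' \<in> inv_chains ?n"
    unfolding x'_def by (intro inv_chains_diff x Dinv_inv_chains y)
  \<comment> \<open>being killed by every \<open>e'\<^sub>k\<close>, the coefficients of \<open>x'\<close> are divisible by \<open>e'\<^sub>1 \<and> \<dots> \<and> e'\<^sub>s\<close>\<close>
  have supp: "M = {1..s}" if nz: "x' \<alpha> M \<noteq> 0" for \<alpha> M
  proof (rule ccontr)
    assume "M \<noteq> {1..s}"
    moreover have "M \<subseteq> {1..s}"
      by (rule coef_module_subset[OF inv_chains_coef[OF x'] nz])
    ultimately obtain k where k: "k \<in> {1..s}" "k \<notin> M"
      by blast
    then have "insert k M - {k} = M"
      by auto
    then have "ins k (x' \<alpha>) (insert k M) = altsign (below (insert k M) k) (x' \<alpha> M)"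
      by (simp only: ins_def insertI1 if_True)
    moreover have "ins k (x' \<alpha>) = 0"
      unfolding x'_def by (rule ins_y[OF k(1)])
    ultimately show False
      using nz by (metis altsign_eq_0_iff fun2_apply(3))
  qed
  have "x' \<alpha> = 0" for \<alpha>
  proof (rule ccontr)
    assume nz: "x' \<alpha> \<noteq> 0"
    have "\<alpha> = top_mon i"
    proof -
      have neg: "neg s \<alpha>" and deg: "deg \<alpha> = - int ?n"
        using inv_chains_supp[OF x' nz] by blast+
      have k: "Poly_Mapping.lookup \<alpha> k = -1" if "k \<in> {1..s}" for k
        using supp_y[OF that] nz unfolding x'_def by blast
      have "deg \<alpha> = (\<Sum>j\<le>s. Poly_Mapping.lookup \<alpha> j)"
        using neg unfolding neg_def by (intro deg_atMost) blast
      also have "\<dots> = Poly_Mapping.lookup \<alpha> 0 + (\<Sum>j\<in>{..s} - {0}. Poly_Mapping.lookup \<alpha> j)"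
        by (rule sum.remove) auto
      also have "{..s} - {0} = {1..s}"
        by auto
      also have "(\<Sum>j\<in>{1..s}. Poly_Mapping.lookup \<alpha> j) = (\<Sum>j\<in>{1..s}. -1)"
        by (rule sum.cong) (simp_all add: k)
      finally have "Poly_Mapping.lookup \<alpha> 0 = - int i"
        using deg by simp
      then show ?thesis
        using k neg unfolding neg_def by (intro poly_mapping_eqI) (simp add: lookup_top_mon)
    qed
    obtain e where e: "\<And>w :: 'a wchain. (\<And>M. w M \<noteq> 0 \<Longrightarrow> M = {1..s}) \<Longrightarrow>
       kaps [1..<Suc s] w {} = altsign e (w {1..s})"
      using kaps_top_value by blast
    have "psi i x' = altsign e (x' \<alpha> {1..s})"
      unfolding psi_def \<open>\<alpha> = top_mon i\<close> by (rule e) (rule supp)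
    moreover have "psi i x' = 0"
      unfolding x'_def by (rule psiy)
    ultimately have "x' \<alpha> {1..s} = 0"
      by (metis altsign_eq_0_iff)
    then have "x' \<alpha> M = 0" for M
      using supp[of \<alpha> M] by blast
    then have "x' \<alpha> = 0"
      by (simp add: fun_eq_iff)
    with nz show False ..
  qed
  then have "x' = 0"
    by (intro ext) (simp only: inv_apply)
  then have "x = Dinv y"
    unfolding x'_def by (metis eq_iff_diff_eq_0)
  with y show ?thesis
    by blast
qed

text \<open>
  A section of \<open>psi\<close>, up to a sign. It is compatible with the differentials on the elements that are
  killed by \<open>del 0\<close>.
\<close>

definition top_elem :: "nat \<Rightarrow> (nat set \<Rightarrow> 'a) \<Rightarrow> (nat \<Rightarrow>\<^sub>0 int) \<Rightarrow> 'a wchain" where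
  "top_elem i v = (\<lambda>\<alpha> M. if \<alpha> = top_mon i \<and> M = {1..s} then v else 0)"

lemma top_elem_eq_0: "\<alpha> \<noteq> top_mon i \<Longrightarrow> top_elem i v \<alpha> = 0"
  by (simp add: top_elem_def fun_eq_iff)

lemma top_elem_inv_chains:
  assumes v: "v \<in> koszul_cycles {..s} f i" and i: "0 < i"
  shows "top_elem i v \<in> inv_chains (i + s)"
proof (rule inv_chainsI)
  fix \<alpha>
  have "(if M \<subseteq> {1..s} \<and> card M \<le> i + s then top_elem i v \<alpha> M \<in> koszul_cycles {..s} f (i + s - card M)
      else top_elem i v \<alpha> M = 0)" for M
  proof (cases "\<alpha> = top_mon i \<and> M = {1..s}")
    case True
    then show ?thesis
      using v by (simp add: top_elem_def)
  next
    case False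
    then have "top_elem i v \<alpha> M = 0"
      by (simp only: top_elem_def if_False)
    then show ?thesis
      by (simp only: koszul_cycles_zero finite_atMost if_cancel simp_thms)
  qed
  then show "top_elem i v \<alpha> \<in> coef_module s f (i + s)"
    unfolding coef_module_def by blast
  assume "top_elem i v \<alpha> \<noteq> 0"
  then have "\<alpha> = top_mon i"
    using top_elem_eq_0 by blast
  then show "neg s \<alpha> \<and> deg \<alpha> = - int (i + s)"
    using neg_top_mon[OF i] deg_top_mon by simp
qed

lemma psi_top_elem:
  obtains e where "\<And>i v. psi i (top_elem i (altsign e v)) = v"
proof -
  obtain e where e: "\<And>w :: 'a wchain. (\<And>M. w M \<noteq> 0 \<Longrightarrow> M = {1..s}) \<Longrightarrow>
     kaps [1..<Suc s] w {} = altsign e (w {1..s})"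
    using kaps_top_value by blast
  have "psi i (top_elem i (altsign e v)) = v" for i v
  proof -
    have "psi i (top_elem i (altsign e v)) = altsign e (top_elem i (altsign e v) (top_mon i) {1..s})"
      unfolding psi_def by (rule e) (metis top_elem_def)
    then show ?thesis
      by (simp only: top_elem_def simp_thms if_True altsign_twice)
  qed
  with that show ?thesis
    by blast
qed

lemma Dinv_top_elem:
  assumes v: "v \<in> koszul_cycles {..s} f i" and i: "0 < i" and del: "del 0 v = 0"
  shows "Dinv (top_elem i v) = 0"
proof
  fix \<alpha>
  show "Dinv (top_elem i v) \<alpha> = 0 \<alpha>"
  proof (cases "neg s \<alpha>")
    case True
    have "kap l (top_elem i v (\<alpha> - Poly_Mapping.single l 1)) = 0" if l: "l \<in> {..s}" for l
    proof (cases "\<alpha> - Poly_Mapping.single l 1 = top_mon i")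
      case eq: True
      have "l = 0"
      proof (rule ccontr)
        assume "l \<noteq> 0"
        then have "Poly_Mapping.lookup (\<alpha> - Poly_Mapping.single l 1) l = -1"
          using l unfolding eq by (simp add: lookup_top_mon)
        then have "Poly_Mapping.lookup \<alpha> l = 0"
          by (simp add: lookup_minus)
        then show False
          using True l unfolding neg_def by (metis atMost_iff less_irrefl)
      qed
      have c: "top_elem i v (top_mon i) \<in> coef_module s f (i + s)"
        by (rule inv_chains_coef[OF top_elem_inv_chains[OF v i]])
      show ?thesis
        unfolding eq unfolding \<open>l = 0\<close>
      proof (rule ext)
        fix M
        have "del 0 (top_elem i v (top_mon i) M) = 0"
          by (cases "M = {1..s}") (simp_all only: top_elem_def simp_thms if_True if_False del del_zero)
        then show "kap 0 (top_elem i v (top_mon i)) M = 0 M"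
          by (simp only: kap_0_coef_module[OF c] altsign_zero fun2_apply)
      qed
    next
      case False
      then show ?thesis
        by (simp only: top_elem_eq_0 kap_zero not_False_eq_True)
    qed
    then have "(\<Sum>l\<le>s. kap l (top_elem i v (\<alpha> - Poly_Mapping.single l 1))) = 0"
      by (rule sum.neutral[rule_format])
    then show ?thesis
      by (simp only: Dinv_def True if_True inv_apply)
  qed (simp only: Dinv_def if_False inv_apply)
qed

end

lemma a_kernel_eq: "a_kernel M N h = {x \<in> carrier M. h x = \<zero>\<^bsub>N\<^esub>}"
  by (simp add: a_kernel_def kernel_def)

lemma cscale_diff: "cscale r (c - d) = cscale r c - cscale r d"
  by (simp add: cscale_def fun_eq_iff right_diff_distrib)

lemma altsign_cancel:
  assumes "odd (m + n)"
  shows "altsign m v + altsign n v = 0"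
  using assms by (auto simp: altsign_def)

lemma below_complement:
  assumes "l \<le> s" "J \<subseteq> {..s}"
  shows "below J l + below ({..s} - J) l = l"
proof -
  have "{k \<in> J. k < l} \<union> {k \<in> {..s} - J. k < l} = {..<l}"
    using assms by auto
  moreover have "{k \<in> J. k < l} \<inter> {k \<in> {..s} - J. k < l} = {}"
    by auto
  moreover have "finite {k \<in> J. k < l}" "finite {k \<in> {..s} - J. k < l}"
    by auto
  ultimately show ?thesis
    unfolding below_def using card_Un_disjoint[of "{k \<in> J. k < l}" "{k \<in> {..s} - J. k < l}"]
    by (simp only: card_lessThan)
qed

context approximation_complex
begin

section \<open>The terms of \<open>\<^sub>0\<Z>\<^sup>+\<close>\<close>

lemma cech_presents: "presents cscale (cech_chains p i) {0} (\<lambda>x. x) (cech_module s f p i)"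
  unfolding cech_module_eq
  by (intro presents_module_on cscale_diff cech_chains_zero cech_chains_diff cech_chains_cscale)

lemma carrier_cech_module: "carrier (cech_module s f p i) = cech_chains p i"
  using presents_carrier[OF cech_presents] by simp

text \<open>
  The top local cohomology consists of the inverse polynomials.
\<close>

lemma image_cech_diff:
  "cech_diff s ` cech_chains s i = {c \<in> cech_chains (Suc s) i. neg_part c = 0}"
proof (intro equalityI subsetI)
  fix c assume "c \<in> cech_diff s ` cech_chains s i"
  then obtain w where w: "w \<in> cech_chains s i" "c = cech_diff s w"
    by blast
  have "cech_diff s w \<in> cech_chains (Suc s) i"
  proof (rule cech_chainsI)
    fix J assume "J \<subseteq> {..s}" "card J = Suc s"
    then have J: "J = {..s}"
      using top_index by blast
    have wj: "w ({..s} - {j}) \<in> loc_chains ({..s} - {j}) i" if "j \<in> {..s}" for j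
      by (rule cech_chainsD[OF w(1)]) (use that in auto)
    show "cech_diff s w J \<in> loc_chains J i"
      unfolding J
    proof (rule loc_chainsI)
      fix \<alpha>
      show "cof (cech_diff s w {..s}) \<alpha> \<in> coef_module s f i"
        unfolding cof_cech_diff[OF order_refl]
        by (intro coef_module_sum coef_module_altsign loc_chains_coef[OF wj])
      assume nz: "cof (cech_diff s w {..s}) \<alpha> \<noteq> 0"
      have "\<exists>j\<in>{..s}. cof (w ({..s} - {j})) \<alpha> \<noteq> 0"
      proof (rule ccontr)
        assume "\<not> ?thesis"
        then have "altsign (below {..s} j) (cof (w ({..s} - {j})) \<alpha>) = 0" if "j \<in> {..s}" for j
          using that altsign_zero by metis
        then have "cof (cech_diff s w {..s}) \<alpha> = 0"
          unfolding cof_cech_diff[OF order_refl] by (rule sum.neutral[rule_format])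
        with nz show False ..
      qed
      then obtain j where "j \<in> {..s}" "cof (w ({..s} - {j})) \<alpha> \<noteq> 0"
        by blast
      then have "mono_ok s ({..s} - {j}) \<alpha>"
        using loc_chains_mono wj by blast
      then show "mono_ok s {..s} \<alpha>"
        unfolding mono_ok_def by blast
    qed
  next
    fix J assume nJ: "\<not> (J \<subseteq> {..s} \<and> card J = Suc s)"
    show "cech_diff s w J = 0"
    proof (cases "J \<subseteq> {..s}")
      case True
      have "w (J - {j}) = 0" if "j \<in> J" for j
      proof (rule cech_chains_eq_0[OF w(1)])
        have "card J = Suc (card (J - {j}))"
          using that finite_subset[OF True] by (intro card.remove) auto
        then show "\<not> (J - {j} \<subseteq> {..s} \<and> card (J - {j}) = s)"
          using nJ True by metis
      qed
      then have "altsign (card {k \<in> J. k < j}) (w (J - {j})) = 0" if "j \<in> J" for j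
        using that by (simp only: altsign_zero)
      then have "(\<Sum>j\<in>J. altsign (card {k \<in> J. k < j}) (w (J - {j}))) = 0"
        by (rule sum.neutral[rule_format])
      then show ?thesis
        by (simp only: cech_diff_def True if_True)
    qed (simp only: cech_diff_def if_False)
  qed
  then show "c \<in> {c \<in> cech_chains (Suc s) i. neg_part c = 0}"
    using w coboundary_neg_part[OF w(1)] by blast
next
  fix c assume "c \<in> {c \<in> cech_chains (Suc s) i. neg_part c = 0}"
  then show "c \<in> cech_diff s ` cech_chains s i"
    using neg_part_zero_coboundary by blast
qed

lemma cech_diff_top:
  assumes c: "c \<in> cech_chains (Suc s) i"
  shows "cech_diff s c = 0"
proof
  fix J
  show "cech_diff s c J = 0 J"
  proof (cases "J \<subseteq> {..s}")
    case True
    have "c (J - {j}) = 0" if "j \<in> J" for j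
    proof (rule cech_chains_eq_0[OF c])
      show "\<not> (J - {j} \<subseteq> {..s} \<and> card (J - {j}) = Suc s)"
        unfolding top_index using that True by blast
    qed
    then have "altsign (card {k \<in> J. k < j}) (c (J - {j})) = 0" if "j \<in> J" for j
      using that by (simp only: altsign_zero)
    then have "(\<Sum>j\<in>J. altsign (card {k \<in> J. k < j}) (c (J - {j}))) = 0"
      by (rule sum.neutral[rule_format])
    then show ?thesis
      by (simp only: cech_diff_def True if_True cchain_apply)
  qed (simp only: cech_diff_def if_False cchain_apply)
qed

abbreviation cls :: "nat \<Rightarrow> 'a cchain \<Rightarrow> 'a cchain set" where
  "cls n \<equiv> lc_class s f (s + 1) n"

lemma local_cohomology_eq:
  "local_cohomology s f (s + 1) n =
     quotient_module (cech_module s f (s + 1) n) (cech_diff s ` cech_chains s n)"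
proof -
  have "a_kernel (cech_module s f (s + 1) n) (cech_module s f (s + 1 + 1) n) (cech_diff s)
      = carrier (cech_module s f (s + 1) n)"
    unfolding a_kernel_eq carrier_cech_module presents_zero[OF cech_presents]
    using cech_diff_top by auto
  moreover have "(cech_module s f (s + 1) n)\<lparr>carrier := carrier (cech_module s f (s + 1) n)\<rparr>
      = cech_module s f (s + 1) n"
    unfolding carrier_cech_module unfolding cech_module_eq by (simp add: module_on_def)
  ultimately show ?thesis
    unfolding local_cohomology_def homology_at_def by (simp only: carrier_cech_module add_diff_cancel_right')
qed

lemma cls_eq_coset:
  "cls n = (\<lambda>c. (cech_diff s ` cech_chains s n) +>\<^bsub>cech_module s f (s + 1) n\<^esub> c)"
  by (rule ext) (simp add: lc_class_def carrier_cech_module)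

lemma coboundaries_submodule:
  defines "B \<equiv> \<lambda>n. {c \<in> cech_chains (Suc s) n. neg_part c = 0}"
  shows "B n \<subseteq> cech_chains (s + 1) n" "0 \<in> B n" "\<And>x y. x \<in> B n \<Longrightarrow> y \<in> B n \<Longrightarrow> x - y \<in> B n"
    "\<And>r x. x \<in> B n \<Longrightarrow> cscale r x \<in> B n"
    "\<And>x. x \<in> cech_chains (s + 1) n \<Longrightarrow> x \<in> {0} \<Longrightarrow> x \<in> B n"
    "cech_diff s ` cech_chains s n = (\<lambda>x. x) ` B n"
proof -
  show "B n \<subseteq> cech_chains (s + 1) n"
    unfolding B_def by auto
  show z: "0 \<in> B n"
    unfolding B_def using cech_chains_zero neg_part_zero by blast
  show "x - y \<in> B n" if xy: "x \<in> B n" "y \<in> B n" for x y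
  proof -
    have "neg_part x = 0" "neg_part y = 0"
      using xy unfolding B_def by blast+
    then have "neg_part (x - y) = 0"
      by (simp only: neg_part_diff diff_self)
    then show ?thesis
      using xy cech_chains_diff unfolding B_def by blast
  qed
  show "cscale r x \<in> B n" if x: "x \<in> B n" for r x
  proof -
    have n: "neg_part x = 0"
      using x unfolding B_def by blast
    have "neg_part (cscale r x) = 0"
      unfolding neg_part_cscale n by (rule ext) (simp only: inv_apply wscale_zero)
    then show ?thesis
      using x cech_chains_cscale unfolding B_def by blast
  qed
  show "x \<in> B n" if "x \<in> {0}" for x
    using that z by blast
  show "cech_diff s ` cech_chains s n = (\<lambda>x. x) ` B n"
    unfolding B_def image_cech_diff by simp
qed

lemma local_cohomology_presents:
  "presents cscale (cech_chains (s + 1) n) {c \<in> cech_chains (Suc s) n. neg_part c = 0} (cls n)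
     (local_cohomology s f (s + 1) n)"
  unfolding local_cohomology_eq cls_eq_coset
  by (rule presents_quotient[OF cech_presents coboundaries_submodule])

lemma classes_of_local_cohomology:
  "classes_of H (local_cohomology s f (s + 1) n) = cls n ` (cech_chains (s + 1) n \<inter> H)"
  unfolding local_cohomology_eq cls_eq_coset
  by (rule classes_of_presented_quotient[OF cech_presents coboundaries_submodule]) auto

lemma top_chains_closed:
  "0 \<in> top_chains n" "x \<in> top_chains n \<Longrightarrow> y \<in> top_chains n \<Longrightarrow> x - y \<in> top_chains n"
  "x \<in> top_chains n \<Longrightarrow> cscale r x \<in> top_chains n"
proof -
  show "0 \<in> top_chains n"
    unfolding top_chains_def T_homogeneous_C_def T_homogeneous_def using cech_chains_zero by simp
  show "x - y \<in> top_chains n" if xy: "x \<in> top_chains n" "y \<in> top_chains n"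
  proof -
    have "deg \<alpha> = - int n" if "cof ((x - y) {..s}) \<alpha> \<noteq> 0" for \<alpha>
    proof -
      have "cof (x {..s}) \<alpha> \<noteq> 0 \<or> cof (y {..s}) \<alpha> \<noteq> 0"
        using that unfolding cchain_apply cof_diff by (metis diff_self)
      then show ?thesis
        using xy unfolding top_chains_iff by blast
    qed
    moreover have "x - y \<in> cech_chains (Suc s) n"
      using xy cech_chains_diff unfolding top_chains_def by blast
    ultimately show ?thesis
      using T_homogeneous_iff[OF cech_chainsD] top_chains_iff cech_chainsD[of "x - y" "Suc s" n "{..s}"]
        cech_chains_eq_0[of "x - y" "Suc s" n] top_index
      by (metis atMost_iff card_atMost order_refl subsetI)
  qed
  show "cscale r x \<in> top_chains n" if x: "x \<in> top_chains n"
  proof -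
    have "deg \<alpha> = - int n" if "cof (cscale r x {..s}) \<alpha> \<noteq> 0" for \<alpha>
    proof -
      have "cof (x {..s}) \<alpha> \<noteq> 0"
        using that unfolding cof_cscale by (metis wscale_zero)
      then show ?thesis
        using x unfolding top_chains_iff by blast
    qed
    moreover have "cscale r x \<in> cech_chains (Suc s) n"
      using x cech_chains_cscale unfolding top_chains_def by blast
    ultimately show ?thesis
      using top_chains_iff cech_chainsD[of "cscale r x" "Suc s" n "{..s}"]
        cech_chains_eq_0[of "cscale r x" "Suc s" n] top_index
      by (metis card_atMost order_refl)
  qed
qed

lemma Zplus_presents:
  "presents cscale (top_chains (i + s)) {c. neg_part c = 0} (cls (i + s)) (Zplus s f i)"
proof -
  have "classes_of (T_homogeneous_C 0) (local_cohomology s f (s + 1) (i + s)) = cls (i + s) ` top_chains (i + s)"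
    unfolding classes_of_local_cohomology top_chains_def by simp
  note eq = this
  have sub: "top_chains (i + s) \<subseteq> cech_chains (s + 1) (i + s)"
    unfolding top_chains_def by simp
  have iff: "c \<in> {c \<in> cech_chains (Suc s) (i + s). neg_part c = 0} \<longleftrightarrow> c \<in> {c. neg_part c = 0}"
    if "c \<in> top_chains (i + s)" for c
    using subsetD[OF sub that] by (simp only: mem_Collect_eq Suc_eq_plus1 simp_thms)
  show ?thesis
    unfolding Zplus_def Let_def
    by (rule presents_restrict[OF local_cohomology_presents sub top_chains_closed(1)
          top_chains_closed(2) top_chains_closed(3) eq iff])
qed

lemma cls_eqI:
  assumes c: "c \<in> cech_chains (Suc s) n" and d: "d \<in> cech_chains (Suc s) n"
    and eq: "neg_part c = neg_part d"
  shows "cls n c = cls n d"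
proof -
  have "neg_part (c - d) = 0"
    by (simp only: neg_part_diff eq diff_self)
  then have "c - d \<in> {c \<in> cech_chains (Suc s) n. neg_part c = 0}"
    using cech_chains_diff[OF c d] by blast
  moreover have "c \<in> cech_chains (s + 1) n" "d \<in> cech_chains (s + 1) n"
    using c d by (simp_all only: Suc_eq_plus1)
  ultimately show ?thesis
    using presents_eq_iff[OF local_cohomology_presents, of c n d] by blast
qed

lemma cls_eq:
  assumes c: "c \<in> cech_chains (Suc s) n"
  shows "cls n c = (\<lambda>e. e + c) ` {c \<in> cech_chains (Suc s) n. neg_part c = 0}"
proof -
  have "c \<in> cech_chains (s + 1) n"
    using c by (simp only: Suc_eq_plus1)
  then show ?thesis
    unfolding cls_eq_coset coboundaries_submodule(6)
    by (rule presents_coset[OF cech_presents coboundaries_submodule(1)])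
qed

lemma cls_memD:
  assumes c: "c \<in> cech_chains (Suc s) n" and d: "d \<in> cls n c"
  shows "d \<in> cech_chains (Suc s) n" "neg_part d = neg_part c"
proof -
  obtain e where e: "e \<in> cech_chains (Suc s) n" "neg_part e = 0" "d = e + c"
    using d unfolding cls_eq[OF c] by blast
  have ec: "e - (0 - c) = d"
    by (simp only: e(3) diff_0 diff_minus_eq_add)
  have "e - (0 - c) \<in> cech_chains (Suc s) n"
    by (intro cech_chains_diff e(1) cech_chains_zero c)
  then show "d \<in> cech_chains (Suc s) n"
    by (simp only: ec)
  have "neg_part d = neg_part (e - (0 - c))"
    by (simp only: ec)
  also have "\<dots> = neg_part e - (neg_part 0 - neg_part c)"
    by (simp only: neg_part_diff)
  also have "\<dots> = neg_part c"
    by (simp only: e(2) neg_part_zero diff_0 minus_minus)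
  finally show "neg_part d = neg_part c" .
qed

lemma cls_self:
  assumes c: "c \<in> cech_chains (Suc s) n"
  shows "c \<in> cls n c"
proof -
  have "0 + c \<in> (\<lambda>d. d + c) ` {c \<in> cech_chains (Suc s) n. neg_part c = 0}"
    using coboundaries_submodule(2)[of n] by (rule imageI)
  then show ?thesis
    unfolding cls_eq[OF c] by (simp only: add_0_left)
qed

lemma D_diff_cech_chains:
  assumes c: "c \<in> cech_chains (Suc s) (Suc n)"
  shows "(\<lambda>J. D_diff s (c J)) \<in> cech_chains (Suc s) n"
proof (rule cech_chainsI)
  fix J
  show "D_diff s (c J) \<in> loc_chains J n" if "J \<subseteq> {..s}" "card J = Suc s"
    by (rule D_diff_loc_chains[OF cech_chainsD[OF c that]])
  show "D_diff s (c J) = 0" if "\<not> (J \<subseteq> {..s} \<and> card J = Suc s)"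
    unfolding cech_chains_eq_0[OF c that] by (rule D_diff_zero)
qed

lemma top_chains_cech: "c \<in> top_chains n \<Longrightarrow> c \<in> cech_chains (Suc s) n"
  unfolding top_chains_def by blast

lemma cech_top_loc: "c \<in> cech_chains (Suc s) n \<Longrightarrow> c {..s} \<in> loc_chains {..s} n"
  using cech_chainsD[of c "Suc s" n "{..s}"] by simp

lemma Zplus_diff_cls:
  assumes c: "c \<in> cech_chains (Suc s) (Suc i + s)"
  shows "Zplus_diff s f (Suc i) (cls (Suc i + s) c) = cls (i + s) (\<lambda>J. D_diff s (c J))"
proof -
  have "cls (i + s) (\<lambda>J. D_diff s (d J)) = cls (i + s) (\<lambda>J. D_diff s (c J))" if "d \<in> cls (Suc i + s) c" for d
  proof (rule cls_eqI)
    note d = cls_memD[OF c that]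
    show "(\<lambda>J. D_diff s (d J)) \<in> cech_chains (Suc s) (i + s)" "(\<lambda>J. D_diff s (c J)) \<in> cech_chains (Suc s) (i + s)"
      using D_diff_cech_chains[of d "i + s"] D_diff_cech_chains[of c "i + s"] d(1) c by (simp_all only: add_Suc)
    show "neg_part (\<lambda>J. D_diff s (d J)) = neg_part (\<lambda>J. D_diff s (c J))"
      by (simp only: neg_part_D_diff[where c = d, OF cech_top_loc[OF d(1)]] neg_part_D_diff[where c = c, OF cech_top_loc[OF c]] d(2))
  qed
  then have "(\<Union>d\<in>cls (Suc i + s) c. cls (i + s) (\<lambda>J. D_diff s (d J)))
      = (\<Union>d\<in>cls (Suc i + s) c. cls (i + s) (\<lambda>J. D_diff s (c J)))"
    by (rule SUP_cong[OF refl])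
  also have "\<dots> = cls (i + s) (\<lambda>J. D_diff s (c J))"
    using cls_self[OF c] by (intro SUP_const) blast
  finally have "(\<Union>d\<in>cls (Suc i + s) c. cls (i + s) (\<lambda>J. D_diff s (d J))) = cls (i + s) (\<lambda>J. D_diff s (c J))" .
  moreover have "Suc i + s - 1 = i + s"
    by simp
  ultimately show ?thesis
    unfolding Zplus_diff_def lc_map_def by (simp only:)
qed

section \<open>The map \<open>\<tau>\<^sub>0\<close>\<close>

text \<open>
  The quantity that is carried along the chain \<open>{} \<subseteq> {0} \<subseteq> {0, 1} \<subseteq> \<dots> \<subseteq> {..s}\<close> to compare the component of a
  total cycle in \<open>C\<^sup>0 \<otimes> D\<^sub>0\<close> with its component in \<open>C\<^sup>r \<otimes> D\<^sub>r\<close>.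
\<close>

definition initial_coef :: "'a cchain \<Rightarrow> nat \<Rightarrow> 'a wchain" where
  "initial_coef x n = kaps [0..<n] (cof (x {..<n}) (mon (-1) {..<n}))"

lemma tot_cycles0D:
  assumes "x \<in> tot_cycles0 s f"
  shows "J \<subseteq> {..s} \<Longrightarrow> x J \<in> loc_chains J (card J)" "\<not> J \<subseteq> {..s} \<Longrightarrow> x J = 0" "tot_diff s x J = 0"
proof -
  have x: "if J \<subseteq> {..s} then x J \<in> localization J (D_chains s f (card J)) else x J = 0"
    using assms unfolding tot_cycles0_def tot_chains0_def by blast
  show "x J \<in> loc_chains J (card J)" if "J \<subseteq> {..s}"
    using x that localization_eq[OF that] by (simp only: if_True)
  show "x J = 0" if "\<not> J \<subseteq> {..s}"
    using x that by (simp only: if_False)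
  have "tot_diff s x = 0"
    using assms unfolding tot_cycles0_def by blast
  then show "tot_diff s x J = 0"
    by (simp only: cchain_apply)
qed

text \<open>
  In the cycle equation at \<open>{..<n + 1}\<close>, the monomial with exponent \<open>-1\<close> in \<open>T\<^sub>0, \<dots>, T\<^bsub>n - 1\<^esub>\<close> has poles which only
  the component at \<open>{..<n}\<close> of the Cech part allows. In the other part \<open>\<Sum>\<^sub>l T\<^sub>l \<kappa>\<^sub>l\<close>, the terms with \<open>l < n\<close> are
  killed by \<open>\<kappa>\<^sub>0 \<dots> \<kappa>\<^bsub>n - 1\<^esub>\<close> and those with \<open>l > n\<close> have a forbidden pole, so \<open>l = n\<close> alone is left.
\<close>

lemma initial_coef_Suc:
  assumes x: "x \<in> tot_cycles0 s f" and n: "n \<le> s"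
  shows "initial_coef x n = initial_coef x (Suc n)"
proof -
  let ?J = "{..<Suc n}"
  let ?\<alpha> = "mon (-1) {..<n}"
  have J: "?J \<subseteq> {..s}"
    using n by auto
  have lk: "Poly_Mapping.lookup ?\<alpha> j = (if j < n then -1 else 0)" for j
    by (simp add: lookup_mon)
  have "cof (tot_diff s x ?J) ?\<alpha> = 0"
    using tot_cycles0D(3)[OF x] by (simp only: cof_zero)
  then have *: "(\<Sum>j\<in>?J. altsign (below ?J j) (cof (x (?J - {j})) ?\<alpha>))
      + altsign (Suc n) (cof (D_diff s (x ?J)) ?\<alpha>) = 0"
    by (simp only: tot_diff_def cchain_apply cof_add cof_cech_diff[OF J] cof_altsign card_lessThan)
  have z: "altsign (below ?J j) (cof (x (?J - {j})) ?\<alpha>) = 0" if j: "j \<in> {..<n}" for j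
  proof (rule ccontr)
    assume "\<not> ?thesis"
    then have nz: "cof (x (?J - {j})) ?\<alpha> \<noteq> 0"
      by (metis altsign_zero)
    have "x (?J - {j}) \<in> loc_chains (?J - {j}) (card (?J - {j}))"
      by (rule tot_cycles0D(1)[OF x]) (use J in auto)
    then have "mono_ok s (?J - {j}) ?\<alpha>"
      using nz by (rule loc_chains_mono)
    then have "0 \<le> Poly_Mapping.lookup ?\<alpha> j"
      unfolding mono_ok_def by blast
    then show False
      using j by (simp add: lk)
  qed
  have "(\<Sum>j\<in>?J. altsign (below ?J j) (cof (x (?J - {j})) ?\<alpha>))
      = (\<Sum>j\<in>{..<n}. altsign (below ?J j) (cof (x (?J - {j})) ?\<alpha>))
        + altsign (below ?J n) (cof (x (?J - {n})) ?\<alpha>)"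
    by (rule sum.lessThan_Suc)
  also have "(\<Sum>j\<in>{..<n}. altsign (below ?J j) (cof (x (?J - {j})) ?\<alpha>)) = 0"
    using z by (rule sum.neutral[rule_format])
  also have "?J - {n} = {..<n}"
    by auto
  also have "below ?J n = n"
  proof -
    have "{k \<in> ?J. k < n} = {..<n}"
      by auto
    then show ?thesis
      by (simp only: below_def card_lessThan)
  qed
  finally have "altsign n (cof (x {..<n}) ?\<alpha>) + altsign (Suc n) (cof (D_diff s (x ?J)) ?\<alpha>) = 0"
    using * by (simp only: add_0_left)
  then have "altsign n (cof (x {..<n}) ?\<alpha> - cof (D_diff s (x ?J)) ?\<alpha>) = 0"
    by (simp only: altsign_Suc altsign_diff add_uminus_conv_diff)
  then have eq: "cof (x {..<n}) ?\<alpha> = cof (D_diff s (x ?J)) ?\<alpha>"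
    by (simp only: altsign_eq_0_iff right_minus_eq)
  have xJ: "x ?J \<in> loc_chains ?J (card ?J)"
    by (rule tot_cycles0D(1)[OF x J])
  have z: "kaps [0..<n] (kap l (cof (x ?J) (?\<alpha> - Poly_Mapping.single l 1))) = 0" if l: "l \<in> {..s} - {n}" for l
  proof (cases "l < n")
    case True
    then show ?thesis
      by (intro kaps_kap_mem) simp
  next
    case False
    then have "n < l"
      using l by auto
    have "cof (x ?J) (?\<alpha> - Poly_Mapping.single l 1) = 0"
    proof (rule ccontr)
      assume "\<not> ?thesis"
      then have "mono_ok s ?J (?\<alpha> - Poly_Mapping.single l 1)"
        by (rule loc_chains_mono[OF xJ])
      moreover have "l \<notin> ?J"
        using \<open>n < l\<close> by simp
      ultimately have "0 \<le> Poly_Mapping.lookup (?\<alpha> - Poly_Mapping.single l 1) l"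
        unfolding mono_ok_def by blast
      then show False
        using \<open>n < l\<close> by (simp add: lookup_minus lk)
    qed
    then show ?thesis
      by (simp only: kap_zero kaps_zero)
  qed
  have "initial_coef x n = (\<Sum>l\<le>s. kaps [0..<n] (kap l (cof (x ?J) (?\<alpha> - Poly_Mapping.single l 1))))"
    by (simp only: initial_coef_def eq cof_D_diff[OF loc_chains_coef[OF xJ]] kaps_sum)
  also have "\<dots> = kaps [0..<n] (kap n (cof (x ?J) (?\<alpha> - Poly_Mapping.single n 1)))
      + (\<Sum>l\<in>{..s} - {n}. kaps [0..<n] (kap l (cof (x ?J) (?\<alpha> - Poly_Mapping.single l 1))))"
    by (rule sum.remove) (use n in auto)
  also have "(\<Sum>l\<in>{..s} - {n}. kaps [0..<n] (kap l (cof (x ?J) (?\<alpha> - Poly_Mapping.single l 1)))) = 0"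
    using z by (rule sum.neutral[rule_format])
  also have "?\<alpha> - Poly_Mapping.single n 1 = mon (-1) ?J"
    by (rule poly_mapping_eqI) (simp add: lookup_minus lookup_mon lookup_single when_def)
  also have "kaps [0..<n] (kap n (cof (x ?J) (mon (-1) ?J))) + 0 = initial_coef x (Suc n)"
    by (simp only: initial_coef_def upt_Suc le0 if_True kaps_append kaps_Cons kaps_Nil add_0_right)
  finally show ?thesis .
qed

lemma top_mon_1: "top_mon 1 = mon (-1) {..s}"
  by (rule poly_mapping_eqI) (simp add: lookup_top_mon lookup_mon)

lemma initial_coef_eq:
  assumes x: "x \<in> tot_cycles0 s f"
  shows "cof (x {}) 0 = kaps [0..<Suc s] (cof (x {..s}) (top_mon 1))"
proof -
  have "initial_coef x 0 = initial_coef x n" if "n \<le> Suc s" for n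
    using that by (induction n) (use initial_coef_Suc[OF x] in auto)
  then have "initial_coef x 0 = initial_coef x (Suc s)"
    by blast
  moreover have "mon (-1) {} = 0" "{..<0::nat} = {}"
    by (simp_all add: mon_def)
  ultimately show ?thesis
    by (simp only: initial_coef_def upt_0 kaps_Nil top_mon_1 lessThan_Suc_atMost)
qed

definition constant_chain :: "'a wchain \<Rightarrow> 'a dchain" where
  "constant_chain w = (\<lambda>M L. Poly_Mapping.single 0 (w M L))"

lemma cof_constant_chain: "cof (constant_chain w) \<alpha> = (if \<alpha> = 0 then w else 0)"
  by (simp add: cof_def constant_chain_def lookup_single when_def fun_eq_iff)

lemma constant_chainI:
  assumes x: "x \<in> loc_chains {} 0" and hom: "x \<in> T_homogeneous 0"
  shows "x = constant_chain (cof x 0)"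
proof (rule cof_eqI)
  fix \<alpha>
  show "cof x \<alpha> = cof (constant_chain (cof x 0)) \<alpha>"
  proof (cases "\<alpha> = 0")
    case False
    have "cof x \<alpha> = 0"
    proof (rule ccontr)
      assume nz: "cof x \<alpha> \<noteq> 0"
      have ok: "mono_ok s {} \<alpha>"
        by (rule loc_chains_mono[OF x nz])
      then have ge: "0 \<le> Poly_Mapping.lookup \<alpha> j" for j
        unfolding mono_ok_def by blast
      have "deg \<alpha> = 0"
        using hom nz unfolding T_homogeneous_iff[OF x] by simp
      moreover have "deg \<alpha> = (\<Sum>j\<le>s. Poly_Mapping.lookup \<alpha> j)"
        using ok unfolding mono_ok_def by (intro deg_atMost) blast
      ultimately have "\<forall>j\<in>{..s}. Poly_Mapping.lookup \<alpha> j = 0"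
        using sum_nonneg_eq_0_iff[of "{..s}" "Poly_Mapping.lookup \<alpha>"] ge by simp
      then have "Poly_Mapping.lookup \<alpha> j = 0" for j
        using ok unfolding mono_ok_def by (cases "j \<le> s") simp_all
      then have "\<alpha> = 0"
        by (intro poly_mapping_eqI) simp
      with False show False ..
    qed
    with False show ?thesis
      by (simp only: cof_constant_chain if_False)
  qed (simp only: cof_constant_chain simp_thms if_True)
qed

lemma kaps_coboundary:
  assumes "l \<le> s"
  shows "kaps [0..<Suc s] (kap l w) = 0"
  by (rule kaps_kap_mem) (use assms in auto)

lemma neg_deg_top:
  assumes "neg s \<alpha>" "deg \<alpha> = - int (Suc s)"
  shows "\<alpha> = top_mon 1"
proof -
  have "deg \<alpha> = (\<Sum>j\<le>s. Poly_Mapping.lookup \<alpha> j)"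
    using assms(1) unfolding neg_def by (intro deg_atMost) blast
  then have "(\<Sum>j\<le>s. - 1 - Poly_Mapping.lookup \<alpha> j) = 0"
    using assms(2) by (simp add: sum_subtractf)
  moreover have "0 \<le> - 1 - Poly_Mapping.lookup \<alpha> j" if "j \<in> {..s}" for j
  proof -
    have "Poly_Mapping.lookup \<alpha> j < 0"
      using assms(1) that unfolding neg_def by blast
    then show ?thesis
      by linarith
  qed
  ultimately have "\<forall>j\<in>{..s}. - 1 - Poly_Mapping.lookup \<alpha> j = 0"
    using sum_nonneg_eq_0_iff[of "{..s}" "\<lambda>j. - 1 - Poly_Mapping.lookup \<alpha> j"] by simp
  then have "Poly_Mapping.lookup \<alpha> j = - 1" if "j \<le> s" for j
    using that by force
  then show ?thesis
    using assms(1) unfolding neg_def by (intro poly_mapping_eqI) (simp add: lookup_top_mon)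
qed

text \<open>
  The exponent of the sign of the component at \<open>J\<close> in the total cycle below. The cycle
  equation forces the recursion \<open>cycle_sign_remove\<close> modulo \<open>2\<close>.
\<close>

definition cycle_sign :: "nat set \<Rightarrow> nat" where
  "cycle_sign J = \<Sum>J + (card J choose 2)"

lemma cycle_sign_remove:
  assumes "finite J" "j \<in> J"
  shows "cycle_sign J = cycle_sign (J - {j}) + j + card (J - {j})"
proof -
  have "card J = Suc (card (J - {j}))"
    by (rule card.remove[OF assms])
  moreover have "Suc n choose 2 = n + (n choose 2)" for n
    by (simp add: numeral_2_eq_2)
  ultimately have "card J choose 2 = card (J - {j}) + (card (J - {j}) choose 2)"
    by metis
  moreover have "\<Sum>J = j + \<Sum>(J - {j})"
    by (rule sum.remove[OF assms])
  ultimately show ?thesis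
    by (simp only: cycle_sign_def)
qed

lemma even_cycle_sign_atMost: "even (cycle_sign {..s})"
proof -
  have "\<Sum>{..n} = (Suc n choose 2)" for n :: nat
    by (induction n) (simp_all add: numeral_2_eq_2)
  then show ?thesis
    by (simp add: cycle_sign_def)
qed

text \<open>
  The total cycle with components \<open>\<plusminus> (\<Prod>\<^sub>j\<^sub>\<in>\<^sub>J T\<^sub>j\<^sup>-\<^sup>1) \<kappa>\<^bsub>J'\<^esub> w\<close>, where \<open>J'\<close> is the complement of \<open>J\<close>. It lifts an
  arbitrary class \<open>w (T\<^sub>0 \<dots> T\<^sub>s)\<^sup>-\<^sup>1\<close> of \<open>H\<^sup>r(D\<^sub>r)\<close> in degree \<open>0\<close>.
\<close>

definition lift_cycle :: "'a wchain \<Rightarrow> 'a cchain" where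
  "lift_cycle w = (\<lambda>J. if J \<subseteq> {..s} then \<lambda>M L. Poly_Mapping.single (mon (-1) J)
     (altsign (cycle_sign J) (kaps (sorted_list_of_set ({..s} - J)) w) M L) else 0)"

lemma cof_lift_cycle:
  assumes "J \<subseteq> {..s}"
  shows "cof (lift_cycle w J) \<alpha> =
    (if \<alpha> = mon (-1) J then altsign (cycle_sign J) (kaps (sorted_list_of_set ({..s} - J)) w) else 0)"
  using assms by (auto simp: cof_def lift_cycle_def lookup_single when_def fun_eq_iff)

lemma lift_cycle_loc:
  assumes w: "w \<in> coef_module s f (Suc s)" and J: "J \<subseteq> {..s}"
  shows "lift_cycle w J \<in> loc_chains J (card J)" "lift_cycle w J \<in> T_homogeneous 0"
proof -
  have fin: "finite J"
    using J finite_subset by blast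
  show loc: "lift_cycle w J \<in> loc_chains J (card J)"
  proof (rule loc_chainsI)
    fix \<alpha>
    have "card J + card ({..s} - J) = Suc s"
      using J fin by (simp add: card_Diff_subset card_mono)
        (metis card_atMost card_mono finite_atMost le_add_diff_inverse)
    then have "kaps (sorted_list_of_set ({..s} - J)) w \<in> coef_module s f (card J)"
      by (intro coef_module_kaps) (simp add: w)
    then show "cof (lift_cycle w J) \<alpha> \<in> coef_module s f (card J)"
      by (cases "\<alpha> = mon (-1) J")
        (simp_all only: cof_lift_cycle[OF J] simp_thms if_True if_False coef_module_zero coef_module_altsign)
    assume "cof (lift_cycle w J) \<alpha> \<noteq> 0"
    then have "\<alpha> = mon (-1) J"
      unfolding cof_lift_cycle[OF J] by presburger
    then show "mono_ok s J \<alpha>"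
      using J by (auto simp: mono_ok_def lookup_mon[OF fin])
  qed
  have "deg (mon (-1) J) = - int (card J)"
  proof -
    have "deg (mon (-1) J) = (\<Sum>j\<in>J. Poly_Mapping.lookup (mon (-1) J) j)"
      by (rule deg_eq_sum[OF fin]) (auto simp: in_keys_iff lookup_mon[OF fin] split: if_splits)
    also have "\<dots> = (\<Sum>j\<in>J. -1)"
      by (rule sum.cong) (simp_all add: lookup_mon[OF fin])
    finally show ?thesis
      by simp
  qed
  moreover have "\<alpha> = mon (-1) J" if "cof (lift_cycle w J) \<alpha> \<noteq> 0" for \<alpha>
    using that unfolding cof_lift_cycle[OF J] by presburger
  ultimately show "lift_cycle w J \<in> T_homogeneous 0"
    unfolding T_homogeneous_iff[OF loc] by blast
qed

text \<open>
  In \<open>\<Sum>\<^sub>l T\<^sub>l \<kappa>\<^sub>l\<close> applied to the component at \<open>J\<close>, the terms with \<open>l \<notin> J\<close> vanish because \<open>\<kappa>\<^sub>l\<close> already occurs in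
  \<open>\<kappa>\<^bsub>J'\<^esub>\<close>, and the term with \<open>l \<in> J\<close> is, up to sign, the component at \<open>J - {l}\<close>. The Cech differential is
  the sum of the same terms.
\<close>

lemma lift_cycle_tot_cycle:
  assumes w: "w \<in> coef_module s f (Suc s)"
  shows "lift_cycle w \<in> tot_cycles0 s f \<inter> T_homogeneous_C 0"
proof -
  let ?x = "lift_cycle w"
  have out: "?x J = 0" if "\<not> J \<subseteq> {..s}" for J
    using that by (simp only: lift_cycle_def if_False)
  have zT: "(0 :: 'a dchain) \<in> T_homogeneous 0"
    by (simp add: T_homogeneous_def)
  have "?x J \<in> T_homogeneous 0" for J
    using lift_cycle_loc(2)[OF w] out zT by metis
  then have hom: "?x \<in> T_homogeneous_C 0"
    unfolding T_homogeneous_C_def by blast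
  have "if J \<subseteq> {..s} then ?x J \<in> localization J (D_chains s f (card J)) else ?x J = 0" for J
    by (cases "J \<subseteq> {..s}") (simp_all only: localization_eq lift_cycle_loc(1)[OF w] out if_True if_False not_False_eq_True)
  then have tot: "?x \<in> tot_chains0 s f"
    unfolding tot_chains0_def by blast
  have "tot_diff s ?x J = 0" for J
  proof (cases "J \<subseteq> {..s}")
    case False
    then show ?thesis
      by (simp only: tot_diff_def cchain_apply cech_diff_def if_False out D_diff_zero altsign_zero add_0_right not_False_eq_True)
  next
    case J: True
    have fin: "finite J"
      using J finite_subset by blast
    show ?thesis
    proof (rule cof_eqI)
      fix \<alpha>
      define t where "t = (\<lambda>l. kap l (cof (?x J) (\<alpha> - Poly_Mapping.single l 1)))"
      have t0: "t l = 0" if "l \<in> {..s} - J" for l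
      proof -
        have "l \<in> set (sorted_list_of_set ({..s} - J))"
          using that by simp
        then have "kap l (altsign (cycle_sign J) (kaps (sorted_list_of_set ({..s} - J)) w)) = 0"
          by (simp only: kap_altsign kap_kaps_mem altsign_zero)
        then show ?thesis
          unfolding t_def cof_lift_cycle[OF J]
          by (cases "\<alpha> - Poly_Mapping.single l 1 = mon (-1) J") (simp_all only: simp_thms if_True if_False kap_zero)
      qed
      have "cof (tot_diff s ?x J) \<alpha> = (\<Sum>j\<in>J. altsign (below J j) (cof (?x (J - {j})) \<alpha>))
          + altsign (card J) (\<Sum>l\<le>s. t l)"
        by (simp only: tot_diff_def cchain_apply cof_add cof_cech_diff[OF J] cof_altsign
            cof_D_diff[OF loc_chains_coef[OF lift_cycle_loc(1)[OF w J]]] t_def)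
      also have "(\<Sum>l\<le>s. t l) = (\<Sum>l\<in>J. t l)"
        using t0 by (intro sum.mono_neutral_right J) auto
      also have "(\<Sum>j\<in>J. altsign (below J j) (cof (?x (J - {j})) \<alpha>)) + altsign (card J) (\<Sum>l\<in>J. t l)
          = (\<Sum>j\<in>J. altsign (below J j) (cof (?x (J - {j})) \<alpha>) + altsign (card J) (t j))"
        by (simp only: altsign_sum sum.distrib)
      also have "\<dots> = 0"
      proof (rule sum.neutral[rule_format])
        fix l assume l: "l \<in> J"
        define K where "K = kaps (sorted_list_of_set ({..s} - (J - {l}))) w"
        have lJ: "J - {l} \<subseteq> {..s}" and ls: "l \<le> s"
          using J l by auto
        have "J = insert l (J - {l})"
          using l by auto
        then have "mon (-1) J = Poly_Mapping.single l (-1) + mon (-1) (J - {l})"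
          using mon_insert[of "J - {l}" l "-1"] fin by simp
        then have shift: "\<alpha> - Poly_Mapping.single l 1 = mon (-1) J \<longleftrightarrow> \<alpha> = mon (-1) (J - {l})"
          by (auto simp: single_uminus algebra_simps)
        have "insert l ({..s} - J) = {..s} - (J - {l})"
          using ls l by auto
        then have "insort l (sorted_list_of_set ({..s} - J)) = sorted_list_of_set ({..s} - (J - {l}))"
          using l sorted_list_of_set_insert[of "{..s} - J" l] by simp
        then have k: "kap l (kaps (sorted_list_of_set ({..s} - J)) w) = altsign (below ({..s} - J) l) K"
          using kap_kaps_insort[of "sorted_list_of_set ({..s} - J)" l w] l by (simp add: K_def)
        show "altsign (below J l) (cof (?x (J - {l})) \<alpha>) + altsign (card J) (t l) = 0"
        proof (cases "\<alpha> = mon (-1) (J - {l})")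
          case True
          have 1: "cof (?x (J - {l})) \<alpha> = altsign (cycle_sign (J - {l})) K"
            by (simp only: cof_lift_cycle[OF lJ] True simp_thms if_True K_def)
          have 2: "t l = altsign (cycle_sign J) (altsign (below ({..s} - J) l) K)"
            unfolding t_def cof_lift_cycle[OF J] shift using True by (simp only: simp_thms if_True kap_altsign k)
          have "odd ((below J l + cycle_sign (J - {l}))
              + (card J + (cycle_sign J + below ({..s} - J) l)))"
            using cycle_sign_remove[OF fin l] below_complement[OF ls J] card.remove[OF fin l]
            by presburger
          then show ?thesis
            unfolding 1 2 altsign_altsign by (rule altsign_cancel)
        next
          case False
          then have "t l = 0" "cof (?x (J - {l})) \<alpha> = 0"
            unfolding t_def cof_lift_cycle[OF J] cof_lift_cycle[OF lJ] shift by (simp_all only: if_False kap_zero)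
          then show ?thesis
            by (simp only: altsign_zero add_0_right)
        qed
      qed
      finally show "cof (tot_diff s ?x J) \<alpha> = cof 0 \<alpha>"
        by (simp only: cof_zero)
    qed
  qed
  then have "tot_diff s ?x = 0"
    by (intro ext) (simp only: cchain_apply)
  then show ?thesis
    using tot hom unfolding tot_cycles0_def by blast
qed

lemma top_component_cech:
  assumes x: "x \<in> tot_cycles0 s f"
  shows "top_component s x \<in> cech_chains (Suc s) (Suc s)" "top_component s x {..s} = x {..s}"
proof -
  show top: "top_component s x {..s} = x {..s}"
    by (simp add: top_component_def)
  show "top_component s x \<in> cech_chains (Suc s) (Suc s)"
  proof (rule cech_chainsI)
    fix J
    show "top_component s x J \<in> loc_chains J (Suc s)" if "J \<subseteq> {..s}" "card J = Suc s"
      using tot_cycles0D(1)[OF x that(1)] that(2) by (simp add: top_component_def)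
    show "top_component s x J = 0" if "\<not> (J \<subseteq> {..s} \<and> card J = Suc s)"
    proof (cases "card J = s + 1")
      case True
      then have "x J = 0"
        using that tot_cycles0D(2)[OF x, of J] by simp
      then show ?thesis
        by (simp only: top_component_def if_cancel)
    qed (simp only: top_component_def if_False)
  qed
qed

text \<open>
  The invariance of \<open>initial_coef\<close> determines the value on every total cycle that lifts the class, and
  \<open>lift_cycle\<close> provides one. Boundaries from \<open>H\<^sup>r(D\<^bsub>r + 1\<^esub>)\<close> do not matter because
  \<open>\<kappa>\<^sub>0 \<dots> \<kappa>\<^sub>s (\<Sum>\<^sub>l T\<^sub>l \<kappa>\<^sub>l) = 0\<close>.
\<close>

lemma tau0_cls:
  assumes c: "c \<in> top_chains (Suc s)"
  shows "tau0 s f (cls (Suc s) c) = constant_chain (kaps [0..<Suc s] (neg_part c (top_mon 1)))"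
proof -
  define C where "C = (\<lambda>y J. D_diff s (y J)) ` top_chains (Suc (Suc s))"
  have Csub: "C \<subseteq> top_chains (Suc s)"
    unfolding C_def using D_diff_top_chains by blast
  have "Zplus_diff s f 2 ` carrier (Zplus s f 2) = cls (Suc s) ` C"
  proof -
    have "Zplus_diff s f 2 ` carrier (Zplus s f 2)
        = (\<lambda>y. Zplus_diff s f 2 (cls (2 + s) y)) ` top_chains (Suc (Suc s))"
      using presents_carrier[OF Zplus_presents[of 2]] by (simp add: image_image)
    also have "\<dots> = (\<lambda>y. cls (Suc s) (\<lambda>J. D_diff s (y J))) ` top_chains (Suc (Suc s))"
      using Zplus_diff_cls[of _ 1] top_chains_cech by (intro image_cong) (auto simp: numeral_2_eq_2)
    finally show ?thesis
      by (simp add: C_def image_image)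
  qed
  moreover have "cls (Suc s) ` C +>\<^bsub>Zplus s f 1\<^esub> cls (Suc s) c = (\<lambda>d. cls (Suc s) (d + c)) ` C"
    using presents_coset[OF Zplus_presents[of 1]] Csub c by simp
  ultimately have coset: "(Zplus_diff s f 2 ` carrier (Zplus s f 2)) +>\<^bsub>Zplus s f 1\<^esub> cls (Suc s) c
      = (\<lambda>d. cls (Suc s) (d + c)) ` C"
    by simp
  let ?P = "\<lambda>z. \<exists>x \<in> tot_cycles0 s f \<inter> T_homogeneous_C 0.
        cls (s + 1) (top_component s x) \<in> (\<lambda>d. cls (Suc s) (d + c)) ` C \<and> z = x {}"
  have tau: "tau0 s f (cls (Suc s) c) = (THE z. ?P z)"
    unfolding tau0_def coset ..
  have uniq: "x {} = constant_chain (kaps [0..<Suc s] (neg_part c (top_mon 1)))"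
    if x: "x \<in> tot_cycles0 s f" "x \<in> T_homogeneous_C 0"
      and d: "d \<in> C" "cls (Suc s) (top_component s x) = cls (Suc s) (d + c)" for x d
  proof -
    note top = top_component_cech[OF x(1)]
    have dt: "d \<in> top_chains (Suc s)"
      using d Csub by blast
    obtain y where y: "y \<in> top_chains (Suc (Suc s))" "d = (\<lambda>J. D_diff s (y J))"
      using d unfolding C_def by blast
    have dc: "d + c \<in> cech_chains (Suc s) (Suc s)"
      using presents_plus[OF cech_presents] top_chains_cech dt c by blast
    have negeq: "neg_part (top_component s x) = neg_part (d + c)"
    proof -
      have "top_component s x \<in> cls (Suc s) (d + c)"
        using cls_self[OF top(1)] d(2) by simp
      then show ?thesis
        by (rule cls_memD(2)[OF dc])
    qed
    have neg1: "neg s (top_mon 1)"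
      by (rule neg_top_mon) simp
    have "cof (x {..s}) (top_mon 1) = neg_part (top_component s x) (top_mon 1)"
      by (simp only: neg_part_def neg1 if_True top(2))
    also have "\<dots> = neg_part d (top_mon 1) + neg_part c (top_mon 1)"
      unfolding negeq by (simp only: neg_part_def neg1 if_True cchain_apply cof_add)
    finally have "cof (x {}) 0 = kaps [0..<Suc s] (neg_part d (top_mon 1)) + kaps [0..<Suc s] (neg_part c (top_mon 1))"
      by (simp only: initial_coef_eq[OF x(1)] kaps_add)
    also have "kaps [0..<Suc s] (neg_part d (top_mon 1)) = 0"
    proof -
      have "kaps [0..<Suc s] (kap l (neg_part y (top_mon 1 - Poly_Mapping.single l 1))) = 0" if "l \<in> {..s}" for l
        using that by (intro kaps_coboundary) simp
      then have "(\<Sum>l\<le>s. kaps [0..<Suc s] (kap l (neg_part y (top_mon 1 - Poly_Mapping.single l 1)))) = 0"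
        by (rule sum.neutral[rule_format])
      then show ?thesis
        by (simp only: y(2) neg_part_D_diff[where c = y, OF top_chains_loc[OF y(1)]] Dinv_def neg1 if_True kaps_sum)
    qed
    finally have "cof (x {}) 0 = kaps [0..<Suc s] (neg_part c (top_mon 1))"
      by (simp only: add_0_left)
    moreover have "x {} \<in> loc_chains {} 0"
      using tot_cycles0D(1)[OF x(1), of "{}"] by simp
    moreover have "x {} \<in> T_homogeneous 0"
      using x(2) unfolding T_homogeneous_C_def by blast
    ultimately show ?thesis
      using constant_chainI by metis
  qed
  define w where "w = neg_part c (top_mon 1)"
  have w: "w \<in> coef_module s f (Suc s)"
    unfolding w_def by (rule inv_chains_coef[OF neg_part_inv_chains[OF c]])
  let ?x = "lift_cycle w"
  have x: "?x \<in> tot_cycles0 s f" "?x \<in> T_homogeneous_C 0"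
    using lift_cycle_tot_cycle[OF w] by blast+
  have "neg_part (top_component s ?x) = neg_part c"
  proof
    fix \<alpha>
    show "neg_part (top_component s ?x) \<alpha> = neg_part c \<alpha>"
    proof (cases "\<alpha> = top_mon 1")
      case True
      have "cof (?x {..s}) (top_mon 1)
          = altsign (cycle_sign {..s}) (kaps (sorted_list_of_set ({..s} - {..s})) w)"
        by (simp only: cof_lift_cycle[OF order_refl] top_mon_1 simp_thms if_True)
      also have "\<dots> = w"
        using even_cycle_sign_atMost by (simp add: altsign_def)
      finally have cw: "cof (?x {..s}) (top_mon 1) = w" .
      have n1: "neg s (top_mon 1)"
        by (rule neg_top_mon) simp
      have "neg_part (top_component s ?x) (top_mon 1) = w"
        by (simp only: neg_part_def[of "top_component s ?x"] n1 if_True top_component_cech(2)[OF x(1)] cw)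
      then show ?thesis
        unfolding True w_def .
    next
      case False
      have "neg_part c \<alpha> = 0"
        using neg_deg_top[of \<alpha>] inv_chains_supp[OF neg_part_inv_chains[OF c], of \<alpha>] False by blast
      moreover have "cof (?x {..s}) \<alpha> = 0"
        using False by (simp only: cof_lift_cycle[OF order_refl] top_mon_1[symmetric] if_False)
      ultimately show ?thesis
        by (simp only: neg_part_def[of "top_component s ?x"] top_component_cech(2)[OF x(1)] if_cancel)
    qed
  qed
  then have cl: "cls (Suc s) (top_component s ?x) = cls (Suc s) c"
    by (intro cls_eqI top_component_cech[OF x(1)] top_chains_cech[OF c])
  have "0 \<in> C"
  proof -
    have "(\<lambda>J. D_diff s ((0 :: 'a cchain) J)) = 0"
      by (rule ext) (simp only: cchain_apply D_diff_zero)
    then show ?thesis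
      unfolding C_def using top_chains_closed(1)[of "Suc (Suc s)"] by (metis imageI)
  qed
  then have mem: "cls (s + 1) (top_component s ?x) \<in> (\<lambda>d. cls (Suc s) (d + c)) ` C"
    using cl \<open>0 \<in> C\<close> by (intro image_eqI[of _ _ 0]) (simp_all only: add_0_left Suc_eq_plus1)
  have xw: "?x {} = constant_chain (kaps [0..<Suc s] (neg_part c (top_mon 1)))"
    by (rule uniq[OF x \<open>0 \<in> C\<close>]) (simp only: cl add_0_left)
  show ?thesis
    unfolding tau
  proof (rule the_equality)
    show "?P (constant_chain (kaps [0..<Suc s] (neg_part c (top_mon 1))))"
      using x mem xw by (intro bexI[of _ ?x]) simp_all
  next
    fix z assume "?P z"
    then obtain x d where "x \<in> tot_cycles0 s f" "x \<in> T_homogeneous_C 0" "d \<in> C"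
      "cls (s + 1) (top_component s x) = cls (Suc s) (d + c)" and z: "z = x {}"
      by blast
    then have "x {} = constant_chain (kaps [0..<Suc s] (neg_part c (top_mon 1)))"
      by (intro uniq) (simp_all only: Suc_eq_plus1)
    with z show "z = constant_chain (kaps [0..<Suc s] (neg_part c (top_mon 1)))"
      by (simp only:)
  qed
qed

end

section \<open>The Koszul complex of \<open>a\<close>\<close>

definition kscale :: "'a::comm_ring_1 \<Rightarrow> (nat set \<Rightarrow> 'a) \<Rightarrow> nat set \<Rightarrow> 'a" where
  "kscale r c = (\<lambda>K. r * c K)"

lemma kscale_diff: "kscale r (c - d) = kscale r c - kscale r d"
  by (simp add: kscale_def fun_eq_iff right_diff_distrib)

text \<open>
  The Koszul differential of \<open>f\<^sub>0, \<dots>, f\<^sub>s\<close>. The chains on \<open>{1..s}\<close> are those killed by \<open>del 0\<close>, and on these it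
  is the differential of \<open>f\<^sub>1, \<dots>, f\<^sub>s\<close>; one operator thus serves both complexes.
\<close>

definition kdiff :: "nat \<Rightarrow> (nat \<Rightarrow> 'a::comm_ring_1) \<Rightarrow> (nat set \<Rightarrow> 'a) \<Rightarrow> nat set \<Rightarrow> 'a" where
  "kdiff s f c = (\<lambda>K. \<Sum>l\<le>s. f l * del l c K)"

lemma kdiff_diff: "kdiff s f (c - d) = kdiff s f c - kdiff s f d"
  by (simp add: kdiff_def fun_eq_iff del_diff right_diff_distrib sum_subtractf)

lemma kdiff_kscale: "kdiff s f (kscale r c) = kscale r (kdiff s f c)"
  by (simp add: kdiff_def kscale_def fun_eq_iff del_scale sum_distrib_left mult.left_commute)

lemma kdiff_kdiff: "kdiff s f (kdiff s f c) = 0"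
proof
  fix K
  have d: "del l (kdiff s f c) K = (\<Sum>k\<le>s. f k * del l (del k c) K)" for l
    by (simp add: kdiff_def del_def[of l] altsign_sum altsign_mult)
  define g where "g = (\<lambda>l k. f l * f k * del l (del k c) K)"
  have "kdiff s f (kdiff s f c) K = (\<Sum>l\<le>s. \<Sum>k\<le>s. g l k)"
    unfolding kdiff_def[of s f "kdiff s f c"] d g_def by (simp only: sum_distrib_left mult.assoc)
  also have "\<dots> = 0"
  proof (rule sum_antisymmetric)
    fix k l
    have "del k (del l c) K = - del l (del k c) K"
      using del_del[of k l c] by simp
    then show "g k l = - g l k"
      by (simp add: g_def mult.commute)
    show "g l l = 0"
      by (simp add: g_def)
  qed
  finally show "kdiff s f (kdiff s f c) K = 0 K"
    by simp
qed

lemma kdiff_chains: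
  assumes "c \<in> koszul_chains {..s} (Suc p)"
  shows "kdiff s f c \<in> koszul_chains {..s} p"
proof (rule koszul_chainsI)
  fix K assume nz: "kdiff s f c K \<noteq> 0"
  have "\<exists>l\<in>{..s}. f l * del l c K \<noteq> 0"
  proof (rule ccontr)
    assume "\<not> ?thesis"
    then have "(\<Sum>l\<le>s. f l * del l c K) = 0"
      by (intro sum.neutral) blast
    with nz show False
      by (simp add: kdiff_def)
  qed
  then obtain l where "f l * del l c K \<noteq> 0"
    by blast
  then have "del l c K \<noteq> 0"
    by auto
  then show "K \<subseteq> {..s} \<and> card K = p"
    using koszul_chainsD[OF koszul_chains_del[OF finite_atMost assms]] by blast
qed

lemma koszul_cycles_kdiff: "c \<in> koszul_cycles {..s} f p \<longleftrightarrow> c \<in> koszul_chains {..s} p \<and> kdiff s f c = 0"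
  by (simp add: koszul_cycles_iff kdiff_def fun_eq_iff)

lemma del_0_zero_iff:
  "c \<in> koszul_chains {1..s} p \<longleftrightarrow> c \<in> koszul_chains {..s} p \<and> del 0 c = 0"
proof
  assume c: "c \<in> koszul_chains {1..s} p"
  have "c \<in> koszul_chains {..s} p"
    by (rule koszul_chainsI) (use koszul_chainsD[OF c] in force)
  moreover have "del 0 c = 0"
  proof
    fix K
    have "\<not> insert 0 K \<subseteq> {1..s}"
      by auto
    then have "c (insert 0 K) = 0"
      using koszul_chainsD[OF c] by blast
    then show "del 0 c K = 0 K"
      by (simp add: del_def)
  qed
  ultimately show "c \<in> koszul_chains {..s} p \<and> del 0 c = 0" ..
next
  assume c: "c \<in> koszul_chains {..s} p \<and> del 0 c = 0"
  show "c \<in> koszul_chains {1..s} p"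
  proof (rule koszul_chainsI)
    fix K assume nz: "c K \<noteq> 0"
    have "0 \<notin> K"
    proof
      assume "0 \<in> K"
      then have "del 0 c (K - {0}) = altsign (below (K - {0}) 0) (c K)"
        by (simp add: del_def insert_absorb)
      moreover have "del 0 c (K - {0}) = 0"
        using c by simp
      ultimately show False
        using nz by simp
    qed
    moreover have "K \<subseteq> {..s} \<and> card K = p"
      using c koszul_chainsD nz by blast
    moreover have "{..s} - {0} \<subseteq> {1..s}"
      by auto
    ultimately show "K \<subseteq> {1..s} \<and> card K = p"
      by blast
  qed
qed

lemma koszul_diff_eq_kdiff:
  assumes "c \<in> koszul_chains {1..s} p"
  shows "koszul_diff {1..s} (\<lambda>l v. f l * v) c = kdiff s f c"
proof -
  have "del 0 c = 0"
    using assms del_0_zero_iff by blast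
  have "(\<Sum>l\<in>{1..s}. f l * del l c K) = (\<Sum>l\<le>s. f l * del l c K)" for K
  proof (rule sum.mono_neutral_left)
    have "l = 0" if "l \<in> {..s} - {1..s}" for l
      using that by auto
    moreover have "f 0 * del 0 c K = 0"
      using \<open>del 0 c = 0\<close> by simp
    ultimately show "\<forall>l\<in>{..s} - {1..s}. f l * del l c K = 0"
      by blast
  qed auto
  then show ?thesis
    unfolding koszul_diff_mult_eq[OF finite_atLeastAtMost assms] kdiff_def by simp
qed

text \<open>
  The cycles of \<open>a\<close> are the cycles of the complex of the \<open>Z\<^sub>i(f)\<close> with differential \<open>del 0\<close>.
\<close>

lemma koszul_cycles_a_iff:
  "v \<in> koszul_cycles {1..s} f i \<longleftrightarrow> v \<in> koszul_cycles {..s} f i \<and> del 0 v = 0"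
proof -
  have "v \<in> koszul_cycles {1..s} f i \<longleftrightarrow> v \<in> koszul_chains {1..s} i \<and> kdiff s f v = 0"
    unfolding koszul_cycles_def using koszul_diff_eq_kdiff[of v s i f] by auto
  then show ?thesis
    using koszul_cycles_kdiff[of v s f i] del_0_zero_iff[of v s i] by blast
qed

lemma kdiff_a_chains:
  assumes "c \<in> koszul_chains {1..s} (Suc p)"
  shows "kdiff s f c \<in> koszul_cycles {1..s} f p"
proof -
  have c: "c \<in> koszul_chains {..s} (Suc p)" "del 0 c = 0"
    using assms del_0_zero_iff by blast+
  have "del 0 (kdiff s f c) = 0"
  proof
    fix K
    have "del 0 (kdiff s f c) K = (\<Sum>k\<le>s. f k * del 0 (del k c) K)"
      by (simp add: kdiff_def del_def[of 0] altsign_sum altsign_mult)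
    also have "\<dots> = 0"
    proof (rule sum.neutral, rule ballI)
      fix k
      have "del 0 (del k c) = - del k (del 0 c)"
        by (rule del_del)
      also have "\<dots> = 0"
        unfolding c(2) by simp
      finally show "f k * del 0 (del k c) K = 0"
        by simp
    qed
    finally show "del 0 (kdiff s f c) K = 0 K"
      by simp
  qed
  then show ?thesis
    unfolding koszul_cycles_a_iff koszul_cycles_kdiff using kdiff_chains[OF c(1)] kdiff_kdiff by blast
qed

definition koszul_boundaries :: "nat \<Rightarrow> (nat \<Rightarrow> 'a::comm_ring_1) \<Rightarrow> nat \<Rightarrow> (nat set \<Rightarrow> 'a) set" where
  "koszul_boundaries s f p = kdiff s f ` koszul_chains {1..s} (Suc p)"

lemma koszul_module_presents:
  "presents kscale (koszul_chains N p) {0} (\<lambda>x. x) (koszul_module N p)"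
proof -
  have eq: "koszul_module N p = module_on kscale (koszul_chains N p)"
    by (simp only: koszul_module_def kscale_def[abs_def])
  have sc: "kscale r c \<in> koszul_chains N p" if "c \<in> koszul_chains N p" for r :: 'a and c
    unfolding kscale_def by (rule koszul_chains_scale[OF that])
  show ?thesis
    unfolding eq by (intro presents_module_on kscale_diff koszul_chains_zero koszul_chains_diff sc)
qed

lemma koszul_boundaries_submodule:
  "koszul_boundaries s f p \<subseteq> koszul_cycles {1..s} f p" "0 \<in> koszul_boundaries s f p"
  "x \<in> koszul_boundaries s f p \<Longrightarrow> y \<in> koszul_boundaries s f p \<Longrightarrow> x - y \<in> koszul_boundaries s f p"
  "x \<in> koszul_boundaries s f p \<Longrightarrow> kscale r x \<in> koszul_boundaries s f p"
proof -
  show "koszul_boundaries s f p \<subseteq> koszul_cycles {1..s} f p"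
    unfolding koszul_boundaries_def using kdiff_a_chains by blast
  have "kdiff s f 0 = 0"
    using kdiff_diff[of s f 0 0] by simp
  then show "0 \<in> koszul_boundaries s f p"
    unfolding koszul_boundaries_def using koszul_chains_zero by (metis image_eqI)
  show "x - y \<in> koszul_boundaries s f p" if xy: "x \<in> koszul_boundaries s f p" "y \<in> koszul_boundaries s f p"
  proof -
    obtain u v where uv: "u \<in> koszul_chains {1..s} (Suc p)" "x = kdiff s f u"
        "v \<in> koszul_chains {1..s} (Suc p)" "y = kdiff s f v"
      using xy unfolding koszul_boundaries_def by blast
    then have "x - y = kdiff s f (u - v)"
      by (simp only: kdiff_diff)
    then show ?thesis
      unfolding koszul_boundaries_def using koszul_chains_diff[OF uv(1,3)] by (rule image_eqI)
  qed
  show "kscale r x \<in> koszul_boundaries s f p" if x: "x \<in> koszul_boundaries s f p"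
  proof -
    obtain u where u: "u \<in> koszul_chains {1..s} (Suc p)" "x = kdiff s f u"
      using x unfolding koszul_boundaries_def by blast
    then have "kscale r x = kdiff s f (kscale r u)"
      by (simp only: kdiff_kscale)
    moreover have "kscale r u \<in> koszul_chains {1..s} (Suc p)"
      unfolding kscale_def by (rule koszul_chains_scale[OF u(1)])
    ultimately show ?thesis
      unfolding koszul_boundaries_def by (rule image_eqI)
  qed
qed

lemma koszul_cycles_module_presents:
  "presents kscale (koszul_cycles {1..s} f p) {0} (\<lambda>x. x)
     ((koszul_module {1..s} p)\<lparr>carrier := koszul_cycles {1..s} f p\<rparr>)"
proof (rule presents_restrict[OF koszul_module_presents])
  show "koszul_cycles {1..s} f p \<subseteq> koszul_chains {1..s} p"
    unfolding koszul_cycles_def by blast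
  show "0 \<in> koszul_cycles {1..s} f p"
    by (simp add: koszul_cycles_zero)
  show "x - y \<in> koszul_cycles {1..s} f p" if "x \<in> koszul_cycles {1..s} f p" "y \<in> koszul_cycles {1..s} f p" for x y
    using that by (simp add: koszul_cycles_diff)
  show "kscale r x \<in> koszul_cycles {1..s} f p" if "x \<in> koszul_cycles {1..s} f p" for r x
    unfolding kscale_def using that by (simp add: koszul_cycles_scale)
qed simp_all

lemma koszul_homology_eq:
  "koszul_homology {1..s} f (Suc i) =
     quotient_module ((koszul_module {1..s} (Suc i))\<lparr>carrier := koszul_cycles {1..s} f (Suc i)\<rparr>)
       (koszul_boundaries s f (Suc i))"
proof -
  let ?d = "koszul_diff {1..s} (\<lambda>l v. f l * v)"
  have carr: "carrier (koszul_module {1..s} p) = koszul_chains {1..s} p" for p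
    using presents_carrier[OF koszul_module_presents] by simp
  have z: "\<zero>\<^bsub>koszul_module {1..s} i\<^esub> = 0"
    by (rule presents_zero[OF koszul_module_presents])
  have "a_kernel (koszul_module {1..s} (Suc i)) (koszul_module {1..s} (Suc i - 1)) ?d
      = koszul_cycles {1..s} f (Suc i)"
    unfolding a_kernel_eq carr koszul_cycles_def by (simp only: z diff_Suc_1)
  moreover have "?d ` koszul_chains {1..s} (Suc i + 1) = koszul_boundaries s f (Suc i)"
    unfolding koszul_boundaries_def using koszul_diff_eq_kdiff by (intro image_cong) simp_all
  ultimately show ?thesis
    unfolding koszul_homology_def homology_at_def Let_def carr by (simp only:)
qed

definition koszul_class :: "nat \<Rightarrow> (nat \<Rightarrow> 'a::comm_ring_1) \<Rightarrow> nat \<Rightarrow> (nat set \<Rightarrow> 'a) \<Rightarrow> (nat set \<Rightarrow> 'a) set" where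
  "koszul_class s f i v = koszul_boundaries s f i
     +>\<^bsub>(koszul_module {1..s} i)\<lparr>carrier := koszul_cycles {1..s} f i\<rparr>\<^esub> v"

lemma koszul_homology_presents:
  "presents kscale (koszul_cycles {1..s} f (Suc i)) (koszul_boundaries s f (Suc i))
     (koszul_class s f (Suc i)) (koszul_homology {1..s} f (Suc i))"
  unfolding koszul_homology_eq koszul_class_def[abs_def]
  by (rule presents_quotient[OF koszul_cycles_module_presents koszul_boundaries_submodule])
    (use koszul_boundaries_submodule(2)[of s f "Suc i"] in auto)

lemma classes_of_koszul_homology:
  "classes_of H (koszul_homology {1..s} f (Suc i)) = koszul_class s f (Suc i) ` (koszul_cycles {1..s} f (Suc i) \<inter> H)"
  unfolding koszul_homology_eq koszul_class_def[abs_def]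
  by (rule classes_of_presented_quotient[OF koszul_cycles_module_presents koszul_boundaries_submodule])
    (use koszul_boundaries_submodule(2)[of s f "Suc i"] in auto)

text \<open>
  Write \<open>z \<in> Z\<^bsub>i + 1\<^esub>(f)\<close> as \<open>e\<^sub>0 \<and> v - u\<close> with \<open>u\<close>, \<open>v\<close> not involving \<open>e\<^sub>0\<close>. Then \<open>z\<close> is a cycle if and only if
  \<open>v\<close> is a cycle of \<open>a\<close> and \<open>b v = d u\<close>. So the homology of the complex of the \<open>Z\<^sub>i(f)\<close> is \<open>Z\<^sub>i(a)\<close> modulo those \<open>v\<close>
  for which \<open>b v\<close> is a boundary.
\<close>

lemma multiple_boundary_iff:
  assumes v: "v \<in> koszul_cycles {1..s} f i"
  shows "kscale (f 0) v \<in> koszul_boundaries s f i \<longleftrightarrow> (\<exists>z\<in>koszul_cycles {..s} f (Suc i). del 0 z = v)"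
proof
  have v0: "v \<in> koszul_chains {..s} i" "kdiff s f v = 0" "del 0 v = 0"
    using v unfolding koszul_cycles_a_iff koszul_cycles_kdiff by blast+
  assume "kscale (f 0) v \<in> koszul_boundaries s f i"
  then obtain u where u: "u \<in> koszul_chains {1..s} (Suc i)" "kscale (f 0) v = kdiff s f u"
    unfolding koszul_boundaries_def by blast
  have u0: "u \<in> koszul_chains {..s} (Suc i)" "del 0 u = 0"
    using u(1) del_0_zero_iff by blast+
  define z where "z = ins 0 v - u"
  have "ins 0 v \<in> koszul_chains {..s} (Suc i)"
  proof (rule koszul_chainsI)
    fix K assume "ins 0 v K \<noteq> 0"
    then have K: "0 \<in> K" "v (K - {0}) \<noteq> 0"
      by (auto simp: ins_def split: if_splits)
    then have *: "K - {0} \<subseteq> {..s} \<and> card (K - {0}) = i"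
      using koszul_chainsD[OF v0(1)] by blast
    then have "finite K"
      using finite_subset[of "K - {0}" "{..s}"] by simp
    then have "card K = Suc (card (K - {0}))"
      using K(1) by (intro card.remove)
    with * show "K \<subseteq> {..s} \<and> card K = Suc i"
      by auto
  qed
  then have zc: "z \<in> koszul_chains {..s} (Suc i)"
    unfolding z_def using u0(1) by (rule koszul_chains_diff)
  have zv: "del 0 z K = v K" for K
  proof -
    have "del 0 z = del 0 (ins 0 v)"
      by (simp only: z_def del_diff u0(2) diff_0_right)
    moreover have "ins 0 (del 0 v) K = 0"
      by (simp only: v0(3) ins_zero zero_fun_apply)
    ultimately show ?thesis
      using del_ins[of 0 0 v K] by (simp only: simp_thms if_True add_0_right)
  qed
  have "kdiff s f z K = 0" for K
  proof -
    have vK: "kdiff s f v (K - {0}) = 0"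
      using v0(2) by simp
    have i: "del l (ins 0 v) K = (if l = 0 then v K else 0) - ins 0 (del l v) K" for l
      using del_ins[of l 0 v K] by (simp add: algebra_simps)
    have "(\<Sum>l\<le>s. f l * ins 0 (del l v) K) = (if 0 \<in> K then altsign (below K 0) (kdiff s f v (K - {0})) else 0)"
      by (simp add: ins_def kdiff_def altsign_sum altsign_mult)
    then have s0: "(\<Sum>l\<le>s. f l * ins 0 (del l v) K) = 0"
      by (simp add: vK)
    have "kdiff s f (ins 0 v) K = (\<Sum>l\<le>s. f l * (if l = 0 then v K else 0)) - (\<Sum>l\<le>s. f l * ins 0 (del l v) K)"
      unfolding kdiff_def i by (simp only: right_diff_distrib sum_subtractf)
    also have "(\<Sum>l\<le>s. f l * (if l = 0 then v K else 0)) = (\<Sum>l\<le>s. if l = 0 then f 0 * v K else 0)"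
      by (rule sum.cong) auto
    also have "\<dots> = f 0 * v K"
      by (subst sum.delta) auto
    finally have "kdiff s f (ins 0 v) K = f 0 * v K"
      by (simp add: s0)
    moreover have "f 0 * v K = kdiff s f u K"
      using fun_cong[OF u(2), of K] by (simp add: kscale_def)
    ultimately show ?thesis
      by (simp add: z_def kdiff_diff)
  qed
  then have kz: "kdiff s f z = 0"
    by (simp add: fun_eq_iff)
  have dz: "del 0 z = v"
    using zv by (rule ext)
  have zz: "z \<in> koszul_cycles {..s} f (Suc i)"
    unfolding koszul_cycles_kdiff by (rule conjI[OF zc kz])
  show "\<exists>z\<in>koszul_cycles {..s} f (Suc i). del 0 z = v"
  proof (rule bexI[of _ z])
    show "del 0 z = v"
      by (rule dz)
    show "z \<in> koszul_cycles {..s} f (Suc i)"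
      by (rule zz)
  qed
next
  assume "\<exists>z\<in>koszul_cycles {..s} f (Suc i). del 0 z = v"
  then obtain z where zc: "z \<in> koszul_cycles {..s} f (Suc i)" and zv: "del 0 z = v"
    by (elim bexE)
  note z = conjunct1[OF zc[unfolded koszul_cycles_kdiff]] conjunct2[OF zc[unfolded koszul_cycles_kdiff]] zv
  define u where "u = (\<lambda>K. if 0 \<in> K then 0 else - z K)"
  have u: "u \<in> koszul_chains {1..s} (Suc i)"
  proof (rule koszul_chainsI)
    fix K assume "u K \<noteq> 0"
    then have "0 \<notin> K" "z K \<noteq> 0"
      by (auto simp: u_def split: if_splits)
    moreover from this have "K \<subseteq> {..s} \<and> card K = Suc i"
      using koszul_chainsD[OF z(1)] by blast
    moreover have "{..s} - {0} \<subseteq> {1..s}"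
      by auto
    ultimately show "K \<subseteq> {1..s} \<and> card K = Suc i"
      by blast
  qed
  have u0: "del 0 u = 0"
    using u del_0_zero_iff by blast
  have "kscale (f 0) v = kdiff s f u"
  proof
    fix K
    have v0: "v K = 0" if "0 \<in> K"
      using that unfolding z(3)[symmetric] by (simp add: del_def)
    show "kscale (f 0) v K = kdiff s f u K"
    proof (cases "0 \<in> K")
      case True
      have "del l u K = 0" for l
        using True by (simp add: del_def u_def)
      then show ?thesis
        using v0[OF True] by (simp add: kscale_def kdiff_def)
    next
      case False
      have l: "f l * del l u K = - (f l * del l z K)" if "l \<in> {..s} - {0}" for l
        using that False by (simp add: del_def u_def altsign_uminus)
      have "kdiff s f u K = f 0 * del 0 u K + (\<Sum>l\<in>{..s} - {0}. f l * del l u K)"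
        unfolding kdiff_def by (rule sum.remove) auto
      also have "f 0 * del 0 u K = 0"
        using u0 by simp
      also have "(\<Sum>l\<in>{..s} - {0}. f l * del l u K) = - (\<Sum>l\<in>{..s} - {0}. f l * del l z K)"
        using l by (simp add: sum_negf)
      also have "(\<Sum>l\<in>{..s} - {0}. f l * del l z K) = - (f 0 * v K)"
      proof -
        have "kdiff s f z K = f 0 * del 0 z K + (\<Sum>l\<in>{..s} - {0}. f l * del l z K)"
          unfolding kdiff_def by (rule sum.remove) auto
        then have "0 = f 0 * v K + (\<Sum>l\<in>{..s} - {0}. f l * del l z K)"
          using z(2,3) by simp
        then show ?thesis
          by (simp add: eq_neg_iff_add_eq_0 add.commute)
      qed
      finally show ?thesis
        by (simp add: kscale_def)
    qed
  qed
  then show "kscale (f 0) v \<in> koszul_boundaries s f i"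
    unfolding koszul_boundaries_def using u by (rule image_eqI)
qed

context approximation_complex
begin

section \<open>The homology in positive degrees\<close>

text \<open>
  Representatives of the cycles and boundaries of \<open>\<^sub>0\<Z>\<^sup>+\<close> in degree \<open>i \<ge> 1\<close>. For \<open>i \<ge> 2\<close> the condition on
  \<open>psi\<close> follows from the one on \<open>Dinv\<close>, while for \<open>i = 1\<close> the latter is void and the former says that
  \<open>\<tau>\<^sub>0\<close> vanishes; with both conditions the two cases have one description.
\<close>

definition hcycles :: "nat \<Rightarrow> 'a cchain set" where
  "hcycles i = {c \<in> top_chains (i + s). Dinv (neg_part c) = 0 \<and> del 0 (psi i (neg_part c)) = 0}"

definition hboundaries :: "nat \<Rightarrow> 'a cchain set" where
  "hboundaries i = {c \<in> hcycles i. \<exists>y\<in>inv_chains (Suc (i + s)). neg_part c = Dinv y}"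

lemma Dinv_scale: "Dinv (\<lambda>\<alpha>. wscale r (x \<alpha>)) = (\<lambda>\<alpha>. wscale r (Dinv x \<alpha>))"
proof
  fix \<alpha>
  have w: "(\<Sum>l\<in>A. wscale r (g l)) = wscale r (sum g A)" for g :: "nat \<Rightarrow> 'a wchain" and A
    by (simp add: wscale_def fun_eq_iff sum_apply sum_distrib_left)
  show "Dinv (\<lambda>\<alpha>. wscale r (x \<alpha>)) \<alpha> = wscale r (Dinv x \<alpha>)"
    by (cases "neg s \<alpha>") (simp_all only: Dinv_def if_True if_False kap_scale w wscale_zero)
qed

lemma hcycles_closed:
  "0 \<in> hcycles i" "x \<in> hcycles i \<Longrightarrow> y \<in> hcycles i \<Longrightarrow> x - y \<in> hcycles i"
  "x \<in> hcycles i \<Longrightarrow> cscale r x \<in> hcycles i"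
proof -
  show "0 \<in> hcycles i"
    unfolding hcycles_def mem_Collect_eq neg_part_zero Dinv_zero psi_zero del_zero
    by (intro conjI top_chains_closed refl)
  show "x - y \<in> hcycles i" if xy: "x \<in> hcycles i" "y \<in> hcycles i"
  proof -
    have e: "Dinv (neg_part x) = 0" "Dinv (neg_part y) = 0" "del 0 (psi i (neg_part x)) = 0"
      "del 0 (psi i (neg_part y)) = 0" and t: "x \<in> top_chains (i + s)" "y \<in> top_chains (i + s)"
      using xy unfolding hcycles_def by blast+
    show ?thesis
      unfolding hcycles_def mem_Collect_eq neg_part_diff Dinv_diff psi_diff del_diff e diff_self
      by (intro conjI top_chains_closed t refl)
  qed
  show "cscale r x \<in> hcycles i" if x: "x \<in> hcycles i"
  proof -
    have e: "Dinv (neg_part x) = 0" "del 0 (psi i (neg_part x)) = 0" and t: "x \<in> top_chains (i + s)"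
      using x unfolding hcycles_def by blast+
    have "(\<lambda>\<alpha>. wscale r (Dinv (neg_part x) \<alpha>)) = 0"
      unfolding e by (rule ext) (simp only: inv_apply wscale_zero)
    moreover have "(\<lambda>L. r * del 0 (psi i (neg_part x)) L) = 0"
      unfolding e by (simp add: fun_eq_iff)
    ultimately show ?thesis
      unfolding hcycles_def mem_Collect_eq neg_part_cscale Dinv_scale psi_scale del_scale
      by (intro conjI top_chains_closed t)
  qed
qed

lemma inv_chains_scale:
  assumes "x \<in> inv_chains n"
  shows "(\<lambda>\<alpha>. wscale r (x \<alpha>)) \<in> inv_chains n"
proof (rule inv_chainsI)
  fix \<alpha>
  show "wscale r (x \<alpha>) \<in> coef_module s f n"
    by (rule coef_module_scale[OF inv_chains_coef[OF assms]])
  assume "wscale r (x \<alpha>) \<noteq> 0"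
  then have "x \<alpha> \<noteq> 0"
    by (metis wscale_zero)
  then show "neg s \<alpha> \<and> deg \<alpha> = - int n"
    by (rule inv_chains_supp[OF assms])
qed

lemma hboundaries_closed:
  "hboundaries i \<subseteq> hcycles i" "0 \<in> hboundaries i"
  "x \<in> hboundaries i \<Longrightarrow> y \<in> hboundaries i \<Longrightarrow> x - y \<in> hboundaries i"
  "x \<in> hboundaries i \<Longrightarrow> cscale r x \<in> hboundaries i"
  "x \<in> hcycles i \<Longrightarrow> x \<in> {c. neg_part c = 0} \<Longrightarrow> x \<in> hboundaries i"
proof -
  show "hboundaries i \<subseteq> hcycles i"
    unfolding hboundaries_def by blast
  show neg0: "x \<in> hboundaries i" if x: "x \<in> hcycles i" "x \<in> {c. neg_part c = 0}" for x
  proof -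
    have "neg_part x = Dinv 0"
      using x(2) unfolding Dinv_zero by blast
    then show ?thesis
      unfolding hboundaries_def using x(1) inv_chains_zero by blast
  qed
  show "0 \<in> hboundaries i"
    by (rule neg0[OF hcycles_closed(1)]) (simp only: mem_Collect_eq neg_part_zero)
  show "x - y \<in> hboundaries i" if xy: "x \<in> hboundaries i" "y \<in> hboundaries i"
  proof -
    obtain u v where uv: "u \<in> inv_chains (Suc (i + s))" "neg_part x = Dinv u"
      "v \<in> inv_chains (Suc (i + s))" "neg_part y = Dinv v" and h: "x \<in> hcycles i" "y \<in> hcycles i"
      using xy unfolding hboundaries_def by blast
    have "neg_part (x - y) = Dinv (u - v)"
      by (simp only: neg_part_diff Dinv_diff uv(2,4))
    then show ?thesis
      unfolding hboundaries_def using inv_chains_diff[OF uv(1,3)] hcycles_closed(2)[OF h] by blast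
  qed
  show "cscale r x \<in> hboundaries i" if x: "x \<in> hboundaries i"
  proof -
    obtain u where u: "u \<in> inv_chains (Suc (i + s))" "neg_part x = Dinv u" and h: "x \<in> hcycles i"
      using x unfolding hboundaries_def by blast
    have "neg_part (cscale r x) = Dinv (\<lambda>\<alpha>. wscale r (u \<alpha>))"
      by (simp only: neg_part_cscale Dinv_scale u(2))
    then show ?thesis
      unfolding hboundaries_def using inv_chains_scale[OF u(1)] hcycles_closed(3)[OF h] by blast
  qed
qed

lemma hcycles_top: "hcycles i \<subseteq> top_chains (i + s)"
  unfolding hcycles_def by blast

lemma hcycles_module_presents:
  "presents cscale (hcycles i) {c. neg_part c = 0} (cls (i + s)) ((Zplus s f i)\<lparr>carrier := cls (i + s) ` hcycles i\<rparr>)"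
  by (rule presents_restrict[OF Zplus_presents hcycles_top hcycles_closed refl refl])

lemma cls_eq_zero_iff:
  assumes "c \<in> top_chains (i + s)"
  shows "cls (i + s) c = \<zero>\<^bsub>Zplus s f i\<^esub> \<longleftrightarrow> neg_part c = 0"
  using presents_eq_zero_iff[OF Zplus_presents assms] by simp

text \<open>
  The value of \<open>\<tau>\<^sub>0\<close> in terms of \<open>psi\<close>: up to the identification \<open>(D\<^sub>0)\<^bsub>[0]\<^esub> = R\<close> it is \<open>del 0 \<circ> psi 1\<close>.
\<close>

lemma kaps_psi:
  assumes c: "c \<in> top_chains (Suc s)"
  shows "kaps [0..<Suc s] (neg_part c (top_mon 1)) \<in> coef_module s f 0"
    "kaps [0..<Suc s] (neg_part c (top_mon 1)) {} = del 0 (psi 1 (neg_part c))"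
proof -
  let ?w = "neg_part c (top_mon 1)"
  have upt: "[0..<Suc s] = 0 # [1..<Suc s]"
    by (simp add: upt_conv_Cons del: upt_Suc)
  have k1: "kaps [1..<Suc s] ?w \<in> coef_module s f (Suc 0)"
  proof (rule coef_module_kaps)
    have len: "length [1..<Suc s] = s"
      by simp
    show "?w \<in> coef_module s f (Suc 0 + length [1..<Suc s])"
      unfolding len using inv_chains_coef[OF neg_part_inv_chains[OF c]] by simp
  qed
  have k0: "kaps [0..<Suc s] ?w = kap 0 (kaps [1..<Suc s] ?w)"
    by (simp only: upt kaps_Cons)
  show "kaps [0..<Suc s] ?w \<in> coef_module s f 0"
    unfolding k0 by (rule coef_module_kap[OF k1])
  show "kaps [0..<Suc s] ?w {} = del 0 (psi 1 (neg_part c))"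
    unfolding k0 using kap_0_coef_module[OF k1, of "{}"] by (simp only: card.empty altsign_0 psi_def)
qed

lemma tau0_zero_iff:
  assumes c: "c \<in> top_chains (Suc s)"
  shows "tau0 s f (cls (Suc s) c) = 0 \<longleftrightarrow> del 0 (psi 1 (neg_part c)) = 0"
proof -
  let ?w = "neg_part c (top_mon 1)"
  note e = kaps_psi(2)[OF c]
  have "kaps [0..<Suc s] ?w M = 0" if "M \<noteq> {}" for M
  proof (rule ccontr)
    assume nz: "kaps [0..<Suc s] ?w M \<noteq> 0"
    then obtain L where nzL: "kaps [0..<Suc s] ?w M L \<noteq> 0"
      by (metis ext zero_fun_apply)
    have "M \<subseteq> {1..s} \<and> card M = 0"
      using coef_module_subset2[OF kaps_psi(1)[OF c] nzL] by simp
    then show False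
      using that finite_subset by fastforce
  qed
  then have "kaps [0..<Suc s] ?w = 0 \<longleftrightarrow> kaps [0..<Suc s] ?w {} = 0"
    by (metis ext fun2_apply(3))
  moreover have "constant_chain w = 0 \<longleftrightarrow> w = 0" for w :: "'a wchain"
  proof
    assume "constant_chain w = 0"
    then have "cof (constant_chain w) 0 = 0"
      by (simp only: cof_zero)
    then show "w = 0"
      by (simp only: cof_constant_chain simp_thms if_True)
  qed (simp add: constant_chain_def fun_eq_iff)
  ultimately show ?thesis
    unfolding tau0_cls[OF c] e by blast
qed

text \<open>
  The \<open>s + 1\<close> negative exponents of a monomial sum up to at most \<open>-(s + 1)\<close>.
\<close>

lemma inv_chains_low:
  assumes x: "x \<in> inv_chains s"
  shows "x = 0"
proof
  fix \<alpha>
  show "x \<alpha> = 0 \<alpha>"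
  proof (rule ccontr)
    assume "x \<alpha> \<noteq> 0 \<alpha>"
    then have "x \<alpha> \<noteq> 0"
      by (simp only: inv_apply not_False_eq_True)
    then have neg: "neg s \<alpha>" and deg: "deg \<alpha> = - int s"
      using inv_chains_supp[OF x] by blast+
    have "deg \<alpha> = (\<Sum>j\<le>s. Poly_Mapping.lookup \<alpha> j)"
      using neg unfolding neg_def by (intro deg_atMost) blast
    also have "\<dots> \<le> (\<Sum>j\<le>s. -1)"
    proof (rule sum_mono)
      fix j assume "j \<in> {..s}"
      then have "Poly_Mapping.lookup \<alpha> j < 0"
        using neg unfolding neg_def by blast
      then show "Poly_Mapping.lookup \<alpha> j \<le> - 1"
        by linarith
    qed
    finally show False
      using deg by simp
  qed
qed

lemma Zplus_kernel_1: "a_kernel (Zplus s f 1) (Zplus0 s f) (tau0 s f) = cls (1 + s) ` hcycles 1"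
proof -
  have z: "\<zero>\<^bsub>Zplus0 s f\<^esub> = 0"
    by (simp add: Zplus0_def module_on_def)
  have "c \<in> hcycles 1 \<longleftrightarrow> tau0 s f (cls (1 + s) c) = 0" if c: "c \<in> top_chains (1 + s)" for c
  proof -
    have "Dinv (neg_part c) = 0"
      by (intro inv_chains_low Dinv_inv_chains) (use neg_part_inv_chains[OF c] in simp)
    then show ?thesis
      using tau0_zero_iff[of c] c unfolding hcycles_def by simp
  qed
  then have "{c \<in> top_chains (1 + s). tau0 s f (cls (1 + s) c) = 0} = hcycles 1"
    using hcycles_top[of 1] by blast
  moreover have "a_kernel (Zplus s f 1) (Zplus0 s f) (tau0 s f)
      = cls (1 + s) ` {c \<in> top_chains (1 + s). tau0 s f (cls (1 + s) c) = 0}"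
    unfolding a_kernel_eq z presents_carrier[OF Zplus_presents] by blast
  ultimately show ?thesis
    by (simp only:)
qed

lemma Zplus_kernel_Suc:
  assumes i: "0 < i"
  shows "a_kernel (Zplus s f (Suc i)) (Zplus s f i) (Zplus_diff s f (Suc i)) = cls (Suc i + s) ` hcycles (Suc i)"
proof -
  have "c \<in> hcycles (Suc i) \<longleftrightarrow> Zplus_diff s f (Suc i) (cls (Suc i + s) c) = \<zero>\<^bsub>Zplus s f i\<^esub>"
    if c: "c \<in> top_chains (Suc i + s)" for c
  proof -
    have D: "(\<lambda>J. D_diff s (c J)) \<in> top_chains (i + s)"
      by (rule D_diff_top_chains) (use c in simp)
    have x: "neg_part c \<in> inv_chains (Suc i + s)"
      by (rule neg_part_inv_chains[OF c])
    have "Zplus_diff s f (Suc i) (cls (Suc i + s) c) = \<zero>\<^bsub>Zplus s f i\<^esub> \<longleftrightarrow> Dinv (neg_part c) = 0"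
      unfolding Zplus_diff_cls[OF top_chains_cech[OF c]] cls_eq_zero_iff[OF D]
        neg_part_D_diff[where c = c, OF top_chains_loc[OF c]] ..
    moreover have "del 0 (psi (Suc i) (neg_part c)) = 0" if D0: "Dinv (neg_part c) = 0"
    proof -
      have "altsign s (del 0 (psi (Suc i) (neg_part c))) = psi i 0"
        unfolding D0[symmetric] by (rule psi_Dinv[OF x i, symmetric])
      then show ?thesis
        by (simp only: psi_zero altsign_eq_0_iff)
    qed
    ultimately show ?thesis
      using c unfolding hcycles_def by blast
  qed
  then have "{c \<in> top_chains (Suc i + s). Zplus_diff s f (Suc i) (cls (Suc i + s) c) = \<zero>\<^bsub>Zplus s f i\<^esub>} = hcycles (Suc i)"
    using hcycles_top[of "Suc i"] by blast
  moreover have "a_kernel (Zplus s f (Suc i)) (Zplus s f i) (Zplus_diff s f (Suc i))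
      = cls (Suc i + s) ` {c \<in> top_chains (Suc i + s). Zplus_diff s f (Suc i) (cls (Suc i + s) c) = \<zero>\<^bsub>Zplus s f i\<^esub>}"
    unfolding a_kernel_eq presents_carrier[OF Zplus_presents] by blast
  ultimately show ?thesis
    by (simp only:)
qed

lemma D_diff_hboundaries:
  assumes y: "y \<in> top_chains (Suc i + s)" and i: "0 < i"
  shows "(\<lambda>J. D_diff s (y J)) \<in> hboundaries i"
proof -
  have x: "neg_part y \<in> inv_chains (Suc i + s)"
    by (rule neg_part_inv_chains[OF y])
  have n: "neg_part (\<lambda>J. D_diff s (y J)) = Dinv (neg_part y)"
    by (rule neg_part_D_diff[where c = y, OF top_chains_loc[OF y]])
  have t: "(\<lambda>J. D_diff s (y J)) \<in> top_chains (i + s)"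
    by (rule D_diff_top_chains) (use y in simp)
  have "del 0 (psi i (Dinv (neg_part y))) = 0"
    by (simp only: psi_Dinv[OF x i] del_altsign del_self altsign_zero)
  then have "(\<lambda>J. D_diff s (y J)) \<in> hcycles i"
    unfolding hcycles_def mem_Collect_eq n by (intro conjI t Dinv_Dinv)
  then show ?thesis
    unfolding hboundaries_def mem_Collect_eq n using x by (metis add_Suc)
qed

lemma Zplus_image:
  assumes i: "0 < i"
  shows "Zplus_diff s f (Suc i) ` carrier (Zplus s f (Suc i)) = cls (i + s) ` hboundaries i"
proof -
  have "Zplus_diff s f (Suc i) ` carrier (Zplus s f (Suc i))
      = (\<lambda>y. cls (i + s) (\<lambda>J. D_diff s (y J))) ` top_chains (Suc i + s)"
    unfolding presents_carrier[OF Zplus_presents] image_image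
    by (rule image_cong[OF refl Zplus_diff_cls[OF top_chains_cech]])
  also have "\<dots> = cls (i + s) ` hboundaries i"
  proof (intro equalityI subsetI)
    fix Y assume "Y \<in> (\<lambda>y. cls (i + s) (\<lambda>J. D_diff s (y J))) ` top_chains (Suc i + s)"
    then show "Y \<in> cls (i + s) ` hboundaries i"
      using D_diff_hboundaries[OF _ i] by blast
  next
    fix Y assume "Y \<in> cls (i + s) ` hboundaries i"
    then obtain c y where c: "c \<in> hcycles i" "Y = cls (i + s) c" and y: "y \<in> inv_chains (Suc (i + s))"
      "neg_part c = Dinv y"
      unfolding hboundaries_def by blast
    let ?y = "realize y"
    note t = realize_top_chains[OF y(1)]
    have "cls (i + s) c = cls (i + s) (\<lambda>J. D_diff s (?y J))"
    proof (rule cls_eqI)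
      show "c \<in> cech_chains (Suc s) (i + s)"
        using c(1) hcycles_top top_chains_cech by blast
      show "(\<lambda>J. D_diff s (?y J)) \<in> cech_chains (Suc s) (i + s)"
        by (rule top_chains_cech[OF D_diff_top_chains[OF t]])
      show "neg_part c = neg_part (\<lambda>J. D_diff s (?y J))"
        by (simp only: neg_part_D_diff[where c = ?y, OF top_chains_loc[OF t]] neg_part_realize[OF y(1)] y(2))
    qed
    then show "Y \<in> (\<lambda>y. cls (i + s) (\<lambda>J. D_diff s (y J))) ` top_chains (Suc i + s)"
      using c(2) t by (intro image_eqI[of _ _ ?y]) (simp_all only: add_Suc)
  qed
  finally show ?thesis .
qed

lemma Zplus_homology_eq:
  assumes i: "0 < i"
  shows "Zplus_homology s f i =
     quotient_module ((Zplus s f i)\<lparr>carrier := cls (i + s) ` hcycles i\<rparr>) (cls (i + s) ` hboundaries i)"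
proof (cases "i = 1")
  case True
  have "Zplus_diff s f 2 ` carrier (Zplus s f 2) = cls (1 + s) ` hboundaries 1"
    using Zplus_image[of 1] by (simp add: numeral_2_eq_2)
  then show ?thesis
    unfolding True Zplus_homology_def homology_at_def Zplus_kernel_1 by (simp only: simp_thms if_True)
next
  case False
  then obtain j where j: "i = Suc j" "0 < j"
    using i by (cases i) auto
  have "Suc j + 1 = Suc (Suc j)" "Suc j - 1 = j"
    by simp_all
  then show ?thesis
    using False unfolding Zplus_homology_def homology_at_def j
    by (simp only: if_False Zplus_kernel_Suc[OF j(2)] Zplus_image[OF zero_less_Suc])
qed

definition hclass :: "nat \<Rightarrow> 'a cchain \<Rightarrow> 'a cchain set set" where
  "hclass i c = cls (i + s) ` hboundaries i
     +>\<^bsub>(Zplus s f i)\<lparr>carrier := cls (i + s) ` hcycles i\<rparr>\<^esub> cls (i + s) c"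

lemma Zplus_homology_presents:
  assumes i: "0 < i"
  shows "presents cscale (hcycles i) (hboundaries i) (hclass i) (Zplus_homology s f i)"
  unfolding Zplus_homology_eq[OF i] hclass_def[abs_def]
  by (rule presents_quotient[OF hcycles_module_presents hboundaries_closed refl])

lemma psi_hcycles:
  assumes "c \<in> hcycles i"
  shows "psi i (neg_part c) \<in> koszul_cycles {1..s} f i"
  unfolding koszul_cycles_a_iff
  using assms psi_cycle[OF neg_part_inv_chains] unfolding hcycles_def by blast

lemma hcycles_lift:
  assumes i: "0 < i"
  obtains e where "\<And>v. v \<in> koszul_cycles {1..s} f i \<Longrightarrow> realize (top_elem i (altsign e v)) \<in> hcycles i \<and>
    psi i (neg_part (realize (top_elem i (altsign e v)))) = v"
proof -
  obtain e where e: "\<And>i v. psi i (top_elem i (altsign e v)) = v"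
    using psi_top_elem by blast
  have "realize (top_elem i (altsign e v)) \<in> hcycles i \<and> psi i (neg_part (realize (top_elem i (altsign e v)))) = v"
    if v: "v \<in> koszul_cycles {1..s} f i" for v
  proof -
    have v': "v \<in> koszul_cycles {..s} f i" "del 0 v = 0"
      using v unfolding koszul_cycles_a_iff by blast+
    have ev: "altsign e v \<in> koszul_cycles {..s} f i" "del 0 (altsign e v) = 0"
      by (rule koszul_cycles_altsign[OF finite_atMost v'(1)]) (simp only: del_altsign v'(2) altsign_zero)
    note x = top_elem_inv_chains[OF ev(1) i]
    show ?thesis
      unfolding hcycles_def mem_Collect_eq neg_part_realize[OF x] e
      by (intro conjI realize_top_chains[OF x] Dinv_top_elem[OF ev(1) i ev(2)] v'(2) refl)
  qed
  with that show ?thesis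
    by blast
qed

text \<open>
  By \<open>multiple_boundary_iff\<close> the left side says that \<open>psi\<close> maps \<open>c\<close> to a boundary \<open>del 0 z\<close>. Subtracting the
  boundary of the section at \<open>z\<close> makes \<open>psi\<close> vanish, and then \<open>cycle_reduction\<close> applies.
\<close>

lemma hboundaries_iff:
  assumes i: "0 < i" and c: "c \<in> hcycles i"
  shows "kscale (f 0) (psi i (neg_part c)) \<in> koszul_boundaries s f i \<longleftrightarrow> c \<in> hboundaries i"
  unfolding multiple_boundary_iff[OF psi_hcycles[OF c]]
proof
  have x: "neg_part c \<in> inv_chains (i + s)" and D: "Dinv (neg_part c) = 0"
    using c neg_part_inv_chains unfolding hcycles_def by blast+
  assume "\<exists>z\<in>koszul_cycles {..s} f (Suc i). del 0 z = psi i (neg_part c)"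
  then obtain z where z: "z \<in> koszul_cycles {..s} f (Suc i)" "del 0 z = psi i (neg_part c)"
    by blast
  obtain e where e: "\<And>i v. psi i (top_elem i (altsign e v)) = v"
    using psi_top_elem by blast
  \<comment> \<open>one sign turns the section into a right inverse of \<open>psi\<close>, the other is that of \<open>psi_Dinv\<close>\<close>
  define y where "y = top_elem (Suc i) (altsign e (altsign s z))"
  have y: "y \<in> inv_chains (Suc i + s)"
    unfolding y_def by (intro top_elem_inv_chains koszul_cycles_altsign z finite_atMost zero_less_Suc)
  have "psi (Suc i) y = altsign s z"
    unfolding y_def by (rule e)
  then have "psi i (Dinv y) = psi i (neg_part c)"
    by (simp only: psi_Dinv[OF y i] del_altsign altsign_twice z(2))
  then have psi0: "psi i (neg_part c - Dinv y) = 0"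
    by (simp only: psi_diff diff_self)
  have D0: "Dinv (neg_part c - Dinv y) = 0"
    by (simp only: Dinv_diff D Dinv_Dinv diff_self)
  have "neg_part c - Dinv y \<in> inv_chains (i + s)"
    by (intro inv_chains_diff x Dinv_inv_chains) (use y in simp)
  from cycle_reduction[OF this i D0 psi0]
  obtain y' where y': "y' \<in> inv_chains (Suc (i + s))" "neg_part c - Dinv y = Dinv y'"
    by blast
  have "neg_part c = Dinv (y + y')"
    unfolding Dinv_add y'(2)[symmetric] by (simp only: add_diff_eq add_diff_cancel_left')
  moreover have "y + y' \<in> inv_chains (Suc (i + s))"
    by (intro inv_chains_add y'(1)) (use y in simp)
  ultimately show "c \<in> hboundaries i"
    unfolding hboundaries_def using c by blast
next
  assume "c \<in> hboundaries i"
  then obtain y where y: "y \<in> inv_chains (Suc i + s)" "neg_part c = Dinv y"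
    unfolding hboundaries_def by auto
  have "del 0 (altsign s (psi (Suc i) y)) = psi i (neg_part c)"
    by (simp only: y(2) psi_Dinv[OF y(1) i] del_altsign)
  moreover have "altsign s (psi (Suc i) y) \<in> koszul_cycles {..s} f (Suc i)"
    by (intro koszul_cycles_altsign psi_cycle y finite_atMost)
  ultimately show "\<exists>z\<in>koszul_cycles {..s} f (Suc i). del 0 z = psi i (neg_part c)"
    by blast
qed

text \<open>
  Both sides are quotients of \<open>Z\<^sub>i(a)\<close> by the elements \<open>v\<close> with \<open>b v\<close> a boundary: the left one through \<open>psi\<close>, the
  right one through multiplication by \<open>b\<close>.
\<close>

lemma homology_iso:
  assumes i: "0 < i"
  shows "\<exists>h\<in>module_iso R (Zplus_homology s f i) (multiple_module (f 0) (koszul_homology {1..s} f i)).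
    \<forall>c\<in>hcycles i. h (hclass i c) = koszul_class s f i (kscale (f 0) (psi i (neg_part c)))"
proof -
  obtain j where j: "i = Suc j"
    using i by (cases i) auto
  have M': "presents kscale (koszul_cycles {1..s} f i) {v. kscale (f 0) v \<in> koszul_boundaries s f i}
      (\<lambda>v. koszul_class s f i (kscale (f 0) v)) (multiple_module (f 0) (koszul_homology {1..s} f i))"
    unfolding j by (rule presents_multiple_module[OF koszul_homology_presents])
      (simp add: kscale_def fun_eq_iff mult.left_commute)
  define \<theta> where "\<theta> = (\<lambda>c. psi i (neg_part c))"
  have d: "\<theta> (x - y) = \<theta> x - \<theta> y" for x y
    by (simp only: \<theta>_def neg_part_diff psi_diff)
  have a: "\<theta> (x + y) = \<theta> x + \<theta> y" for x y
    using d[of "x + y" y] by (simp only: add_diff_cancel_right' diff_eq_eq) (metis diff_add_cancel d)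
  have sc: "\<theta> (cscale r x) = kscale r (\<theta> x)" for r x
    by (simp only: \<theta>_def neg_part_cscale psi_scale kscale_def)
  have surj: "\<theta> ` hcycles i = koszul_cycles {1..s} f i"
  proof (intro equalityI subsetI)
    fix v assume "v \<in> \<theta> ` hcycles i"
    then show "v \<in> koszul_cycles {1..s} f i"
      using psi_hcycles unfolding \<theta>_def by blast
  next
    fix v assume v: "v \<in> koszul_cycles {1..s} f i"
    obtain e where "\<And>v. v \<in> koszul_cycles {1..s} f i \<Longrightarrow> realize (top_elem i (altsign e v)) \<in> hcycles i \<and>
      psi i (neg_part (realize (top_elem i (altsign e v)))) = v"
      using hcycles_lift[OF i] by blast
    from this[OF v] show "v \<in> \<theta> ` hcycles i"
      unfolding \<theta>_def by (metis imageI)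
  qed
  have ker: "\<theta> c \<in> {v. kscale (f 0) v \<in> koszul_boundaries s f i} \<longleftrightarrow> c \<in> hboundaries i" if "c \<in> hcycles i" for c
    unfolding \<theta>_def mem_Collect_eq by (rule hboundaries_iff[OF i that])
  show ?thesis
  proof (rule presents_iso[OF Zplus_homology_presents[OF i] M' a d sc surj ker, where R = R])
    fix h
    assume h: "h \<in> module_iso R (Zplus_homology s f i) (multiple_module (f 0) (koszul_homology {1..s} f i))"
      and hc: "\<And>c. c \<in> hcycles i \<Longrightarrow> h (hclass i c) = koszul_class s f i (kscale (f 0) (\<theta> c))"
    show ?thesis
      by (intro bexI[of _ h] ballI hc[unfolded \<theta>_def] h)
  qed
qed

end

section \<open>Ideals and grade\<close>

lemma RR_simps:
  "carrier (RR :: 'a::comm_ring_1 ring) = UNIV" "x \<otimes>\<^bsub>RR\<^esub> y = x * (y :: 'a)"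
  "x \<oplus>\<^bsub>RR\<^esub> y = x + (y :: 'a)" "\<zero>\<^bsub>RR\<^esub> = (0 :: 'a)"
  by (simp_all add: ring_of_type_algebra_def)

lemma ideal_RRI:
  fixes J :: "'a::comm_ring_1 set"
  assumes "0 \<in> J" "\<And>x y. x \<in> J \<Longrightarrow> y \<in> J \<Longrightarrow> x - y \<in> J" "\<And>r x. x \<in> J \<Longrightarrow> r * x \<in> J"
  shows "ideal J RR"
proof -
  interpret ring "RR :: 'a ring"
    by (rule ring_from_type_algebra)
  have inv: "inv\<^bsub>add_monoid RR\<^esub> x = - x" for x :: 'a
    using minus_equality[of "- x" x] by (simp add: RR_simps a_inv_def)
  have neg: "- x \<in> J" if "x \<in> J" for x
    using assms(2)[OF assms(1) that] by simp
  have add: "x + y \<in> J" if "x \<in> J" "y \<in> J" for x y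
    using assms(2)[OF that(1) neg[OF that(2)]] by simp
  show ?thesis
  proof (rule idealI)
    show "ring (RR :: 'a ring)"
      by (rule ring_from_type_algebra)
    show "subgroup J (add_monoid RR)"
    proof (rule subgroup.intro)
      fix x assume "x \<in> J"
      then show "inv\<^bsub>add_monoid RR\<^esub> x \<in> J"
        unfolding inv by (rule neg)
    qed (simp_all add: RR_simps add assms(1))
    show "x \<otimes>\<^bsub>RR\<^esub> a \<in> J" "a \<otimes>\<^bsub>RR\<^esub> x \<in> J" if "a \<in> J" for a x
      using assms(3)[OF that, of x] by (simp_all add: RR_simps mult.commute)
  qed
qed

lemma Idl_image_iff:
  fixes g :: "'i \<Rightarrow> 'a::comm_ring_1"
  assumes A: "finite A"
  shows "x \<in> Idl\<^bsub>RR\<^esub> (g ` A) \<longleftrightarrow> (\<exists>c. x = (\<Sum>i\<in>A. c i * g i))"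
proof
  interpret ring "RR :: 'a ring"
    by (rule ring_from_type_algebra)
  let ?J = "{x. \<exists>c. x = (\<Sum>i\<in>A. c i * g i)}"
  have "ideal ?J RR"
  proof (rule ideal_RRI)
    show "0 \<in> ?J"
      by (auto intro!: exI[of _ "\<lambda>_. 0"])
    fix x y assume "x \<in> ?J" "y \<in> ?J"
    then obtain c d where "x = (\<Sum>i\<in>A. c i * g i)" "y = (\<Sum>i\<in>A. d i * g i)"
      by blast
    then have "x - y = (\<Sum>i\<in>A. (c i - d i) * g i)"
      by (simp add: left_diff_distrib sum_subtractf)
    then show "x - y \<in> ?J"
      by (intro CollectI exI[of _ "\<lambda>i. c i - d i"])
  next
    fix r x assume "x \<in> ?J"
    then obtain c where "x = (\<Sum>i\<in>A. c i * g i)"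
      by blast
    then have "r * x = (\<Sum>i\<in>A. (r * c i) * g i)"
      by (simp add: sum_distrib_left mult.assoc)
    then show "r * x \<in> ?J"
      by (intro CollectI exI[of _ "\<lambda>i. r * c i"])
  qed
  moreover have "g ` A \<subseteq> ?J"
  proof
    fix x assume "x \<in> g ` A"
    then obtain i where i: "i \<in> A" "x = g i"
      by blast
    have "(\<Sum>j\<in>A. (if j = i then 1 else 0) * g j) = (\<Sum>j\<in>A. if j = i then g i else 0)"
      by (rule sum.cong) auto
    also have "\<dots> = g i"
      using A i by (subst sum.delta) auto
    finally have "x = (\<Sum>j\<in>A. (if j = i then 1 else 0) * g j)"
      using i by simp
    then show "x \<in> ?J"
      by (intro CollectI exI[of _ "\<lambda>j. if j = i then 1 else 0"])
  qed
  ultimately have "Idl\<^bsub>RR\<^esub> (g ` A) \<subseteq> ?J"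
    by (rule genideal_minimal)
  then show "\<exists>c. x = (\<Sum>i\<in>A. c i * g i)" if "x \<in> Idl\<^bsub>RR\<^esub> (g ` A)"
    using that by blast
next
  interpret ring "RR :: 'a ring"
    by (rule ring_from_type_algebra)
  interpret I: ideal "Idl\<^bsub>RR\<^esub> (g ` A)" "RR :: 'a ring"
    by (rule genideal_ideal) (simp add: RR_simps)
  have gen: "g i \<in> Idl\<^bsub>RR\<^esub> (g ` A)" if "i \<in> A" for i
    using genideal_self[of "g ` A"] that by (auto simp: RR_simps)
  assume "\<exists>c. x = (\<Sum>i\<in>A. c i * g i)"
  then obtain c where x: "x = (\<Sum>i\<in>A. c i * g i)"
    by blast
  have "(\<Sum>i\<in>B. c i * g i) \<in> Idl\<^bsub>RR\<^esub> (g ` A)" if "finite B" "B \<subseteq> A" for B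
    using that
  proof (induction B rule: finite_induct)
    case empty
    show ?case
      using I.zero_closed by (simp add: RR_simps)
  next
    case (insert j B)
    have "c j * g j \<in> Idl\<^bsub>RR\<^esub> (g ` A)"
      using I.I_l_closed[OF gen[of j], of "c j"] insert.prems by (simp add: RR_simps)
    then show ?case
      using I.a_closed[of "c j * g j" "\<Sum>i\<in>B. c i * g i"] insert by (simp add: RR_simps)
  qed
  from this[OF A order_refl] show "x \<in> Idl\<^bsub>RR\<^esub> (g ` A)"
    by (simp only: x)
qed

text \<open>
  The first element of a regular sequence is regular. If \<open>J\<close> is the whole ring, its grade is infinite by
  convention and \<open>1\<close> serves.
\<close>

lemma grade_ge_1_regular_element:
  fixes J :: "'a::comm_ring_1 set"
  assumes "1 \<le> grade J"
  obtains x where "x \<in> J" "\<And>y. y * x = 0 \<Longrightarrow> y = 0"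
proof (cases "J = UNIV")
  case True
  then show ?thesis
    using that[of 1] by simp
next
  case False
  interpret ring "RR :: 'a ring"
    by (rule ring_from_type_algebra)
  have Idl0: "Idl\<^bsub>RR\<^esub> {} = {0 :: 'a}"
  proof -
    have "Idl\<^bsub>RR\<^esub> {} \<subseteq> {0 :: 'a}"
      using genideal_minimal[OF zeroideal, of "{}"] by (simp add: RR_simps)
    moreover have "(0 :: 'a) \<in> Idl\<^bsub>RR\<^esub> {}"
      using additive_subgroup.zero_closed[OF ideal.axioms(1)[OF genideal_ideal[of "{}"]]] by (simp add: RR_simps)
    ultimately show ?thesis
      by blast
  qed
  have "\<exists>xs. regular_sequence xs \<and> set xs \<subseteq> J \<and> xs \<noteq> []"
  proof (rule ccontr)
    assume "\<not> ?thesis"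
    then have "enat (length xs) \<le> 0" if "xs \<in> {xs. regular_sequence xs \<and> set xs \<subseteq> J}" for xs
      using that by (auto simp: zero_enat_def)
    then have "grade J \<le> 0"
      unfolding grade_def using False by (simp only: if_False) (rule SUP_least)
    with assms show False
      by (simp add: le_zero_eq)
  qed
  then obtain xs where xs: "regular_sequence xs" "set xs \<subseteq> J" "xs \<noteq> []"
    by blast
  have "y = 0" if "y * xs ! 0 = 0" for y
  proof -
    have "\<forall>y. y * xs ! 0 \<in> Idl\<^bsub>RR\<^esub> (set (take 0 xs)) \<longrightarrow> y \<in> Idl\<^bsub>RR\<^esub> (set (take 0 xs))"
      using xs unfolding regular_sequence_def by blast
    then show ?thesis
      using that by (simp add: Idl0)
  qed
  moreover have "xs ! 0 \<in> J"
    using xs by (meson length_greater_0_conv nth_mem subsetD)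
  ultimately show ?thesis
    using that by blast
qed

text \<open>
  A cycle in the last exterior power has a single coefficient, annihilated by every \<open>f\<^sub>l\<close> and hence by the
  regular element.
\<close>

lemma top_cycles_of_grade:
  fixes f :: "nat \<Rightarrow> 'a::comm_ring_1"
  assumes "1 \<le> grade (Idl\<^bsub>RR\<^esub> (f ` {..s}))"
  shows "koszul_cycles {..s} f (Suc s) = {0}"
proof -
  obtain x where x: "x \<in> Idl\<^bsub>RR\<^esub> (f ` {..s})" "\<And>y. y * x = 0 \<Longrightarrow> y = 0"
    using grade_ge_1_regular_element[OF assms] by blast
  obtain c where c: "x = (\<Sum>l\<le>s. c l * f l)"
    using x(1) unfolding Idl_image_iff[OF finite_atMost] by blast
  have "z = 0" if z: "z \<in> koszul_cycles {..s} f (Suc s)" for z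
  proof -
    have zc: "z \<in> koszul_chains {..s} (Suc s)" and d: "(\<Sum>k\<le>s. f k * del k z K) = 0" for K
      using z by (simp_all add: koszul_cycles_iff)
    have "z {..s} * f l = 0" if l: "l \<in> {..s}" for l
    proof -
      let ?K = "{..s} - {l}"
      have "(\<Sum>k\<le>s. f k * del k z ?K) = f l * del l z ?K + (\<Sum>k\<in>?K. f k * del k z ?K)"
        by (rule sum.remove) (use l in auto)
      also have "(\<Sum>k\<in>?K. f k * del k z ?K) = 0"
        by (rule sum.neutral) (simp add: del_def)
      also have "del l z ?K = altsign (below ?K l) (z {..s})"
        using l by (simp add: del_def insert_absorb)
      finally have "f l * altsign (below ?K l) (z {..s}) = 0"
        using d[of ?K] by simp
      then have "altsign (below ?K l) (f l * z {..s}) = 0"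
        by (simp only: altsign_mult)
      then show ?thesis
        by (simp add: mult.commute)
    qed
    then have "z {..s} * x = (\<Sum>l\<le>s. 0)"
      unfolding c sum_distrib_left by (intro sum.cong refl) (metis mult.left_commute mult_zero_right)
    then have "z {..s} = 0"
      using x(2) by simp
    moreover have "K = {..s}" if "z K \<noteq> 0" for K
      using koszul_chainsD[OF zc that] card_subset_eq[of "{..s}" K] by simp
    ultimately show ?thesis
      by (intro ext) (metis zero_fun_apply)
  qed
  then show ?thesis
    using koszul_cycles_zero[of "{..s}" f "Suc s"] by auto
qed

context approximation_complex
begin

section \<open>The homology in degree zero\<close>

lemma coef_module_0_zero_outside:
  assumes w: "w \<in> coef_module s f 0" and nz: "w M L \<noteq> 0"
  shows "M = {} \<and> L = {}"
proof -
  have "M \<subseteq> {1..s} \<and> L \<subseteq> {..s} \<and> card M + card L = 0"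
    by (rule coef_module_subset2[OF w nz])
  then show ?thesis
    using finite_subset[of M "{1..s}"] finite_subset[of L "{..s}"] by simp
qed

lemma coef_module_0I: "(\<lambda>M L. if M = {} \<and> L = {} then r else 0) \<in> coef_module s f 0"
proof -
  let ?w = "\<lambda>M L. if M = {} \<and> L = {} then r else (0 :: 'a)"
  have 1: "?w {} \<in> koszul_cycles {..s} f 0"
  proof -
    have ch: "?w {} \<in> koszul_chains {..s} 0"
      by (rule koszul_chainsI) (simp split: if_splits)
    have "del l (?w {}) = 0" for l
      by (rule koszul_chains_0_del[OF finite_atMost ch])
    then show ?thesis
      unfolding koszul_cycles_iff[OF finite_atMost] using ch by simp
  qed
  have "if M \<subseteq> {1..s} \<and> card M \<le> 0 then ?w M \<in> koszul_cycles {..s} f (0 - card M) else ?w M = 0" for M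
  proof (cases "M = {}")
    case True
    then show ?thesis
      using 1 by simp
  next
    case False
    then have "\<not> (M \<subseteq> {1..s} \<and> card M \<le> 0)"
      using finite_subset[of M "{1..s}"] by auto
    moreover have "?w M = 0"
      using False by (simp add: fun_eq_iff)
    ultimately show ?thesis
      by (simp only: if_False)
  qed
  then show ?thesis
    unfolding coef_module_def by blast
qed

lemma D_chains_0_eq: "D_chains s f 0 \<inter> T_homogeneous 0 = constant_chain ` coef_module s f 0"
proof -
  have D: "D_chains s f 0 = loc_chains {} 0"
    unfolding loc_chains_def using D_chains_iff[of _ 0] by blast
  show ?thesis
    unfolding D
  proof (intro equalityI subsetI)
    fix x assume "x \<in> loc_chains {} 0 \<inter> T_homogeneous 0"
    then show "x \<in> constant_chain ` coef_module s f 0"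
      using constant_chainI[of x] loc_chains_coef[of x "{}" 0 0] by blast
  next
    fix x assume "x \<in> constant_chain ` coef_module s f 0"
    then obtain w where w: "w \<in> coef_module s f 0" "x = constant_chain w"
      by blast
    have z: "\<alpha> = 0" if "cof x \<alpha> \<noteq> 0" for \<alpha>
      using that unfolding w(2) cof_constant_chain by presburger
    have loc: "x \<in> loc_chains {} 0"
    proof (rule loc_chainsI)
      fix \<alpha>
      show "cof x \<alpha> \<in> coef_module s f 0"
        by (cases "\<alpha> = 0") (simp_all only: w cof_constant_chain simp_thms if_True if_False coef_module_zero)
      show "mono_ok s {} \<alpha>" if "cof x \<alpha> \<noteq> 0"
        unfolding z[OF that] by (simp add: mono_ok_def)
    qed
    moreover have "deg \<alpha> = - int 0" if "cof x \<alpha> \<noteq> 0" for \<alpha>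
      unfolding z[OF that] by (simp add: deg_def)
    ultimately show "x \<in> loc_chains {} 0 \<inter> T_homogeneous 0"
      unfolding T_homogeneous_iff[OF loc, symmetric] Int_iff using T_homogeneous_iff[OF loc] by blast
  qed
qed

definition dscale :: "'a \<Rightarrow> 'a dchain \<Rightarrow> 'a dchain" where
  "dscale r x = (\<lambda>M L. Const r * x M L)"

lemma dscale_constant_chain: "dscale r (constant_chain w) = constant_chain (wscale r w)"
  by (simp add: dscale_def constant_chain_def Const_def wscale_def mult_single)

lemma constant_chain_diff: "constant_chain v - constant_chain w = constant_chain (v - w)"
  by (simp add: constant_chain_def fun_eq_iff single_diff)

lemma Zplus0_presents:
  "presents dscale (constant_chain ` coef_module s f 0) {0} (\<lambda>x. x) (Zplus0 s f)"
proof -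
  have eq: "Zplus0 s f = module_on dscale (constant_chain ` coef_module s f 0)"
    unfolding Zplus0_def D_chains_0_eq dscale_def[abs_def] ..
  have 1: "dscale r (x - y) = dscale r x - dscale r y" for r x y
    by (simp add: dscale_def fun_eq_iff right_diff_distrib)
  have "constant_chain (0 :: 'a wchain) = 0"
    by (simp add: constant_chain_def fun_eq_iff)
  then have 2: "0 \<in> constant_chain ` coef_module s f 0"
    using coef_module_zero by (metis imageI)
  show ?thesis
    unfolding eq
    by (intro presents_module_on 1 2)
      (auto simp: constant_chain_diff dscale_constant_chain intro!: imageI coef_module_diff coef_module_scale)
qed

text \<open>
  As \<open>psi\<close> is onto \<open>Z\<^sub>1(f)\<close>, the image of \<open>\<tau>\<^sub>0\<close> consists of the coefficients of \<open>e\<^sub>0\<close> in first syzygies of \<open>f\<close>.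
\<close>

lemma image_tau0:
  "tau0 s f ` carrier (Zplus s f 1)
     = {constant_chain w | w. w \<in> coef_module s f 0 \<and> (\<exists>z\<in>koszul_cycles {..s} f 1. w {} {} = z {0})}"
proof -
  have key: "kaps [0..<Suc s] (neg_part c (top_mon 1)) \<in> coef_module s f 0
      \<and> kaps [0..<Suc s] (neg_part c (top_mon 1)) {} {} = psi 1 (neg_part c) {0}"
    if c: "c \<in> top_chains (Suc s)" for c
    unfolding kaps_psi(2)[OF c] using kaps_psi(1)[OF c] by (simp add: del_def below_def del: upt_Suc)
  have carr: "tau0 s f ` carrier (Zplus s f 1)
      = (\<lambda>c. constant_chain (kaps [0..<Suc s] (neg_part c (top_mon 1)))) ` top_chains (Suc s)"
    unfolding presents_carrier[OF Zplus_presents] image_image plus_1_eq_Suc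
    by (rule image_cong[OF refl tau0_cls])
  show ?thesis
    unfolding carr
  proof (intro equalityI subsetI)
    fix x assume "x \<in> (\<lambda>c. constant_chain (kaps [0..<Suc s] (neg_part c (top_mon 1)))) ` top_chains (Suc s)"
    then obtain c where c: "c \<in> top_chains (Suc s)" "x = constant_chain (kaps [0..<Suc s] (neg_part c (top_mon 1)))"
      by blast
    have "psi 1 (neg_part c) \<in> koszul_cycles {..s} f 1"
      by (rule psi_cycle) (use neg_part_inv_chains[OF c(1)] in simp)
    then show "x \<in> {constant_chain w | w. w \<in> coef_module s f 0 \<and> (\<exists>z\<in>koszul_cycles {..s} f 1. w {} {} = z {0})}"
      using key[OF c(1)] c(2) by blast
  next
    fix x assume "x \<in> {constant_chain w | w. w \<in> coef_module s f 0 \<and> (\<exists>z\<in>koszul_cycles {..s} f 1. w {} {} = z {0})}"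
    then obtain w z where w: "x = constant_chain w" "w \<in> coef_module s f 0" "w {} {} = z {0}"
      and z: "z \<in> koszul_cycles {..s} f 1"
      by blast
    obtain e where e: "\<And>i v. psi i (top_elem i (altsign e v)) = v"
      using psi_top_elem by blast
    let ?y = "top_elem 1 (altsign e z)"
    have y: "?y \<in> inv_chains (1 + s)"
      by (intro top_elem_inv_chains koszul_cycles_altsign z finite_atMost zero_less_one)
    have c: "realize ?y \<in> top_chains (Suc s)"
      using realize_top_chains[OF y] by simp
    have "psi 1 (neg_part (realize ?y)) = z"
      by (simp only: neg_part_realize[OF y] e)
    then have k: "kaps [0..<Suc s] (neg_part (realize ?y) (top_mon 1)) \<in> coef_module s f 0"
      "kaps [0..<Suc s] (neg_part (realize ?y) (top_mon 1)) {} {} = w {} {}"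
      using key[OF c] w(3) by simp_all
    have "kaps [0..<Suc s] (neg_part (realize ?y) (top_mon 1)) M L = w M L" for M L
      using coef_module_0_zero_outside[OF k(1), of M L] coef_module_0_zero_outside[OF w(2), of M L] k(2) by metis
    then have "w = kaps [0..<Suc s] (neg_part (realize ?y) (top_mon 1))"
      by (intro ext) (rule sym)
    then show "x \<in> (\<lambda>c. constant_chain (kaps [0..<Suc s] (neg_part c (top_mon 1)))) ` top_chains (Suc s)"
      using c w(1) by blast
  qed
qed

lemma first_syzygy_iff:
  "(\<exists>z\<in>koszul_cycles {..s} f 1. r = z {0}) \<longleftrightarrow> r \<in> colon (Idl\<^bsub>RR\<^esub> (f ` {1..s})) (f 0)"
proof -
  have split: "(\<Sum>l\<le>s. g l) = g 0 + (\<Sum>l\<in>{1..s}. g l)" for g :: "nat \<Rightarrow> 'a"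
  proof -
    have "(\<Sum>l\<le>s. g l) = g 0 + (\<Sum>l\<in>{..s} - {0}. g l)"
      by (rule sum.remove) auto
    also have "{..s} - {0} = {1..s}"
      by auto
    finally show ?thesis .
  qed
  have colon: "r \<in> colon (Idl\<^bsub>RR\<^esub> (f ` {1..s})) (f 0) \<longleftrightarrow> (\<exists>c. r * f 0 = (\<Sum>l\<in>{1..s}. c l * f l))"
    unfolding colon_def mem_Collect_eq by (rule Idl_image_iff) simp
  show ?thesis
    unfolding colon
  proof
    assume "\<exists>z\<in>koszul_cycles {..s} f 1. r = z {0}"
    then obtain z where z: "z \<in> koszul_cycles {..s} f 1" "r = z {0}"
      by blast
    have "(\<Sum>l\<le>s. f l * del l z {}) = 0"
      using z(1) unfolding koszul_cycles_iff[OF finite_atMost] by blast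
    moreover have "del l z {} = z {l}" for l
      by (simp add: del_def below_def)
    ultimately have "f 0 * z {0} + (\<Sum>l\<in>{1..s}. f l * z {l}) = 0"
      by (simp only: split)
    then have "r * f 0 = (\<Sum>l\<in>{1..s}. - z {l} * f l)"
      by (simp add: z(2) sum_negf mult.commute eq_neg_iff_add_eq_0)
    then show "\<exists>c. r * f 0 = (\<Sum>l\<in>{1..s}. c l * f l)"
      by (rule exI[of _ "\<lambda>l. - z {l}"])
  next
    assume "\<exists>c. r * f 0 = (\<Sum>l\<in>{1..s}. c l * f l)"
    then obtain c where c: "r * f 0 = (\<Sum>l\<in>{1..s}. c l * f l)"
      by blast
    define z where "z = (\<lambda>K. if card K = 1 \<and> K \<subseteq> {..s} then (if K = {0} then r else - c (the_elem K)) else 0)"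
    have zs: "z {l} = (if l = 0 then r else - c l)" if "l \<le> s" for l
      using that by (simp add: z_def)
    have zc: "z \<in> koszul_chains {..s} 1"
      by (rule koszul_chainsI) (simp add: z_def split: if_splits)
    have "(\<Sum>l\<le>s. f l * del l z K) = 0" for K
    proof (cases "K = {}")
      case True
      have "del l z {} = z {l}" for l
        by (simp add: del_def below_def)
      then have "(\<Sum>l\<le>s. f l * del l z {}) = (\<Sum>l\<le>s. f l * (if l = 0 then r else - c l))"
        by (intro sum.cong refl) (simp add: zs)
      also have "\<dots> = f 0 * r - (\<Sum>l\<in>{1..s}. f l * c l)"
        by (simp add: split sum_negf)
      also have "\<dots> = 0"
        using c by (simp add: mult.commute)
      finally show ?thesis
        using True by simp
    next
      case False
      have "del l z K = 0" for l
      proof (cases "l \<in> K")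
        case nl: False
        have "card (insert l K) \<noteq> 1"
          using False nl by (auto simp: card_1_singleton_iff)
        then have "z (insert l K) = 0"
          by (simp add: z_def)
        then show ?thesis
          by (simp add: del_def)
      qed (simp add: del_def)
      then show ?thesis
        by simp
    qed
    then have "z \<in> koszul_cycles {..s} f 1"
      unfolding koszul_cycles_iff[OF finite_atMost] using zc by blast
    then show "\<exists>z\<in>koszul_cycles {..s} f 1. r = z {0}"
      using zs[of 0] by (intro bexI[of _ z]) simp_all
  qed
qed

lemma homology_0_iso:
  "isomorphic_modules R (Zplus_homology0 s f)
     (quotient_module (module_on (*) UNIV) (colon (Idl\<^bsub>RR\<^esub> (f ` {1..s})) (f 0)))"
proof -
  let ?A = "constant_chain ` coef_module s f 0"
  let ?J = "colon (Idl\<^bsub>RR\<^esub> (f ` {1..s})) (f 0)"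
  define \<theta> where "\<theta> = (\<lambda>x :: 'a dchain. cof x 0 {} {})"
  have \<theta>c: "\<theta> (constant_chain w) = w {} {}" for w
    by (simp add: \<theta>_def cof_def constant_chain_def)
  have J: "r \<in> ?J \<longleftrightarrow> (\<exists>z\<in>koszul_cycles {..s} f 1. r = z {0})" for r
    using first_syzygy_iff by blast
  have J0: "0 \<in> ?J"
    unfolding J using koszul_cycles_zero[of "{..s}" f 1] by (intro bexI[of _ 0]) simp_all
  have Jd: "x - y \<in> ?J" if xy: "x \<in> ?J" "y \<in> ?J" for x y
  proof -
    obtain u v where uv: "u \<in> koszul_cycles {..s} f 1" "v \<in> koszul_cycles {..s} f 1" "x = u {0}" "y = v {0}"
      using xy unfolding J by blast
    then have "x - y = (u - v) {0}"
      by simp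
    then show ?thesis
      unfolding J using koszul_cycles_diff[OF finite_atMost uv(1,2)] by blast
  qed
  have Js: "r * x \<in> ?J" if x: "x \<in> ?J" for r x
  proof -
    obtain u where u: "u \<in> koszul_cycles {..s} f 1" "x = u {0}"
      using x unfolding J by blast
    have "(\<lambda>K. r * u K) \<in> koszul_cycles {..s} f 1"
      by (rule koszul_cycles_scale[OF finite_atMost u(1)])
    then show ?thesis
      unfolding J by (rule bexI[rotated]) (simp add: u(2))
  qed
  define C where "C = {x \<in> ?A. \<theta> x \<in> ?J}"
  have image: "tau0 s f ` carrier (Zplus s f 1) = (\<lambda>x. x) ` C"
  proof -
    have "x \<in> C \<longleftrightarrow> (\<exists>w. x = constant_chain w \<and> w \<in> coef_module s f 0 \<and> w {} {} \<in> ?J)" for x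
      unfolding C_def using \<theta>c by auto
    then show ?thesis
      unfolding image_tau0 image_ident J[symmetric] by (intro equalityI subsetI) simp_all
  qed
  have \<theta>d: "\<theta> (x - y) = \<theta> x - \<theta> y" for x y
    by (simp add: \<theta>_def cof_diff)
  have \<theta>a: "\<theta> (x + y) = \<theta> x + \<theta> y" for x y
    by (simp add: \<theta>_def cof_add)
  have \<theta>s: "\<theta> (dscale r x) = r * \<theta> x" for r x
    unfolding \<theta>_def dscale_def cof_Const by (simp add: wscale_def)
  note A = Zplus0_presents
  have Ad: "0 \<in> ?A" "\<And>x y. x \<in> ?A \<Longrightarrow> y \<in> ?A \<Longrightarrow> x - y \<in> ?A" "\<And>r x. x \<in> ?A \<Longrightarrow> dscale r x \<in> ?A"
    using A unfolding presents_def by blast+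
  have \<theta>0: "\<theta> 0 = 0"
    by (simp add: \<theta>_def)
  have C: "C \<subseteq> ?A" "0 \<in> C" "\<And>x y. x \<in> C \<Longrightarrow> y \<in> C \<Longrightarrow> x - y \<in> C" "\<And>r x. x \<in> C \<Longrightarrow> dscale r x \<in> C"
    "\<And>x. x \<in> ?A \<Longrightarrow> x \<in> {0} \<Longrightarrow> x \<in> C"
    unfolding C_def using Ad J0 Jd Js by (simp_all add: \<theta>d \<theta>s \<theta>0)
  have Q: "presents dscale ?A C (\<lambda>x. (\<lambda>x. x) ` C +>\<^bsub>Zplus0 s f\<^esub> x) (Zplus_homology0 s f)"
    unfolding Zplus_homology0_def image by (rule presents_quotient[OF A C refl])
  have U: "presents (*) UNIV {0} (\<lambda>x :: 'a. x) (module_on (*) UNIV)"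
    by (rule presents_module_on) (simp_all add: right_diff_distrib)
  have Q': "presents (*) UNIV ?J (\<lambda>x. ?J +>\<^bsub>module_on (*) UNIV\<^esub> x) (quotient_module (module_on (*) UNIV) ?J)"
    by (rule presents_quotient[OF U]) (use J0 Jd Js in auto)
  have surj: "\<theta> ` ?A = UNIV"
  proof -
    have "r \<in> \<theta> ` ?A" for r
      using imageI[OF imageI[OF coef_module_0I[of r], of constant_chain], of \<theta>] by (simp add: \<theta>c)
    then show ?thesis
      by blast
  qed
  have ker: "\<theta> x \<in> ?J \<longleftrightarrow> x \<in> C" if "x \<in> ?A" for x
    unfolding C_def using that by blast
  show ?thesis
  proof (rule presents_iso[OF Q Q' \<theta>a \<theta>d \<theta>s surj ker, where R = R])
    fix h
    assume "h \<in> module_iso R (Zplus_homology0 s f) (quotient_module (module_on (*) UNIV) ?J)"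
    then show ?thesis
      unfolding isomorphic_modules_def by blast
  qed
qed

end

section \<open>Homogeneous components\<close>

locale graded =
  fixes G :: "int \<Rightarrow> 'a::comm_ring_1 set"
  assumes graded: "graded_ring G"
begin

lemma G_additive: "additive_subgroup (G n) (RR :: 'a ring)"
  using graded unfolding graded_ring_def by blast

lemma G_zero: "0 \<in> G n"
  using additive_subgroup.zero_closed[OF G_additive] by (simp add: RR_simps)

lemma G_add: "x \<in> G n \<Longrightarrow> y \<in> G n \<Longrightarrow> x + y \<in> G n"
  using additive_subgroup.a_closed[OF G_additive, of x n y] by (simp add: RR_simps)

lemma G_mult: "x \<in> G m \<Longrightarrow> y \<in> G n \<Longrightarrow> x * y \<in> G (m + n)"
  using graded unfolding graded_ring_def by blast

lemma G_uminus:
  assumes "x \<in> G n"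
  shows "- x \<in> G n"
proof -
  interpret ring "RR :: 'a ring"
    by (rule ring_from_type_algebra)
  have "a_inv RR x = - x"
    using minus_equality[of "- x" x] by (simp add: RR_simps)
  moreover have "a_inv RR x \<in> G n"
    using subgroup.m_inv_closed[OF additive_subgroup.a_subgroup[OF G_additive] assms] by (simp add: a_inv_def)
  ultimately show ?thesis
    by simp
qed

lemma G_altsign: "x \<in> G n \<Longrightarrow> altsign k x \<in> G n"
  by (simp add: altsign_def G_uminus)

definition decomposes :: "(int \<Rightarrow> 'a) \<Rightarrow> 'a \<Rightarrow> bool" where
  "decomposes c x \<longleftrightarrow> (\<forall>n. c n \<in> G n) \<and> finite {n. c n \<noteq> 0} \<and> x = (\<Sum>n | c n \<noteq> 0. c n)"

lemma ex1_decomposes: "\<exists>!c. decomposes c x"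
  using graded unfolding graded_ring_def decomposes_def by blast

lemma decomposesI:
  assumes "\<And>n. c n \<in> G n" "finite S" "\<And>n. n \<notin> S \<Longrightarrow> c n = 0" "x = (\<Sum>n\<in>S. c n)"
  shows "decomposes c x"
proof -
  have sub: "{n. c n \<noteq> 0} \<subseteq> S"
    using assms(3) by blast
  have "(\<Sum>n\<in>S. c n) = (\<Sum>n | c n \<noteq> 0. c n)"
    by (rule sum.mono_neutral_right[OF assms(2) sub]) auto
  then show ?thesis
    unfolding decomposes_def using assms finite_subset[OF sub] by simp
qed

definition component :: "int \<Rightarrow> 'a \<Rightarrow> 'a" where
  "component n x = (THE c. decomposes c x) n"

lemma decomposes_component: "decomposes (\<lambda>n. component n x) x"
  unfolding component_def using theI'[OF ex1_decomposes[of x]] by simp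

lemma component_eqI: "decomposes c x \<Longrightarrow> component n x = c n"
  using ex1_decomposes[of x] decomposes_component[of x] by (metis (mono_tags))

lemma component_in: "component n x \<in> G n"
  using decomposes_component[of x] unfolding decomposes_def by blast

lemma component_homogeneous: "x \<in> G m \<Longrightarrow> component n x = (if n = m then x else 0)"
  by (rule component_eqI, rule decomposesI[where S = "{m}"]) (simp_all add: G_zero)

lemma component_zero [simp]: "component n 0 = 0"
  using component_homogeneous[OF G_zero[of n], of n] by simp

lemma component_add: "component n (x + y) = component n x + component n y"
proof (rule component_eqI)
  let ?S = "{n. component n x \<noteq> 0} \<union> {n. component n y \<noteq> 0}"
  have fin: "finite {n. component n x \<noteq> 0}" "finite {n. component n y \<noteq> 0}"
    and xy: "x = (\<Sum>n | component n x \<noteq> 0. component n x)" "y = (\<Sum>n | component n y \<noteq> 0. component n y)"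
    using decomposes_component[of x] decomposes_component[of y] unfolding decomposes_def by blast+
  have "(\<Sum>n | component n x \<noteq> 0. component n x) = (\<Sum>n\<in>?S. component n x)"
    "(\<Sum>n | component n y \<noteq> 0. component n y) = (\<Sum>n\<in>?S. component n y)"
    by (rule sum.mono_neutral_left; use fin in auto)+
  with xy have "x = (\<Sum>n\<in>?S. component n x)" "y = (\<Sum>n\<in>?S. component n y)"
    by simp_all
  then have "x + y = (\<Sum>n\<in>?S. component n x + component n y)"
    by (simp only: sum.distrib)
  then show "decomposes (\<lambda>n. component n x + component n y) (x + y)"
    using fin by (intro decomposesI[where S = ?S] G_add component_in) auto
qed

lemma component_uminus: "component n (- x) = - component n x"
  using component_add[of n x "- x"] by (simp add: eq_neg_iff_add_eq_0 add.commute)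

lemma component_diff: "component n (x - y) = component n x - component n y"
  using component_add[of n x "- y"] by (simp add: component_uminus)

lemma component_altsign: "component n (altsign k x) = altsign k (component n x)"
  by (simp add: altsign_def component_uminus)

lemma component_sum: "component n (sum g A) = (\<Sum>a\<in>A. component n (g a))"
  by (induction A rule: infinite_finite_induct) (simp_all add: component_add)

lemma component_mult:
  assumes y: "y \<in> G m"
  shows "component n (y * x) = y * component (n - m) x"
proof (rule component_eqI)
  have fin: "finite {n. component n x \<noteq> 0}" and x: "x = (\<Sum>n | component n x \<noteq> 0. component n x)"
    using decomposes_component[of x] unfolding decomposes_def by blast+
  let ?S = "(\<lambda>n. n + m) ` {n. component n x \<noteq> 0}"
  show "decomposes (\<lambda>n. y * component (n - m) x) (y * x)"
  proof (rule decomposesI[where S = ?S])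
    show "y * component (n - m) x \<in> G n" for n
      using G_mult[OF y component_in[of "n - m" x]] by simp
    show "finite ?S"
      using fin by simp
    show "y * component (n - m) x = 0" if "n \<notin> ?S" for n
    proof -
      have "component (n - m) x = 0"
        using that by (metis (mono_tags, lifting) diff_add_cancel image_eqI mem_Collect_eq)
      then show ?thesis
        by simp
    qed
    have "(\<Sum>n\<in>?S. y * component (n - m) x) = (\<Sum>n | component n x \<noteq> 0. y * component n x)"
      by (subst sum.reindex) (simp_all add: inj_on_def)
    also have "\<dots> = y * (\<Sum>n | component n x \<noteq> 0. component n x)"
      by (rule sum_distrib_left[symmetric])
    also have "\<dots> = y * x"
      by (simp only: x[symmetric])
    finally show "y * x = (\<Sum>n\<in>?S. y * component (n - m) x)" ..
  qed
qed

end

locale graded_sequence = approximation_complex s f + graded G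
  for s :: nat and f :: "nat \<Rightarrow> 'a::comm_ring_1" and G :: "int \<Rightarrow> 'a set" +
  fixes dg :: "nat \<Rightarrow> int"
  assumes f_homogeneous: "\<And>l. l \<le> s \<Longrightarrow> f l \<in> G (dg l)"
begin

definition koszul_component :: "int \<Rightarrow> (nat set \<Rightarrow> 'a) \<Rightarrow> nat set \<Rightarrow> 'a" where
  "koszul_component e v = (\<lambda>K. component (e - (\<Sum>k\<in>K. dg k)) (v K))"

lemma koszul_component_homogeneous: "koszul_component e v \<in> koszul_homogeneous G dg e"
  unfolding koszul_homogeneous_def koszul_component_def by (simp add: component_in)

lemma koszul_component_eq: "v \<in> koszul_homogeneous G dg e \<Longrightarrow> koszul_component e v = v"
proof
  fix K assume "v \<in> koszul_homogeneous G dg e"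
  then have "v K \<in> G (e - (\<Sum>k\<in>K. dg k))"
    unfolding koszul_homogeneous_def by blast
  then show "koszul_component e v K = v K"
    unfolding koszul_component_def using component_homogeneous by simp
qed

lemma koszul_component_diff: "koszul_component e (v - w) = koszul_component e v - koszul_component e w"
  by (simp add: koszul_component_def fun_eq_iff component_diff)

lemma koszul_component_chains:
  assumes "v \<in> koszul_chains N p"
  shows "koszul_component e v \<in> koszul_chains N p"
proof (rule koszul_chainsI)
  fix K assume "koszul_component e v K \<noteq> 0"
  then have "v K \<noteq> 0"
    unfolding koszul_component_def by (metis component_zero)
  then show "K \<subseteq> N \<and> card K = p"
    by (rule koszul_chainsD[OF assms])
qed

lemma koszul_component_kscale: "koszul_component (e + dg 0) (kscale (f 0) v) = kscale (f 0) (koszul_component e v)"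
proof
  fix K
  have "e + dg 0 - sum dg K - dg 0 = e - sum dg K"
    by simp
  then show "koszul_component (e + dg 0) (kscale (f 0) v) K = kscale (f 0) (koszul_component e v) K"
    unfolding koszul_component_def kscale_def component_mult[OF f_homogeneous[OF le0]] by (simp only:)
qed

text \<open>
  The differential preserves degrees, so it commutes with the passage to homogeneous components.
\<close>

lemma kdiff_koszul_component:
  assumes v: "v \<in> koszul_chains {..s} p"
  shows "kdiff s f (koszul_component e v) = koszul_component e (kdiff s f v)"
proof
  fix K
  have "f l * del l (koszul_component e v) K = component (e - sum dg K) (f l * del l v K)" if l: "l \<in> {..s}" for l
  proof (cases "l \<in> K \<or> infinite K")
    case True
    have "v (insert l K) = 0" if "infinite K"
    proof (rule ccontr)
      assume "v (insert l K) \<noteq> 0"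
      then have "insert l K \<subseteq> {..s}"
        using koszul_chainsD[OF v] by blast
      then show False
        using that finite_subset by fastforce
    qed
    then show ?thesis
      using True by (auto simp: del_def koszul_component_def)
  next
    case False
    then have "e - sum dg K - dg l = e - sum dg (insert l K)"
      by simp
    then show ?thesis
      using False l component_mult[OF f_homogeneous[of l], of "e - sum dg K" "v (insert l K)"]
      by (simp only: atMost_iff) (simp add: del_def koszul_component_def altsign_mult[symmetric] component_altsign)
  qed
  then show "kdiff s f (koszul_component e v) K = koszul_component e (kdiff s f v) K"
    by (simp add: kdiff_def koszul_component_def component_sum)
qed

lemma koszul_component_cycles:
  assumes v: "v \<in> koszul_cycles {1..s} f p"
  shows "koszul_component e v \<in> koszul_cycles {1..s} f p"
proof -
  have v': "v \<in> koszul_chains {..s} p" "kdiff s f v = 0" "v \<in> koszul_chains {1..s} p"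
    using v koszul_cycles_a_iff koszul_cycles_kdiff del_0_zero_iff by blast+
  have k: "koszul_component e 0 = 0"
    by (simp add: koszul_component_def fun_eq_iff)
  have "kdiff s f (koszul_component e v) = 0"
    unfolding kdiff_koszul_component[OF v'(1)] v'(2) by (rule k)
  moreover have "koszul_component e v \<in> koszul_chains {1..s} p"
    by (rule koszul_component_chains[OF v'(3)])
  ultimately show ?thesis
    unfolding koszul_cycles_a_iff koszul_cycles_kdiff using del_0_zero_iff by blast
qed

lemma koszul_component_boundaries:
  assumes "v \<in> koszul_boundaries s f p"
  shows "koszul_component e v \<in> koszul_boundaries s f p"
proof -
  obtain u where u: "u \<in> koszul_chains {1..s} (Suc p)" "v = kdiff s f u"
    using assms unfolding koszul_boundaries_def by blast
  have u': "u \<in> koszul_chains {..s} (Suc p)"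
    using u(1) del_0_zero_iff by blast
  have "koszul_component e v = kdiff s f (koszul_component e u)"
    unfolding u(2) by (rule kdiff_koszul_component[OF u', symmetric])
  then show ?thesis
    unfolding koszul_boundaries_def using koszul_component_chains[OF u(1)] by blast
qed

text \<open>
  Homogeneous elements of degree \<open>\<delta>\<close> among the coefficients. Infinite sets are excluded because sums over them
  are \<open>0\<close>, which would spoil the degrees; they carry no coefficients.
\<close>

definition homogeneous_coefs :: "int \<Rightarrow> 'a wchain set" where
  "homogeneous_coefs \<delta> = {w. \<forall>M L. finite M \<longrightarrow> finite L \<longrightarrow> w M L \<in> G (\<delta> - (\<Sum>m\<in>M. dg m) - (\<Sum>l\<in>L. dg l))}"

lemma kap_homogeneous_coefs:
  assumes w: "w \<in> homogeneous_coefs \<delta>"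
  shows "kap l w \<in> homogeneous_coefs (\<delta> - dg l)"
  unfolding homogeneous_coefs_def
proof (intro CollectI allI impI)
  fix M L :: "nat set"
  assume fin: "finite M" "finite L"
  have w': "w M L \<in> G (\<delta> - (\<Sum>m\<in>M. dg m) - (\<Sum>l\<in>L. dg l))" if "finite M" "finite L" for M L
    using w that unfolding homogeneous_coefs_def by blast
  have 1: "del l w M L \<in> G (\<delta> - dg l - sum dg M - sum dg L)"
  proof (cases "l \<in> M")
    case False
    then have "\<delta> - sum dg (insert l M) - sum dg L = \<delta> - dg l - sum dg M - sum dg L"
      using fin by simp
    moreover have "w (insert l M) L \<in> G (\<delta> - sum dg (insert l M) - sum dg L)"
      by (rule w') (use fin in simp_all)
    ultimately have "w (insert l M) L \<in> G (\<delta> - dg l - sum dg M - sum dg L)"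
      by (simp only:)
    with False show ?thesis
      by (simp add: del_def altsign_apply G_altsign)
  qed (simp add: del_def G_zero)
  have 2: "del l (w M) L \<in> G (\<delta> - dg l - sum dg M - sum dg L)"
  proof (cases "l \<in> L")
    case False
    then have "\<delta> - sum dg M - sum dg (insert l L) = \<delta> - dg l - sum dg M - sum dg L"
      using fin by simp
    moreover have "w M (insert l L) \<in> G (\<delta> - sum dg M - sum dg (insert l L))"
      by (rule w') (use fin in simp_all)
    ultimately have "w M (insert l L) \<in> G (\<delta> - dg l - sum dg M - sum dg L)"
      by (simp only:)
    with False show ?thesis
      by (simp add: del_def G_altsign)
  qed (simp add: del_def G_zero)
  show "kap l w M L \<in> G (\<delta> - dg l - sum dg M - sum dg L)"
    using fin(1) 1 2 by (simp add: kap_def altsign_apply G_add G_altsign)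
qed

lemma kaps_homogeneous_coefs: "w \<in> homogeneous_coefs \<delta> \<Longrightarrow> kaps ls w \<in> homogeneous_coefs (\<delta> - sum_list (map dg ls))"
proof (induction ls)
  case (Cons l ls)
  have "\<delta> - sum_list (map dg ls) - dg l = \<delta> - sum_list (map dg (l # ls))"
    by simp
  then show ?case
    using kap_homogeneous_coefs[OF Cons.IH[OF Cons.prems], of l] by (simp only: kaps_Cons)
qed simp

text \<open>
  The degree \<open>-i deg b\<close> in this formula is the source of the shift: an element of degree \<open>d\<close> in \<open>\<^sub>0\<Z>\<^sup>+\<^sub>i\<close>
  corresponds to one of degree \<open>d + i deg b\<close> in \<open>Z\<^sub>i(a)\<close>, and multiplication by \<open>b\<close> adds another \<open>deg b\<close>.
\<close>

lemma weight_top_mon: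
  assumes i: "0 < i"
  shows "(\<Sum>j\<in>Poly_Mapping.keys (top_mon i). Poly_Mapping.lookup (top_mon i) j * dg j)
    = - int i * dg 0 - (\<Sum>j\<in>{1..s}. dg j)"
proof -
  have keys: "Poly_Mapping.keys (top_mon i) = insert 0 {1..s}"
    using i by (auto simp: in_keys_iff lookup_top_mon split: if_splits)
  have "(\<Sum>j\<in>{1..s}. Poly_Mapping.lookup (top_mon i) j * dg j) = (\<Sum>j\<in>{1..s}. - dg j)"
    by (rule sum.cong) (simp_all add: lookup_top_mon)
  then show ?thesis
    unfolding keys by (simp add: lookup_top_mon sum_negf)
qed

lemma psi_homogeneous:
  assumes i: "0 < i" and c: "c \<in> hcycles i" "c \<in> bihomogeneous G dg d 0"
  shows "psi i (neg_part c) \<in> koszul_homogeneous G dg (d + int i * dg 0)"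
proof -
  have "cof (c {..s}) (top_mon i) M L \<in> G (d + int i * dg 0 + (\<Sum>j\<in>{1..s}. dg j) - sum dg M - sum dg L)" for M L
  proof -
    have "Poly_Mapping.lookup (c {..s} M L) (top_mon i) \<in>
        G (d - (\<Sum>j\<in>Poly_Mapping.keys (top_mon i). Poly_Mapping.lookup (top_mon i) j * dg j)
             - (\<Sum>m\<in>M. dg m) - (\<Sum>l\<in>L. dg l))"
      using c(2) unfolding bihomogeneous_def by blast
    then show ?thesis
      unfolding weight_top_mon[OF i] cof_def by (simp add: algebra_simps)
  qed
  then have "neg_part c (top_mon i) \<in> homogeneous_coefs (d + int i * dg 0 + (\<Sum>j\<in>{1..s}. dg j))"
    unfolding homogeneous_coefs_def by (simp only: neg_part_def neg_top_mon[OF i] if_True) blast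
  then have w: "kaps [1..<Suc s] (neg_part c (top_mon i)) \<in>
      homogeneous_coefs (d + int i * dg 0 + (\<Sum>j\<in>{1..s}. dg j) - sum_list (map dg [1..<Suc s]))"
    by (rule kaps_homogeneous_coefs)
  have "sum_list (map dg [1..<Suc s]) = (\<Sum>j\<in>{1..s}. dg j)"
    by (simp only: interv_sum_list_conv_sum_set_nat set_upt atLeastLessThanSuc_atLeastAtMost)
  then have "d + int i * dg 0 + (\<Sum>j\<in>{1..s}. dg j) - sum_list (map dg [1..<Suc s]) = d + int i * dg 0"
    by simp
  with w have w: "kaps [1..<Suc s] (neg_part c (top_mon i)) \<in> homogeneous_coefs (d + int i * dg 0)"
    by (simp only:)
  have "psi i (neg_part c) L \<in> G (d + int i * dg 0 - sum dg L)" for L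
  proof (cases "finite L")
    case True
    then have "kaps [1..<Suc s] (neg_part c (top_mon i)) {} L \<in> G (d + int i * dg 0 - sum dg {} - sum dg L)"
      using w unfolding homogeneous_coefs_def by blast
    then show ?thesis
      by (simp add: psi_def del: upt_Suc)
  next
    case False
    have ch: "psi i (neg_part c) \<in> koszul_chains {1..s} i"
      using psi_hcycles[OF c(1)] unfolding koszul_cycles_def by blast
    have "psi i (neg_part c) L = 0"
    proof (rule ccontr)
      assume "psi i (neg_part c) L \<noteq> 0"
      then have "L \<subseteq> {1..s}"
        using koszul_chainsD[OF ch] by simp
      with False show False
        using finite_subset[of L "{1..s}"] by simp
    qed
    then show ?thesis
      by (simp add: G_zero)
  qed
  then show ?thesis
    unfolding koszul_homogeneous_def by blast
qed

lemma top_elem_bihomogeneous: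
  assumes i: "0 < i" and v: "v \<in> koszul_cycles {..s} f i" "v \<in> koszul_homogeneous G dg (d + int i * dg 0)"
  shows "realize (top_elem i (altsign e v)) \<in> bihomogeneous G dg d 0"
proof -
  let ?x = "top_elem i (altsign e v)"
  have x: "?x \<in> inv_chains (i + s)"
    by (intro top_elem_inv_chains koszul_cycles_altsign v i finite_atMost)
  have "realize ?x \<in> T_homogeneous_C 0"
    using realize_top_chains[OF x] unfolding top_chains_def by blast
  moreover have "Poly_Mapping.lookup (realize ?x J M L) \<alpha> \<in>
      G (d - (\<Sum>j\<in>Poly_Mapping.keys \<alpha>. Poly_Mapping.lookup \<alpha> j * dg j) - (\<Sum>m\<in>M. dg m) - (\<Sum>l\<in>L. dg l))"
    for J M L \<alpha>
  proof (cases "J = {..s} \<and> \<alpha> = top_mon i \<and> M = {1..s}")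
    case True
    have "Poly_Mapping.lookup (realize ?x {..s} M L) \<alpha> = ?x \<alpha> M L"
      using cof_realize[OF x, of \<alpha>] unfolding cof_def by (metis)
    also have "\<dots> = altsign e (v L)"
      using True by (simp add: top_elem_def altsign_apply)
    finally have l: "Poly_Mapping.lookup (realize ?x J M L) \<alpha> = altsign e (v L)"
      using True by simp
    have "altsign e (v L) \<in> G (d + int i * dg 0 - sum dg L)"
      using v(2) unfolding koszul_homogeneous_def by (simp add: G_altsign)
    moreover have "d + int i * dg 0 - sum dg L =
        d - (\<Sum>j\<in>Poly_Mapping.keys \<alpha>. Poly_Mapping.lookup \<alpha> j * dg j) - (\<Sum>m\<in>M. dg m) - (\<Sum>l\<in>L. dg l)"
      using True weight_top_mon[OF i] by simp
    ultimately show ?thesis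
      unfolding l by (simp only:)
  next
    case False
    have "Poly_Mapping.lookup (realize ?x J M L) \<alpha> = 0"
    proof (cases "J = {..s}")
      case True
      have "Poly_Mapping.lookup (realize ?x {..s} M L) \<alpha> = ?x \<alpha> M L"
        using cof_realize[OF x, of \<alpha>] unfolding cof_def by (metis)
      also have "\<dots> = 0"
      proof -
        have "\<not> (\<alpha> = top_mon i \<and> M = {1..s})"
          using True False by blast
        then show ?thesis
          by (simp only: top_elem_def if_False zero_fun_apply)
      qed
      finally show ?thesis
        by (simp only: True)
    qed (simp add: realize_def)
    then show ?thesis
      by (simp add: G_zero)
  qed
  ultimately show ?thesis
    unfolding bihomogeneous_def by blast
qed

lemma Zplus_homology_part_eq:
  assumes i: "0 < i"
  shows "Zplus_homology_part G dg s f i d = hclass i ` (hcycles i \<inter> bihomogeneous G dg d 0)"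
proof -
  have hom: "cls (i + s) x \<in> classes_of (bihomogeneous G dg d 0) (Zplus s f i) \<longleftrightarrow>
      (\<exists>x'\<in>bihomogeneous G dg d 0. x' \<in> hcycles i \<and> cls (i + s) x' = cls (i + s) x)"
    if x: "x \<in> hcycles i" for x
  proof
    have xt: "x \<in> top_chains (i + s)"
      using x hcycles_top by blast
    note xc = top_chains_cech[OF xt]
    assume "cls (i + s) x \<in> classes_of (bihomogeneous G dg d 0) (Zplus s f i)"
    then obtain c where c: "c \<in> cls (i + s) x" "c \<in> bihomogeneous G dg d 0"
      unfolding classes_of_def by blast
    note m = cls_memD[OF xc c(1)]
    have "c \<in> T_homogeneous_C 0"
      using c(2) unfolding bihomogeneous_def by blast
    then have "c \<in> hcycles i"
      using x m unfolding hcycles_def mem_Collect_eq m(2) top_chains_def by blast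
    moreover have "cls (i + s) c = cls (i + s) x"
      by (rule cls_eqI[OF m(1) xc m(2)])
    ultimately show "\<exists>x'\<in>bihomogeneous G dg d 0. x' \<in> hcycles i \<and> cls (i + s) x' = cls (i + s) x"
      using c(2) by blast
  next
    assume "\<exists>x'\<in>bihomogeneous G dg d 0. x' \<in> hcycles i \<and> cls (i + s) x' = cls (i + s) x"
    then obtain x' where x': "x' \<in> bihomogeneous G dg d 0" "x' \<in> hcycles i" "cls (i + s) x' = cls (i + s) x"
      by blast
    have xt: "x' \<in> top_chains (i + s)"
      using x'(2) hcycles_top by blast
    have "x' \<in> cls (i + s) x'"
      by (rule cls_self[OF top_chains_cech[OF xt]])
    moreover have "cls (i + s) x' \<in> carrier (Zplus s f i)"
      unfolding presents_carrier[OF Zplus_presents] using xt by (rule imageI)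
    ultimately show "cls (i + s) x \<in> classes_of (bihomogeneous G dg d 0) (Zplus s f i)"
      unfolding classes_of_def mem_Collect_eq x'(3)[symmetric] using x'(1) by blast
  qed
  show ?thesis
    unfolding Zplus_homology_part_def Zplus_homology_eq[OF i] hclass_def[abs_def]
    by (rule classes_of_presented_quotient[OF hcycles_module_presents hboundaries_closed refl hom])
qed

lemma multiple_part_eq:
  assumes i: "0 < i"
  shows "multiple_part G dg {1..s} f (f 0) i e =
    (\<lambda>v. koszul_class s f i (kscale (f 0) v)) ` koszul_cycles {1..s} f i
    \<inter> koszul_class s f i ` (koszul_cycles {1..s} f i \<inter> koszul_homogeneous G dg e)"
proof -
  obtain j where j: "i = Suc j"
    using i by (cases i) auto
  have "carrier (multiple_module (f 0) (koszul_homology {1..s} f (Suc j)))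
      = (\<lambda>v. koszul_class s f (Suc j) (kscale (f 0) v)) ` koszul_cycles {1..s} f (Suc j)"
    by (rule presents_carrier[OF presents_multiple_module[OF koszul_homology_presents]])
      (simp add: kscale_def fun_eq_iff mult.left_commute)
  then show ?thesis
    unfolding multiple_part_def koszul_homology_part_def j classes_of_koszul_homology by (simp only:)
qed

text \<open>
  The isomorphism and the section of \<open>psi\<close> respect degrees on representatives. A homogeneous class of
  \<open>b H\<^sub>i(a)\<close> is that of \<open>b v\<close> for some \<open>v\<close>, and \<open>v\<close> may be replaced by its homogeneous component.
\<close>

lemma homology_iso_graded:
  assumes i: "0 < i"
    and h: "\<And>c. c \<in> hcycles i \<Longrightarrow> h (hclass i c) = koszul_class s f i (kscale (f 0) (psi i (neg_part c)))"
  shows "h ` Zplus_homology_part G dg s f i d = multiple_part G dg {1..s} f (f 0) i (d + (int i + 1) * dg 0)"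
proof -
  let ?e = "d + (int i + 1) * dg 0"
  have e: "?e = (d + int i * dg 0) + dg 0"
    by (simp add: algebra_simps)
  obtain j where j: "i = Suc j"
    using i by (cases i) auto
  have scale: "kscale (f 0) v \<in> koszul_homogeneous G dg ?e" if "v \<in> koszul_homogeneous G dg (d + int i * dg 0)" for v
    unfolding koszul_homogeneous_def
  proof (intro CollectI allI)
    fix K
    have "v K \<in> G (d + int i * dg 0 - sum dg K)"
      using that unfolding koszul_homogeneous_def by blast
    then have "f 0 * v K \<in> G (dg 0 + (d + int i * dg 0 - sum dg K))"
      by (rule G_mult[OF f_homogeneous[OF le0]])
    then show "kscale (f 0) v K \<in> G (?e - sum dg K)"
      by (simp add: kscale_def algebra_simps)
  qed
  have cyc: "kscale (f 0) v \<in> koszul_cycles {1..s} f i" if "v \<in> koszul_cycles {1..s} f i" for v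
    unfolding kscale_def by (rule koszul_cycles_scale[OF finite_atLeastAtMost that])
  have "h ` Zplus_homology_part G dg s f i d
      = (\<lambda>c. koszul_class s f i (kscale (f 0) (psi i (neg_part c)))) ` (hcycles i \<inter> bihomogeneous G dg d 0)"
    unfolding Zplus_homology_part_eq[OF i] image_image by (rule image_cong[OF refl]) (use h in blast)
  also have "\<dots> = multiple_part G dg {1..s} f (f 0) i ?e"
    unfolding multiple_part_eq[OF i]
  proof (intro equalityI subsetI)
    fix Y assume "Y \<in> (\<lambda>c. koszul_class s f i (kscale (f 0) (psi i (neg_part c)))) ` (hcycles i \<inter> bihomogeneous G dg d 0)"
    then obtain c where c: "c \<in> hcycles i" "c \<in> bihomogeneous G dg d 0"
      "Y = koszul_class s f i (kscale (f 0) (psi i (neg_part c)))"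
      by blast
    note p = psi_hcycles[OF c(1)]
    show "Y \<in> (\<lambda>v. koszul_class s f i (kscale (f 0) v)) ` koszul_cycles {1..s} f i
      \<inter> koszul_class s f i ` (koszul_cycles {1..s} f i \<inter> koszul_homogeneous G dg ?e)"
      unfolding c(3) using p cyc[OF p] scale[OF psi_homogeneous[OF i c(1,2)]]
      by (intro IntI imageI) simp_all
  next
    fix Y assume "Y \<in> (\<lambda>v. koszul_class s f i (kscale (f 0) v)) ` koszul_cycles {1..s} f i
      \<inter> koszul_class s f i ` (koszul_cycles {1..s} f i \<inter> koszul_homogeneous G dg ?e)"
    then obtain v w where v: "v \<in> koszul_cycles {1..s} f i" "Y = koszul_class s f i (kscale (f 0) v)"
      and w: "w \<in> koszul_cycles {1..s} f i" "w \<in> koszul_homogeneous G dg ?e" "Y = koszul_class s f i w"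
      by blast
    note eq_iff = presents_eq_iff[OF koszul_homology_presents[of s f j], folded j]
    have B: "kscale (f 0) v - w \<in> koszul_boundaries s f i"
      using eq_iff[OF cyc[OF v(1)] w(1)] v(2) w(3) by blast
    define v' where "v' = koszul_component (d + int i * dg 0) v"
    have v': "v' \<in> koszul_cycles {1..s} f i" "v' \<in> koszul_homogeneous G dg (d + int i * dg 0)"
      unfolding v'_def by (rule koszul_component_cycles[OF v(1)], rule koszul_component_homogeneous)
    have "koszul_component ?e (kscale (f 0) v - w) = kscale (f 0) v' - w"
      unfolding koszul_component_diff koszul_component_eq[OF w(2)] unfolding e koszul_component_kscale v'_def ..
    then have "kscale (f 0) v' - w \<in> koszul_boundaries s f i"
      using koszul_component_boundaries[OF B, of ?e] by (simp only:)
    then have Y: "Y = koszul_class s f i (kscale (f 0) v')"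
      using eq_iff[OF cyc[OF v'(1)] w(1)] w(3) by blast
    obtain k where "\<And>v. v \<in> koszul_cycles {1..s} f i \<Longrightarrow> realize (top_elem i (altsign k v)) \<in> hcycles i \<and>
      psi i (neg_part (realize (top_elem i (altsign k v)))) = v"
      using hcycles_lift[OF i] by blast
    note k = this[OF v'(1)]
    have "realize (top_elem i (altsign k v')) \<in> bihomogeneous G dg d 0"
      using v' koszul_cycles_a_iff by (intro top_elem_bihomogeneous i) blast+
    then show "Y \<in> (\<lambda>c. koszul_class s f i (kscale (f 0) (psi i (neg_part c)))) ` (hcycles i \<inter> bihomogeneous G dg d 0)"
      using k Y by (intro image_eqI[of _ _ "realize (top_elem i (altsign k v'))"]) simp_all
  qed
  finally show ?thesis .
qed

end

lemma koszul_homology_cong: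
  assumes "\<And>l. l \<in> N \<Longrightarrow> f l = g l"
  shows "koszul_homology N f p = koszul_homology N g p"
proof -
  have "koszul_diff N (\<lambda>l v. f l * v) = koszul_diff N (\<lambda>l v. g l * v)"
    using assms by (intro ext) (simp add: koszul_diff_def)
  then show ?thesis
    unfolding koszul_homology_def by (simp only:)
qed

section \<open>The homology of \<open>\<^sub>0\<Z>\<^sup>+\<close>\<close>

theorem theorem4p4:
  fixes a :: "nat \<Rightarrow> 'a::comm_ring_1" and b :: 'a and s :: nat
  assumes noeth: "noetherian_ring (RR :: 'a ring)"
    and grade: "grade (Idl\<^bsub>RR\<^esub> (insert b (a ` {1..s}))) \<ge> 1"
  shows
    "(\<forall>i\<ge>1. isomorphic_modules RR
        (Zplus_homology s (a(0 := b)) i)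
        (multiple_module b (koszul_homology {1..s} a i))) \<and>
     isomorphic_modules RR
        (Zplus_homology0 s (a(0 := b)))
        (quotient_module (module_on (*) UNIV) (colon (Idl\<^bsub>RR\<^esub> (a ` {1..s})) b)) \<and>
     (\<forall>(G :: int \<Rightarrow> 'a set) (dg :: nat \<Rightarrow> int).
        graded_ring G \<and> b \<in> G (dg 0) \<and> (\<forall>i\<in>{1..s}. a i \<in> G (dg i)) \<longrightarrow>
        (\<forall>i\<ge>1. \<exists>h \<in> module_iso RR
            (Zplus_homology s (a(0 := b)) i)
            (multiple_module b (koszul_homology {1..s} a i)).
          \<forall>d. h ` Zplus_homology_part G dg s (a(0 := b)) i d
              = multiple_part G dg {1..s} a b i (d + (int i + 1) * dg 0)))"
proof -
  define f where "f = a(0 := b)"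
  have f0: "f 0 = b" and fa: "\<And>l. l \<in> {1..s} \<Longrightarrow> f l = a l"
    by (simp_all add: f_def)
  have "{..s} = insert 0 {1..s}"
    by auto
  then have "f ` {..s} = insert b (a ` {1..s})"
    using f0 fa by (simp add: image_def) force
  then have "koszul_cycles {..s} f (Suc s) = {0}"
    using grade by (intro top_cycles_of_grade) simp
  then interpret approximation_complex s f
    by unfold_locales
  have H: "koszul_homology {1..s} a i = koszul_homology {1..s} f i" for i
    by (rule koszul_homology_cong) (simp add: fa)
  have I: "a ` {1..s} = f ` {1..s}"
    by (rule image_cong) (simp_all add: fa)
  have 1: "isomorphic_modules RR (Zplus_homology s f i) (multiple_module b (koszul_homology {1..s} a i))"
    if "1 \<le> i" for i
  proof -
    have "0 < i"
      using that by simp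
    from homology_iso[OF this, where R = RR] show ?thesis
      unfolding isomorphic_modules_def H f0 by (elim bexE) blast
  qed
  have 2: "isomorphic_modules RR (Zplus_homology0 s f)
      (quotient_module (module_on (*) UNIV) (colon (Idl\<^bsub>RR\<^esub> (a ` {1..s})) b))"
    using homology_0_iso[where R = RR] unfolding I f0 .
  have 3: "\<exists>h \<in> module_iso RR (Zplus_homology s f i) (multiple_module b (koszul_homology {1..s} a i)).
      \<forall>d. h ` Zplus_homology_part G dg s f i d = multiple_part G dg {1..s} a b i (d + (int i + 1) * dg 0)"
    if G: "graded_ring G" "b \<in> G (dg 0)" "\<forall>i\<in>{1..s}. a i \<in> G (dg i)" and i: "1 \<le> i" for G dg i
  proof -
    have "f l \<in> G (dg l)" if "l \<le> s" for l
      using G f0 fa[of l] that by (cases "l = 0") auto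
    then interpret graded_sequence s f G dg
      using G(1) by unfold_locales
    have "0 < i"
      using i by simp
    from homology_iso[OF this, where R = RR] obtain h
      where h: "h \<in> module_iso RR (Zplus_homology s f i) (multiple_module (f 0) (koszul_homology {1..s} f i))"
        "\<forall>c\<in>hcycles i. h (hclass i c) = koszul_class s f i (kscale (f 0) (psi i (neg_part c)))"
      by (elim bexE)
    have "h ` Zplus_homology_part G dg s f i d = multiple_part G dg {1..s} f (f 0) i (d + (int i + 1) * dg 0)" for d
      by (rule homology_iso_graded[OF \<open>0 < i\<close> bspec[OF h(2)]])
    moreover have "multiple_part G dg {1..s} a b i e = multiple_part G dg {1..s} f (f 0) i e" for e
      unfolding multiple_part_def koszul_homology_part_def H f0 ..
    ultimately show ?thesis
      using h(1) unfolding H f0 by (intro bexI[of _ h]) simp_all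
  qed
  show ?thesis
    unfolding f_def[symmetric]
  proof (intro conjI allI impI)
    fix i :: nat assume "1 \<le> i"
    then show "isomorphic_modules RR (Zplus_homology s f i) (multiple_module b (koszul_homology {1..s} a i))"
      by (rule 1)
  next
    show "isomorphic_modules RR (Zplus_homology0 s f)
        (quotient_module (module_on (*) UNIV) (colon (Idl\<^bsub>RR\<^esub> (a ` {1..s})) b))"
      by (rule 2)
  next
    fix G dg and i :: nat
    assume "graded_ring G \<and> b \<in> G (dg 0) \<and> (\<forall>i\<in>{1..s}. a i \<in> G (dg i))" and i: "1 \<le> i"
    then show "\<exists>h \<in> module_iso RR (Zplus_homology s f i) (multiple_module b (koszul_homology {1..s} a i)).
        \<forall>d. h ` Zplus_homology_part G dg s f i d = multiple_part G dg {1..s} a b i (d + (int i + 1) * dg 0)"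
      by (intro 3) simp_all
  qed
qed

end
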